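(* Let $F_1,\dots,F_4$ be fluxes which depend only on the traces of their arguments, are linear in their last argument, and satisfy the following conditions: (a) $\int_{\mathcal E}F_1(\rho_h,\mathbf v_h,\tau_h,\mathbf q_h,1)\,ds=-\int_{\mathcal E}[\![\rho_h\mathbf v_h]\!]\,ds$ for all $\rho_h,\tau_h\in\mathbb V$, $\mathbf v_h\in\mathbb V_0^d$, $\mathbf q_h\in\mathbb V_n$; (b) for all $\rho_h,\tau_h:[0,T]\to\mathbb V$, $\mathbf v_h:[0,T]\to\mathbb V_0^d$, $\mathbf q_h:[0,T]\to\mathbb V_n$ (sufficiently differentiable in time), $$\int_{\mathcal E}F_1(\rho_h,\mathbf v_h,\tau_h,\mathbf q_h,\tau_h)+F_2(\rho_h,\mathbf v_h,\tau_h,\mathbf q_h,\mathbf v_h)+[\![\rho_h\tau_h\mathbf v_h]\!]\,ds=0,$$ $$\int_{\mathcal E}F_3(\rho_h,\mathbf v_h,\tau_h,\mathbf q_h,\partial_t\rho_h)-\gamma D_tF_4(\rho_h,\mathbf v_h,\tau_h,\mathbf q_h,\mathbf q_h)+\gamma[\![\partial_t\rho_h\,\mathbf q_h]\!]\,ds=0,$$ where $D_tF_4(\rho_h,\mathbf v_h,\tau_h,\mathbf q_h,\mathbf Z)$ is the time derivative of $t\mapsto F_4(\rho_h(t),\mathbf v_h(t),\tau_h(t),\mathbf q_h(t),\mathbf Z)$ with $\mathbf Z$ held fixed in time, evaluated at $\mathbf Z=\mathbf q_h(t)$. Let $\rho_h^0,\mathbf v_h^0,\tau_h^0,\mathbf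 q_h^0$ be the $L^2$ projections of $\rho^0,\mathbf v^0,\tau^0,\mathbf q^0$ onto $\mathbb V,\mathbb V_0^d,\mathbb V,\mathbb V_n$ respectively, and let $\rho_h^{n+1},\tau_h^{n+1}\in\mathbb V$, $\mathbf v_h^{n+1}\in\mathbb V_0^d$, $\mathbf q_h^{n+1}\in\mathbb V_n$ ($0\le n\le N-1$) solve the fully discrete scheme $$0=\int_\Omega\Big(\frac{\rho_h^{n+1}-\rho_h^n}{k_n}+\operatorname{div}\big(\rho_h^{n+\frac12}\mathbf v_h^{n+\frac12}\big)\Big)\Psi\,dx+\int_{\mathcal E}F_1\big(\rho_h^{n+\frac12},\mathbf v_h^{n+\frac12},\tau_h^{n+\frac12},\mathbf q_h^{n+\frac12},\Psi\big)\,ds\quad\forall\Psi\in\mathbb V,$$ $$0=\int_\Omega\Big(\rho_h^{n+\frac12}\frac{\mathbf v_h^{n+1}-\mathbf v_h^n}{k_n}+\operatorname{div}\big(\rho_h^{n+\frac12}\mathbf v_h^{n+\frac12}\otimes\mathbf v_h^{n+\frac12}\big)-\operatorname{div}\big(\rho_h^{n+\frac12}\mathbf v_h^{n+\frac12}\big)\mathbf v_h^{n+\frac12}+\rho_h^{n+\frac12}\nabla\tau_h^{n+\frac12}-\tfrac12\rho_h^{n+\frac12}\nabla|\mathbf v_h^{n+\frac12}|^2\Big)^T\mathbf X\,dx$$ $$\qquad+\int_{\mathcal E}F_2\big(\rho_h^{n+\frac12},\mathbf v_h^{n+\frac12},\tau_h^{n+\frac12},\mathbf q_h^{n+\frac12},\mathbf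 X\big)\,ds+\mu B_h\big(\mathbf v_h^{n+\frac12},\mathbf X\big)\quad\forall\mathbf X\in\mathbb V_0^d,$$ $$0=\int_\Omega\Big(\tau_h^{n+\frac12}-\frac{W(\rho_h^{n+1})-W(\rho_h^n)}{\rho_h^{n+1}-\rho_h^n}+\gamma\operatorname{div}\mathbf q_h^{n+\frac12}-\tfrac14\big(|\mathbf v_h^{n+1}|^2+|\mathbf v_h^n|^2\big)\Big)\Xi\,dx+\int_{\mathcal E}F_3\big(\rho_h^{n+\frac12},\mathbf v_h^{n+\frac12},\tau_h^{n+\frac12},\mathbf q_h^{n+\frac12},\Xi\big)\,ds\quad\forall\Xi\in\mathbb V,$$ $$0=\int_\Omega\big(\mathbf q_h^{n+1}-\nabla\rho_h^{n+1}\big)^T\mathbf Z\,dx+\int_{\mathcal E}F_4\big(\rho_h^{n+1},\mathbf v_h^{n+1},\tau_h^{n+1},\mathbf q_h^{n+1},\mathbf Z\big)\,ds\quad\forall\mathbf Z\in\mathbb V_n.$$ Then the solution conserves mass, $$\int_\Omega\rho_h^n\,dx=\int_\Omega\rho_h^0\,dx\quad\text{for }0\le n\le N,$$ and satisfies the energy dissipation equality $$\int_\Omega W(\rho_h^{n+1})+\tfrac12\rho_h^{n+1}|\mathbf v_h^{n+1}|^2+\tfrac\gamma2|\mathbf q_h^{n+1}|^2\,dx-\int_\Omega W(\rho_h^{n})+\tfrac12\rho_h^{n}|\mathbf v_h^{n}|^2+\tfrac\gamma2|\mathbf q_h^{n}|^2\,dx=-\mu k_nB_h\big(\mathbf v_h^{n+\frac12},\mathbf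 v_h^{n+\frac12}\big).$$
   Context: $\Omega\subset\mathbb R^d$, $d\in\{1,2,3\}$, is a bounded domain with a conforming shape-regular triangulation $\mathcal T$ into open simplices (two closed simplices meet in a common full subsimplex or not at all, and the closed simplices cover $\overline\Omega$). $\mathcal E$ is the set (union) of interior interfaces between elements. The operators $\operatorname{div}$ and $\nabla$ are applied elementwise. $H^1(\mathcal T)$ is the broken Sobolev space of functions that are $H^1$ on each $K\in\mathcal T$; $H^1_0(\mathcal T)$ is its subspace of functions with zero trace on $\partial\Omega$; $H^1_n(\mathcal T)$ is the space of vector fields in $H^1(\mathcal T)^d$ with $\mathbf q^T\mathbf n=0$ on $\partial\Omega$ ($\mathbf n$ the outward normal). For a fixed degree $p$, $\mathbb V$ is the space of (discontinuous) piecewise polynomials of degree $p$ on $\mathcal T$; $\mathbb V_0:=\mathbb V\cap H^1_0(\mathcal T)$; $\mathbb V_n:=\mathbb V^d\cap H^1_n(\mathcal T)$. These spaces do not depend on time. On an interior interface shared by $K_1,K_2$ with outward normals $\mathbf n_{K_1},\mathbf n_{K_2}$, the jump of a vector field is the scalar $[\![\mathbf v]\!]=\mathbf v|_{K_1}^T\mathbf n_{K_1}+\mathbf v|_{K_2}^T\mathbf n_{K_2}$. The fluxes are maps $F_1,F_3:H^1(\mathcal T)\times H^1_0(\mathcal T)^d\times H^1(\mathcal T)\times H^1_n(\mathcal T)\times H^1(\mathcal T)\to L^2(\mathcal E)$, $F_2:H^1(\mathcal T)\times H^1_0(\mathcal T)^d\times H^1(\mathcal T)\times H^1_n(\mathcal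 T)\times H^1_0(\mathcal T)^d\to L^2(\mathcal E)$, $F_4:H^1(\mathcal T)\times H^1_0(\mathcal T)^d\times H^1(\mathcal T)\times H^1_n(\mathcal T)\times H^1_n(\mathcal T)\to L^2(\mathcal E)$. $0=t_0<\dots<t_N=T$ is a partition of $[0,T]$, $k_n:=t_{n+1}-t_n$, and $F^{n+\frac12}:=\frac12(F^n+F^{n+1})$. $W$ is a (smooth) double-well potential, $\gamma$ a capillarity coefficient, $\mu\ge0$ a viscosity coefficient, and $B_h:\mathbb V_0^d\times\mathbb V_0^d\to\mathbb R$ a bilinear form discretising the componentwise negative Laplacian. The data $\rho^0,\mathbf v^0$ are initial density and velocity, and $\tau^0,\mathbf q^0$ are initial values of the auxiliary variables $\tau=W'(\rho)-\gamma\operatorname{div}\mathbf q+\frac12|\mathbf v|^2$ and $\mathbf q=\nabla\rho$. The difference quotient of $W$ is understood as $W'(\rho_h^n)$ at points where $\rho_h^{n+1}=\rho_h^n$.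
   Formalization: The energy equality is stated only for F_4 whose interface integral is at most quadratic along lines of discrete states (ρ,v,τ,q), and for the first step n=0 only if the fourth scheme equation also holds at level 0; mass conservation is unrestricted. *)

theory Defs
  imports "HOL-Analysis.Analysis"
begin

type_synonym 'd sfield = "real^'d \<Rightarrow> real"
type_synonym 'd vfield = "real^'d \<Rightarrow> real^'d"


section \<open>Smooth functions, classical differential operators\<close>

primrec C_k :: "nat \<Rightarrow> ('a::euclidean_space \<Rightarrow> 'b::real_normed_vector) \<Rightarrow> bool" where
  "C_k 0 f = continuous_on UNIV f"
| "C_k (Suc k) f = ((\<forall>x. f differentiable at x) \<and>
      (\<forall>b\<in>Basis. C_k k (\<lambda>x. frechet_derivative f (at x) b)))"

definition smooth :: "('a::euclidean_space \<Rightarrow> 'b::real_normed_vector) \<Rightarrow> bool" where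
  "smooth f \<longleftrightarrow> (\<forall>k. C_k k f)"

text \<open>The elementwise operators are only ever evaluated on functions that are smooth on each
  (open) element, where they are the classical ones; the values off the elements concern a
  null set.\<close>

definition partial :: "'d::finite \<Rightarrow> (real^'d \<Rightarrow> 'b::real_normed_vector) \<Rightarrow> real^'d \<Rightarrow> 'b" where
  "partial i u x = frechet_derivative u (at x) (axis i 1)"

definition grad :: "'d::finite sfield \<Rightarrow> 'd vfield" where
  "grad u x = (\<chi> i. partial i u x)"

definition div_op :: "'d::finite vfield \<Rightarrow> 'd sfield" where
  "div_op v x = (\<Sum>i\<in>UNIV. partial i (\<lambda>y. v y $ i) x)"

definition div_tensor :: "(real^'d \<Rightarrow> real^'d^'d) \<Rightarrow> 'd::finite vfield" where
  "div_tensor A x = (\<chi> i. div_op (\<lambda>y. A y $ i) x)"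

definition outer :: "real^'d \<Rightarrow> real^'d \<Rightarrow> real^'d^'d" where
  "outer a b = (\<chi> i j. a $ i * b $ j)"


section \<open>Triangulations\<close>

definition conforming_triangulation :: "real \<Rightarrow> (real^'d) set \<Rightarrow> (real^'d::finite) set set \<Rightarrow> bool" where
  "conforming_triangulation \<sigma> \<Omega> \<T> \<longleftrightarrow>
     finite \<T> \<and>
     (\<forall>K\<in>\<T>. K \<subseteq> \<Omega> \<and> (\<exists>S. int CARD('d) simplex S \<and> K = interior S)) \<and>
     (\<forall>K\<in>\<T>. \<forall>L\<in>\<T>. (closure K \<inter> closure L) face_of closure K \<and>
                       (closure K \<inter> closure L) face_of closure L) \<and>
     (\<Union>K\<in>\<T>. closure K) = closure \<Omega> \<and>
     (\<forall>K\<in>\<T>. \<exists>c r. 0 < r \<and> ball c r \<subseteq> K \<and> diameter K \<le> \<sigma> * r)"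

definition interfaces :: "(real^'d) set \<Rightarrow> (real^'d) set set \<Rightarrow> (real^'d) set set" where
  "interfaces \<Omega> \<T> = {F. F \<inter> \<Omega> \<noteq> {} \<and>
     (\<exists>K\<in>\<T>. \<exists>L\<in>\<T>. K \<noteq> L \<and> F facet_of closure K \<and> F facet_of closure L)}"

definition outward_normal :: "(real^'d) set \<Rightarrow> (real^'d) set \<Rightarrow> real^'d" where
  "outward_normal K F = (THE n. norm n = 1 \<and> (\<forall>x\<in>F. \<forall>y\<in>F. n \<bullet> (x - y) = 0) \<and>
                                (\<forall>x\<in>F. \<forall>y\<in>K. n \<bullet> (y - x) < 0))"

text \<open>Surface measure of a facet $F$ with unit normal $n$: the $(d-1)$-dimensional measure of
  $A \subseteq F$ is the $d$-dimensional volume of the prism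
  $\{x + s n \mid x \in A,\ 0 \le s \le 1\}$ of height one.  Hence it is the image of Lebesgue
  measure on the prism over $F$ under orthogonal projection onto the hyperplane of $F$.
  For $d = 1$ this is the unit point mass.\<close>

definition facet_measure :: "(real^'d) set \<Rightarrow> (real^'d) measure" where
  "facet_measure F =
     (let n = (SOME n. norm n = 1 \<and> (\<forall>x\<in>F. \<forall>y\<in>F. n \<bullet> (x - y) = 0));
          a = (SOME a. a \<in> F)
      in distr (restrict_space lborel {x + s *\<^sub>R n | x s. x \<in> F \<and> s \<in> {0..1}}) borel
           (\<lambda>y. y - (n \<bullet> (y - a)) *\<^sub>R n))"

text \<open>A function on the interior skeleton is integrated facet by facet; the integrand may refer
  to the facet, which determines the two adjacent elements.\<close>

definition interface_integral ::
    "(real^'d) set \<Rightarrow> (real^'d) set set \<Rightarrow> ((real^'d) set \<Rightarrow> 'd sfield) \<Rightarrow> real" where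
  "interface_integral \<Omega> \<T> g = (\<Sum>F\<in>interfaces \<Omega> \<T>. LINT x|facet_measure F. g F x)"

definition L2_fun :: "'a measure \<Rightarrow> ('a \<Rightarrow> 'b::euclidean_space) \<Rightarrow> bool" where
  "L2_fun M f \<longleftrightarrow> f \<in> borel_measurable M \<and> integrable M (\<lambda>x. (norm (f x))\<^sup>2)"

definition L2_interfaces :: "(real^'d) set \<Rightarrow> (real^'d) set set \<Rightarrow> 'd sfield set" where
  "L2_interfaces \<Omega> \<T> = {g. \<forall>F\<in>interfaces \<Omega> \<T>. L2_fun (facet_measure F) g}"

definition AE_interfaces ::
    "(real^'d) set \<Rightarrow> (real^'d) set set \<Rightarrow> (real^'d \<Rightarrow> bool) \<Rightarrow> bool" where
  "AE_interfaces \<Omega> \<T> P \<longleftrightarrow> (\<forall>F\<in>interfaces \<Omega> \<T>. AE x in facet_measure F. P x)"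


section \<open>Sobolev spaces and traces\<close>

text \<open>All spaces are spaces of representatives; fields with values in \<open>real^'d\<close> give the
  $d$-fold product spaces.\<close>

definition test_function :: "(real^'d) set \<Rightarrow> 'd::finite sfield \<Rightarrow> bool" where
  "test_function U \<phi> \<longleftrightarrow> smooth \<phi> \<and> (\<exists>C. compact C \<and> C \<subseteq> U \<and> (\<forall>x. x \<notin> C \<longrightarrow> \<phi> x = 0))"

definition weak_partial ::
    "(real^'d) set \<Rightarrow> 'd::finite \<Rightarrow> (real^'d \<Rightarrow> 'b::euclidean_space) \<Rightarrow> (real^'d \<Rightarrow> 'b) \<Rightarrow> bool" where
  "weak_partial U i u g \<longleftrightarrow> L2_fun (lebesgue_on U) u \<and> L2_fun (lebesgue_on U) g \<and>
     (\<forall>\<phi>. test_function U \<phi> \<longrightarrow>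
        (LINT x|lebesgue_on U. partial i \<phi> x *\<^sub>R u x) = - (LINT x|lebesgue_on U. \<phi> x *\<^sub>R g x))"

definition weak_div :: "(real^'d) set \<Rightarrow> 'd::finite vfield \<Rightarrow> 'd sfield \<Rightarrow> bool" where
  "weak_div U v z \<longleftrightarrow> L2_fun (lebesgue_on U) v \<and> L2_fun (lebesgue_on U) z \<and>
     (\<forall>\<phi>. test_function U \<phi> \<longrightarrow>
        (LINT x|lebesgue_on U. grad \<phi> x \<bullet> v x) = - (LINT x|lebesgue_on U. \<phi> x * z x))"

definition H1 :: "(real^'d) set \<Rightarrow> (real^'d::finite \<Rightarrow> 'b::euclidean_space) set" where
  "H1 U = {u. \<forall>i. \<exists>g. weak_partial U i u g}"

definition broken_H1 :: "(real^'d) set set \<Rightarrow> (real^'d::finite \<Rightarrow> 'b::euclidean_space) set" where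
  "broken_H1 \<T> = {u. \<forall>K\<in>\<T>. u \<in> H1 K}"

text \<open>The trace on a facet \<open>F\<close> of \<open>K\<close> is the $L^2(F)$-limit of restrictions of smooth functions
  that converge in $H^1(K)$; it is unique up to null sets.\<close>

definition is_trace ::
    "(real^'d) set \<Rightarrow> (real^'d) set \<Rightarrow> (real^'d::finite \<Rightarrow> 'b::euclidean_space) \<Rightarrow> (real^'d \<Rightarrow> 'b) \<Rightarrow> bool" where
  "is_trace K F u w \<longleftrightarrow> L2_fun (facet_measure F) w \<and>
     (\<exists>g \<phi>. (\<forall>i. weak_partial K i u (g i)) \<and> (\<forall>j::nat. smooth (\<phi> j)) \<and>
        (\<lambda>j. LINT x|lebesgue_on K. (norm (\<phi> j x - u x))\<^sup>2) \<longlonglongrightarrow> 0 \<and>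
        (\<forall>i. (\<lambda>j. LINT x|lebesgue_on K. (norm (partial i (\<phi> j) x - g i x))\<^sup>2) \<longlonglongrightarrow> 0) \<and>
        (\<lambda>j. LINT x|facet_measure F. (norm (\<phi> j x - w x))\<^sup>2) \<longlonglongrightarrow> 0)"

definition trace_on ::
    "(real^'d) set \<Rightarrow> (real^'d) set \<Rightarrow> (real^'d::finite \<Rightarrow> 'b::euclidean_space) \<Rightarrow> real^'d \<Rightarrow> 'b" where
  "trace_on K F u = (SOME w. is_trace K F u w)"

definition broken_H10 ::
    "(real^'d) set \<Rightarrow> (real^'d) set set \<Rightarrow> (real^'d::finite \<Rightarrow> 'b::euclidean_space) set" where
  "broken_H10 \<Omega> \<T> = {u \<in> broken_H1 \<T>. \<forall>K\<in>\<T>. \<forall>F. F facet_of closure K \<longrightarrow>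
     (AE x in facet_measure F. x \<in> frontier \<Omega> \<longrightarrow> trace_on K F u x = 0)}"

definition broken_H1n :: "(real^'d) set \<Rightarrow> (real^'d) set set \<Rightarrow> 'd::finite vfield set" where
  "broken_H1n \<Omega> \<T> = {q \<in> broken_H1 \<T>. \<forall>K\<in>\<T>. \<forall>F. F facet_of closure K \<longrightarrow>
     (AE x in facet_measure F. x \<in> frontier \<Omega> \<longrightarrow> trace_on K F q x \<bullet> outward_normal K F = 0)}"

definition same_traces ::
    "(real^'d) set set \<Rightarrow> (real^'d::finite \<Rightarrow> 'b::euclidean_space) \<Rightarrow> (real^'d \<Rightarrow> 'b) \<Rightarrow> bool" where
  "same_traces \<T> u w \<longleftrightarrow> (\<forall>K\<in>\<T>. \<forall>F. F facet_of closure K \<longrightarrow>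
     (AE x in facet_measure F. trace_on K F u x = trace_on K F w x))"

text \<open>On an interior interface the sum has exactly two terms.\<close>

definition jump :: "(real^'d) set set \<Rightarrow> 'd::finite vfield \<Rightarrow> (real^'d) set \<Rightarrow> 'd sfield" where
  "jump \<T> v F x = (\<Sum>K | K \<in> \<T> \<and> F facet_of closure K. trace_on K F v x \<bullet> outward_normal K F)"


section \<open>Finite element spaces\<close>

definition polynomial_deg :: "nat \<Rightarrow> (real^'d::finite \<Rightarrow> 'b::euclidean_space) \<Rightarrow> bool" where
  "polynomial_deg p f \<longleftrightarrow> (\<exists>c. \<forall>x. f x =
     (\<Sum>\<alpha> | (\<Sum>i\<in>UNIV. \<alpha> i) \<le> p. (\<Prod>i\<in>UNIV. (x $ i) ^ \<alpha> i) *\<^sub>R c \<alpha>))"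

definition V_space :: "nat \<Rightarrow> (real^'d) set set \<Rightarrow> (real^'d::finite \<Rightarrow> 'b::euclidean_space) set" where
  "V_space p \<T> = {u. \<forall>K\<in>\<T>. \<exists>f. polynomial_deg p f \<and> (\<forall>x\<in>K. u x = f x)}"

definition V0_space ::
    "nat \<Rightarrow> (real^'d) set \<Rightarrow> (real^'d) set set \<Rightarrow> (real^'d::finite \<Rightarrow> 'b::euclidean_space) set" where
  "V0_space p \<Omega> \<T> = V_space p \<T> \<inter> broken_H10 \<Omega> \<T>"

definition Vn_space :: "nat \<Rightarrow> (real^'d) set \<Rightarrow> (real^'d) set set \<Rightarrow> 'd::finite vfield set" where
  "Vn_space p \<Omega> \<T> = V_space p \<T> \<inter> broken_H1n \<Omega> \<T>"

definition L2_projection ::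
    "(real^'d) set \<Rightarrow> (real^'d::finite \<Rightarrow> 'b::euclidean_space) set \<Rightarrow> (real^'d \<Rightarrow> 'b) \<Rightarrow> (real^'d \<Rightarrow> 'b) \<Rightarrow> bool" where
  "L2_projection \<Omega> X u uh \<longleftrightarrow> L2_fun (lebesgue_on \<Omega>) u \<and> uh \<in> X \<and>
     (\<forall>\<Phi>\<in>X. (LINT x|lebesgue_on \<Omega>. (u x - uh x) \<bullet> \<Phi> x) = 0)"

text \<open>The form is defined on classes of functions, so it must not see the values off the
  elements.\<close>

definition bilinear_form :: "(real^'d) set set \<Rightarrow> 'd vfield set \<Rightarrow> ('d vfield \<Rightarrow> 'd vfield \<Rightarrow> real) \<Rightarrow> bool" where
  "bilinear_form \<T> X B \<longleftrightarrow>
     (\<forall>u\<in>X. \<forall>w\<in>X. \<forall>y\<in>X. \<forall>a b.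
        B (\<lambda>x. a *\<^sub>R u x + b *\<^sub>R w x) y = a * B u y + b * B w y \<and>
        B y (\<lambda>x. a *\<^sub>R u x + b *\<^sub>R w x) = a * B y u + b * B y w) \<and>
     (\<forall>u\<in>X. \<forall>u'\<in>X. \<forall>w\<in>X. \<forall>w'\<in>X.
        (\<forall>K\<in>\<T>. \<forall>x\<in>K. u x = u' x \<and> w x = w' x) \<longrightarrow> B u w = B u' w')"


section \<open>Fluxes\<close>

type_synonym ('d, 'b) flux =
  "'d sfield \<Rightarrow> 'd vfield \<Rightarrow> 'd sfield \<Rightarrow> 'd vfield \<Rightarrow> (real^'d \<Rightarrow> 'b) \<Rightarrow> 'd sfield"

text \<open>\<open>Y\<close> is the space of the last argument.  The three conjuncts after the typing say that the
  class of the flux in $L^2(\mathcal E)$ depends only on the traces of the five arguments and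
  linearly on the last one.\<close>

definition trace_flux ::
    "(real^'d) set \<Rightarrow> (real^'d) set set \<Rightarrow> (real^'d::finite \<Rightarrow> 'b::euclidean_space) set \<Rightarrow> ('d, 'b) flux \<Rightarrow> bool" where
  "trace_flux \<Omega> \<T> Y F \<longleftrightarrow>
     (\<forall>\<rho>\<in>broken_H1 \<T>. \<forall>v\<in>broken_H10 \<Omega> \<T>. \<forall>\<tau>\<in>broken_H1 \<T>. \<forall>q\<in>broken_H1n \<Omega> \<T>. \<forall>y\<in>Y.
        F \<rho> v \<tau> q y \<in> L2_interfaces \<Omega> \<T> \<and>
        (\<forall>\<rho>'\<in>broken_H1 \<T>. \<forall>v'\<in>broken_H10 \<Omega> \<T>. \<forall>\<tau>'\<in>broken_H1 \<T>. \<forall>q'\<in>broken_H1n \<Omega> \<T>. \<forall>y'\<in>Y.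
           same_traces \<T> \<rho> \<rho>' \<and> same_traces \<T> v v' \<and> same_traces \<T> \<tau> \<tau>' \<and>
           same_traces \<T> q q' \<and> same_traces \<T> y y' \<longrightarrow>
           AE_interfaces \<Omega> \<T> (\<lambda>x. F \<rho> v \<tau> q y x = F \<rho>' v' \<tau>' q' y' x)) \<and>
        (\<forall>y'\<in>Y. \<forall>a b. AE_interfaces \<Omega> \<T> (\<lambda>x.
           F \<rho> v \<tau> q (\<lambda>z. a *\<^sub>R y z + b *\<^sub>R y' z) x = a * F \<rho> v \<tau> q y x + b * F \<rho> v \<tau> q y' x)))"

text \<open>Along every line in the space of discrete states \<open>(\<rho>, v, \<tau>, q)\<close> the integrated flux is a
  polynomial of degree at most two; this contains all fluxes that are affine in the state.  For
  such a flux the increment between two states equals the derivative at their midpoint, which is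
  what links a condition on the time derivative of the flux to differences between time levels.\<close>

definition quadratic_in_state ::
    "nat \<Rightarrow> (real^'d) set \<Rightarrow> (real^'d::finite) set set \<Rightarrow> ('d, real^'d) flux \<Rightarrow> bool" where
  "quadratic_in_state p \<Omega> \<T> F \<longleftrightarrow>
     (\<forall>\<rho>\<in>V_space p \<T>. \<forall>v\<in>V0_space p \<Omega> \<T>. \<forall>\<tau>\<in>V_space p \<T>. \<forall>q\<in>Vn_space p \<Omega> \<T>.
      \<forall>\<rho>'\<in>V_space p \<T>. \<forall>v'\<in>V0_space p \<Omega> \<T>. \<forall>\<tau>'\<in>V_space p \<T>. \<forall>q'\<in>Vn_space p \<Omega> \<T>.
      \<forall>Z\<in>Vn_space p \<Omega> \<T>. \<exists>a b c. \<forall>s.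
        interface_integral \<Omega> \<T> (\<lambda>_. F (\<lambda>x. \<rho> x + s * \<rho>' x) (\<lambda>x. v x + s *\<^sub>R v' x)
            (\<lambda>x. \<tau> x + s * \<tau>' x) (\<lambda>x. q x + s *\<^sub>R q' x) Z)
          = a + b * s + c * s\<^sup>2)"


section \<open>Time dependence\<close>

definition dt :: "real \<Rightarrow> (real \<Rightarrow> real^'d \<Rightarrow> 'b::real_normed_vector) \<Rightarrow> real \<Rightarrow> real^'d \<Rightarrow> 'b" where
  "dt T u t x = vector_derivative (\<lambda>s. u s x) (at t within {0..T})"

text \<open>Infinitely differentiable maps from \<open>{0..T}\<close> into the space \<open>X\<close>.  As the restrictions to
  the elements of the functions in \<open>X\<close> form a finite-dimensional space, differentiability may be
  tested pointwise on the elements.\<close>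

definition smooth_path ::
    "real \<Rightarrow> (real^'d) set set \<Rightarrow> (real^'d \<Rightarrow> 'b::real_normed_vector) set \<Rightarrow> (real \<Rightarrow> real^'d \<Rightarrow> 'b) \<Rightarrow> bool" where
  "smooth_path T \<T> X u \<longleftrightarrow> (\<exists>D :: nat \<Rightarrow> real \<Rightarrow> real^'d \<Rightarrow> 'b. D 0 = u \<and>
     (\<forall>j. \<forall>t\<in>{0..T}. D j t \<in> X \<and>
        (\<forall>K\<in>\<T>. \<forall>x\<in>K. ((\<lambda>s. D j s x) has_vector_derivative D (Suc j) t x) (at t within {0..T}))))"

text \<open>Time derivative of a curve in $L^2(\mathcal E)$.\<close>

definition has_L2_derivative ::
    "(real^'d) set \<Rightarrow> (real^'d) set set \<Rightarrow> real \<Rightarrow> (real \<Rightarrow> 'd sfield) \<Rightarrow> 'd sfield \<Rightarrow> real \<Rightarrow> bool" where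
  "has_L2_derivative \<Omega> \<T> T g D t \<longleftrightarrow> D \<in> L2_interfaces \<Omega> \<T> \<and>
     ((\<lambda>s. interface_integral \<Omega> \<T> (\<lambda>_ x. ((g s x - g t x) / (s - t) - D x)\<^sup>2)) \<longlongrightarrow> 0)
       (at t within {0..T})"


section \<open>Ingredients of the scheme\<close>

text \<open>Smooth, with at least two wells.\<close>

definition double_well :: "(real \<Rightarrow> real) \<Rightarrow> bool" where
  "double_well W \<longleftrightarrow> smooth W \<and> (\<exists>a b. a \<noteq> b \<and>
     (\<forall>\<^sub>F r in at a. W a < W r) \<and> (\<forall>\<^sub>F r in at b. W b < W r))"

definition diff_quot :: "(real \<Rightarrow> real) \<Rightarrow> real \<Rightarrow> real \<Rightarrow> real" where
  "diff_quot W a b = (if a = b then deriv W a else (W b - W a) / (b - a))"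

definition half :: "(nat \<Rightarrow> real^'d \<Rightarrow> 'b::real_vector) \<Rightarrow> nat \<Rightarrow> real^'d \<Rightarrow> 'b" where
  "half u n x = (1 / 2) *\<^sub>R (u n x + u (Suc n) x)"

definition energy :: "(real^'d) set \<Rightarrow> (real \<Rightarrow> real) \<Rightarrow> real \<Rightarrow> 'd sfield \<Rightarrow> 'd vfield \<Rightarrow> 'd vfield \<Rightarrow> real" where
  "energy \<Omega> W \<gamma> \<rho> v q = (LINT x|lebesgue_on \<Omega>.
     W (\<rho> x) + 1/2 * \<rho> x * (norm (v x))\<^sup>2 + \<gamma>/2 * (norm (q x))\<^sup>2)"

text \<open>The discrete version of \<open>q = \<nabla>\<rho>\<close>.\<close>

definition discrete_gradient_eq ::
    "nat \<Rightarrow> (real^'d) set \<Rightarrow> (real^'d::finite) set set \<Rightarrow> ('d, real^'d) flux \<Rightarrow>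
     'd sfield \<Rightarrow> 'd vfield \<Rightarrow> 'd sfield \<Rightarrow> 'd vfield \<Rightarrow> bool" where
  "discrete_gradient_eq p \<Omega> \<T> F \<rho> v \<tau> q \<longleftrightarrow> (\<forall>Z\<in>Vn_space p \<Omega> \<T>.
     0 = (LINT x|lebesgue_on \<Omega>. (q x - grad \<rho> x) \<bullet> Z x)
         + interface_integral \<Omega> \<T> (\<lambda>_. F \<rho> v \<tau> q Z))"

end

theory Submission
  imports Defs
begin

text \<open>Both conclusions come from testing the scheme with suitable discrete functions.  Write \<open>\<delta>u\<close> for
the increment of \<open>u\<close> over a time step.

Mass: for the test function \<open>1\<close> the elementwise divergence integrates to the jump of the midpoint
mass flux over the interior interfaces, and by \<open>cond_a\<close> the flux \<open>F1\<close> cancels it.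

Energy: the continuity equation is tested with the midpoint of \<open>\<tau>\<close>, the momentum equation with
that of \<open>v\<close>, the equation for \<open>\<tau>\<close> with \<open>\<delta>\<rho>\<close>, and the difference of the gradient equations at
the two time levels with the midpoint of \<open>q\<close>.  The increment of a square is twice the increment
times the midpoint, and the difference quotient of \<open>W\<close> times \<open>\<delta>\<rho>\<close> is \<open>\<delta>W\<close>, so the sum of the
tested equations is the increment of the energy plus the viscous term plus surface terms.  The
convective terms drop out pointwise (\<open>convective_terms_cancel\<close>).  The surface terms produced by
integration by parts are jumps, which \<open>cond_b1\<close> and \<open>cond_b2\<close> match with the fluxes.  This
elimination is \<open>energy_balance\<close>.  Now \<open>cond_b2\<close> speaks of a time derivative of \<open>F4\<close>, while the
scheme contains its increment.  Along the straight line from the old to the new state the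
integrated flux is a quadratic polynomial, whose increment over an interval is the length of the
interval times its derivative at the midpoint, and the derivative of the integrated flux is the
integral of its derivative in \<open>L\<^sup>2\<close> (\<open>interface_integral_L2_derivative\<close>).

The analytic core is therefore integration by parts on each simplex, with the surface measure of
a facet given as the volume of a prism and with boundary values given as limits in \<open>L\<^sup>2\<close>.

  \<^item> For a radial field \<open>(x - a) g(x)\<close>, where \<open>a\<close> is a vertex, the divergence theorem follows by
    differentiating the integral of \<open>g\<close> over dilated copies of the simplex in two ways
    (\<open>integral_cone_divergence\<close>).  One of them is a substitution that maps the prism over the
    opposite facet onto a layer of the cone; its derivative is a rank-one perturbation of a
    multiple of the identity.

  \<^item> Every constant vector is a combination of the fields \<open>x - a\<close> with constant coefficients, and
    this yields the divergence theorem for all \<open>C\<^sup>1\<close> functions (\<open>gauss_simplex\<close>).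

  \<^item> Applied to the squared norm of a function, the radial case bounds its boundary values by its
    \<open>H\<^sup>1\<close> norm (\<open>trace_inequality\<close>).  Hence the trace of a polynomial is its restriction
    (\<open>trace_smooth_unique\<close>).

  \<^item> A facet of an element that meets the domain is shared by another element
    (\<open>facet_in_interfaces\<close>), so the sum of the elementwise identities is an integral of jumps
    (\<open>broken_gauss\<close>).\<close>

section \<open>Substitution by rank-one perturbations of the identity\<close>

text \<open>The substitution rule for multiple integrals is formulated for well-ordered index types, although
the order of the coordinates is irrelevant to it.  This well-ordered type has as many elements as
\<open>'d\<close>, so that the rule can be carried over to \<open>real^'d\<close> along a bijection of the indices.\<close>

typedef (overloaded) 'd rank_index = "{..<CARD('d::finite)}" morphisms rank_of of_rank
  by (rule exI[of _ 0]) auto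
instance rank_index :: (finite) finite
proof
  have "inj (rank_of :: 'a rank_index \<Rightarrow> nat)" by (simp add: inj_on_def rank_of_inject)
  moreover have "range (rank_of :: 'a rank_index \<Rightarrow> nat) \<subseteq> {..<CARD('a)}" using rank_of by auto
  ultimately show "finite (UNIV :: 'a rank_index set)"
    by (meson finite_imageD finite_lessThan finite_subset)
qed
instantiation rank_index :: (finite) wellorder
begin
definition "x \<le> y \<longleftrightarrow> rank_of x \<le> rank_of y"
definition "x < y \<longleftrightarrow> rank_of x < rank_of y"
instance
proof
  fix P :: "'a rank_index \<Rightarrow> bool" and a :: "'a rank_index"
  assume step: "\<And>x. (\<And>y. y < x \<Longrightarrow> P y) \<Longrightarrow> P x"
  have "\<forall>a. rank_of a = k \<longrightarrow> P a" for k
    by (induction k rule: less_induct) (metis step less_rank_index_def)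
  then show "P a" by blast
qed (auto simp: less_eq_rank_index_def less_rank_index_def rank_of_inject)
end

text \<open>The perturbation \<open>u $ i *s w\<close> is switched on one row at a time.  The determinant is affine in row
\<open>i\<close>, and once that row is replaced by \<open>w\<close>, row operations remove the perturbation from all other
rows; so each step adds \<open>u $ i * w $ i\<close>.\<close>

lemma det_mat_plus_rank_one:
  fixes u w :: "real^'n"
  shows "det (\<chi> i j. (if i = j then 1 else 0) + u $ i * w $ j) = 1 + w \<bullet> u"
proof -
  let ?M = "\<lambda>S. (\<chi> i. (if i \<in> S then axis i 1 + u $ i *s w else axis i 1)) :: real^'n^'n"
  have "det (?M S) = 1 + (\<Sum>i\<in>S. u $ i * w $ i)" if "finite S" for S
    using that
  proof (induction S)
    case empty
    have "?M {} = mat 1" by (simp add: vec_eq_iff mat_def axis_def)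
    then show ?case by simp
  next
    case (insert k S)
    let ?c = "\<lambda>i. if i \<in> S then axis i 1 + u $ i *s w else axis i 1"
    have split: "?M (insert k S) = (\<chi> i. if i = k then axis k 1 + u $ k *s w else ?c i)"
      by (simp add: vec_eq_iff)
    have 1: "(\<chi> i. if i = k then axis k 1 else ?c i) = ?M S"
      using insert by (simp add: vec_eq_iff)
    have 2: "det (\<chi> i. if i = k then w else ?c i) = w $ k"
    proof -
      have "det (\<chi> i. if i = k then w else if i \<in> R then axis i 1 + u $ i *s w else axis i 1) = w $ k"
        if "finite R" "k \<notin> R" for R
        using that
      proof (induction R)
        case empty
        have w: "w = (\<Sum>i\<in>UNIV. w $ i *s row i (mat 1 :: real^'n^'n))"
          by (simp add: vec_eq_iff row_def mat_def if_distrib cong: if_cong)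
        have "(\<chi> i. if i = k then w else axis i 1) = 
              ((\<chi> i. if i = k then sum (\<lambda>i. w$i *s row i (mat 1)) UNIV else row i (mat 1))::real^'n^'n)"
          by (subst w) (simp add: vec_eq_iff row_def mat_def axis_def)
        then have "det (\<chi> i. if i = k then w else axis i 1) = w $ k"
          by (simp only: cramer_lemma_transpose) simp
        then show ?case by (simp only: empty_iff if_False)
      next
        case (insert l R)
        let ?A = "(\<chi> i. if i = k then w else if i \<in> R then axis i 1 + u $ i *s w else axis i 1) :: real^'n^'n"
        have kl: "l \<noteq> k" "l \<notin> R" using insert.hyps insert.prems by auto
        have "det (\<chi> i. if i = l then row l ?A + u $ l *s row k ?A else row i ?A) = det ?A"
          by (rule det_row_operation[OF kl(1)])
        moreover have "(\<chi> i. if i = k then w else if i \<in> insert l R then axis i 1 + u $ i *s w else axis i 1)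
            = (\<chi> i. if i = l then row l ?A + u $ l *s row k ?A else row i ?A)"
          by (rule vec_eq_iff[THEN iffD2]) (use kl in \<open>auto simp: row_def vec_eq_iff\<close>)
        moreover have "det ?A = w $ k" using insert by blast
        ultimately show ?case by (simp only:)
      qed
      then show ?thesis using insert by blast
    qed
    have "det (?M (insert k S)) = det (\<chi> i. if i = k then axis k 1 else ?c i)
        + det (\<chi> i. if i = k then u $ k *s w else ?c i)"
      unfolding split by (rule det_row_add)
    also have "det (\<chi> i. if i = k then u $ k *s w else ?c i) = u $ k * w $ k"
      using 2 by (simp only: det_row_mul)
    finally show ?case using insert 1 by simp
  qed
  from this[of UNIV] have "det (?M UNIV) = 1 + w \<bullet> u"
    by (simp add: inner_vec_def mult.commute)
  moreover have "?M UNIV = (\<chi> i j. (if i = j then 1 else 0) + u $ i * w $ j)"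
    by (auto simp: vec_eq_iff axis_def)
  ultimately show ?thesis by simp
qed

lemma det_scaled_plus_rank_one:
  fixes c w :: "real^'n"
  assumes "s \<noteq> 0"
  shows "det (matrix (\<lambda>x. s *\<^sub>R x + (w \<bullet> x) *\<^sub>R c)) = s ^ (CARD('n) - 1) * (s + w \<bullet> c)"
proof -
  have "matrix (\<lambda>x. s *\<^sub>R x + (w \<bullet> x) *\<^sub>R c)
     = (\<chi> i. s *s (\<chi> j. (if i = j then 1 else 0) + (c /\<^sub>R s) $ i * w $ j))"
    using assms by (simp add: matrix_def vec_eq_iff inner_axis) (auto simp: axis_def field_simps)
  then have "det (matrix (\<lambda>x. s *\<^sub>R x + (w \<bullet> x) *\<^sub>R c)) = 
      (\<Prod>i\<in>(UNIV::'n set). s) * det (\<chi> i j. (if i = j then 1 else 0) + (c /\<^sub>R s) $ i * w $ j)"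
    by (simp only: det_rows_mul)
  also have "\<dots> = s ^ CARD('n) * (1 + w \<bullet> (c /\<^sub>R s))"
    by (subst det_mat_plus_rank_one) simp
  also have "\<dots> = s ^ (CARD('n) - 1) * (s + w \<bullet> c)"
    using assms by (cases "CARD('n)") (auto simp: field_simps)
  finally show ?thesis .
qed

lemma prod_Basis_cart: "(\<Prod>b\<in>(Basis::(real^'n) set). f (x \<bullet> b)) = (\<Prod>i\<in>UNIV. f (x $ i))"
proof -
  have "bij_betw (\<lambda>i. axis i (1::real)) (UNIV::'n set) Basis"
    by (auto simp: bij_betw_def inj_on_def axis_eq_axis Basis_vec_def)
  from prod.reindex_bij_betw[OF this, of "\<lambda>b. f (x \<bullet> b)"] show ?thesis
    by (simp add: inner_axis)
qed

lemma lborel_relabel: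
  fixes e :: "'m::finite \<Rightarrow> 'd::finite"
  assumes e: "bij e"
  shows "distr lborel borel (\<lambda>x::real^'d. \<chi> i. x $ e i) = lborel"
proof (rule lborel_eqI[symmetric])
  let ?L = "\<lambda>x::real^'d. \<chi> i. x $ e i"
  fix l u :: "real^'m" assume "\<And>b. b \<in> Basis \<Longrightarrow> l \<bullet> b \<le> u \<bullet> b"
  then have le: "l $ i \<le> u $ i" for i
    by (auto simp: cart_eq_inner_axis)
  let ?l = "(\<chi> j. l $ inv e j)" and ?u = "(\<chi> j. u $ inv e j)"
  have m: "?L \<in> borel_measurable borel"
    by (intro borel_measurable_continuous_onI continuous_intros continuous_on_vec_lambda)
  have "?L -` box l u = box ?l ?u"
    proof -
    have "(\<forall>i. P (x $ e i) i) \<longleftrightarrow> (\<forall>j. P (x $ j) (inv e j))" for P and x :: "real^'d"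
      by (metis e bij_inv_eq_iff)
    from this[of "\<lambda>t i. l $ i < t \<and> t < u $ i"] show ?thesis
      by (auto simp: mem_box_cart)
  qed
  then have "emeasure (distr lborel borel ?L) (box l u) = emeasure lborel (box ?l ?u)"
    using m by (simp add: emeasure_distr)
  also have "\<dots> = ennreal (\<Prod>b\<in>Basis. (?u - ?l) \<bullet> b)"
    by (rule emeasure_lborel_box) (auto simp: Basis_vec_def inner_axis le)
  also have "(\<Prod>b\<in>Basis. (?u - ?l) \<bullet> b) = (\<Prod>j\<in>UNIV. (u - l) $ inv e j)"
    using prod_Basis_cart[of "\<lambda>t. t" "?u - ?l"] by simp
  also have "\<dots> = (\<Prod>j\<in>UNIV. (u - l) $ j)"
    using e prod.reindex_bij_betw[OF bij_imp_bij_inv[OF e], of "\<lambda>j. (u - l) $ j"] by simp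
  also have "\<dots> = (\<Prod>b\<in>Basis. (u - l) \<bullet> b)"
    using prod_Basis_cart[of "\<lambda>t. t" "u - l"] by simp
  finally show "emeasure (distr lborel borel ?L) (box l u) = ennreal (prod ((\<bullet>) (u - l)) Basis)" .
qed simp

lemma absolutely_integrable_lborelI:
  fixes f :: "'a::euclidean_space \<Rightarrow> 'b::euclidean_space"
  assumes "set_integrable lborel S f"
  shows "f absolutely_integrable_on S"
  using assms integrable_completion[of "\<lambda>x. indicator S x *\<^sub>R f x" lborel]
  by (simp add: set_integrable_def borel_measurable_integrable)

text \<open>The maps that sweep out a cone from its base have derivatives of the form
\<open>w \<mapsto> s w + (m \<bullet> w) c\<close>, whose determinant is explicit.  Relabelling the coordinates is a
volume-preserving isometry, so this form of the derivative survives the passage to the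
well-ordered index type in which the substitution is carried out.\<close>

lemma integral_rank_one_substitution:
  fixes G :: "real^'d::finite \<Rightarrow> real^'d" and f :: "real^'d \<Rightarrow> real"
  assumes S: "S \<in> sets borel" and GS: "G ` S \<in> sets borel"
    and der: "\<And>x. x \<in> S \<Longrightarrow> (G has_derivative (\<lambda>w. s x *\<^sub>R w + (m \<bullet> w) *\<^sub>R c x)) (at x within S)"
    and nz: "\<And>x. x \<in> S \<Longrightarrow> s x \<noteq> 0"
    and inj: "inj_on G S"
    and f: "f \<in> borel_measurable borel" "set_integrable lborel (G ` S) f"
    and meas: "(\<lambda>x. \<bar>s x ^ (CARD('d) - 1) * (s x + m \<bullet> c x)\<bar> * f (G x)) \<in> borel_measurable borel"
  shows "(LINT x:G ` S|lborel. f x)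
    = (LINT x:S|lborel. \<bar>s x ^ (CARD('d) - 1) * (s x + m \<bullet> c x)\<bar> * f (G x))"
proof -
  have card: "CARD('d rank_index) = CARD('d)"
    using type_definition.card[OF type_definition_rank_index] by simp
  then obtain e :: "'d rank_index \<Rightarrow> 'd" where e: "bij e"
    using finite_same_card_bij[of "UNIV :: 'd rank_index set" "UNIV :: 'd set"] by auto
  define L where "L = (\<lambda>x::real^'d. (\<chi> i. x $ e i))"
  define L' where "L' = (\<lambda>y::real^'d rank_index. (\<chi> j. y $ inv e j))"
  have LL' [simp]: "L (L' y) = y" "L' (L x) = x" for x y
    using e by (auto simp: L_def L'_def vec_eq_iff bij_is_inj bij_is_surj surj_f_inv_f)
  have mem: "y \<in> L ` A \<longleftrightarrow> L' y \<in> A" for y A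
    by (metis (no_types) LL'(1) LL'(2) image_iff)
  have lin: "bounded_linear L" "bounded_linear L'"
    unfolding linear_conv_bounded_linear[symmetric]
    by (auto intro!: linearI simp: L_def L'_def vec_eq_iff)
  have mL: "L \<in> borel_measurable borel" "L' \<in> borel_measurable borel"
    using lin by (auto intro!: borel_measurable_continuous_onI linear_continuous_on)
  have inner: "L x \<bullet> L y = x \<bullet> y" for x y
    unfolding L_def inner_vec_def using sum.reindex_bij_betw[OF e, of "\<lambda>j. x $ j * y $ j"] by simp
  have inner': "m \<bullet> L' y = L m \<bullet> y" for y
    using inner[of m "L' y"] by simp
  have D': "distr lborel borel L' = lborel"
    unfolding L'_def by (rule lborel_relabel[OF bij_imp_bij_inv[OF e]])
  have tr: "(LINT x:A|lborel. h x) = (LINT y:L ` A|lborel. h (L' y))"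
      "set_integrable lborel A h \<longleftrightarrow> set_integrable lborel (L ` A) (\<lambda>y. h (L' y))"
      "L ` A \<in> sets borel"
    if "A \<in> sets borel" "h \<in> borel_measurable borel" for A and h :: "real^'d \<Rightarrow> real"
  proof -
    have m: "(\<lambda>x. indicator A x *\<^sub>R h x) \<in> borel_measurable borel" using that by measurable
    have i: "(indicator A (L' y) :: real) = indicator (L ` A) y" for y
      by (simp add: indicator_def mem)
    have "L ` A = L' -` A" by (auto simp: mem)
    then show "L ` A \<in> sets borel"
      using measurable_sets[OF mL(2) that(1)] by simp
    show "(LINT x:A|lborel. h x) = (LINT y:L ` A|lborel. h (L' y))"
      unfolding set_lebesgue_integral_def
      by (subst D'[symmetric], subst integral_distr) (use mL m i in auto)
    show "set_integrable lborel A h \<longleftrightarrow> set_integrable lborel (L ` A) (\<lambda>y. h (L' y))"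
      unfolding set_integrable_def
      by (subst D'[symmetric], subst integrable_distr_eq) (use mL m i in auto)
  qed
  let ?J = "\<lambda>x. \<bar>s x ^ (CARD('d) - 1) * (s x + m \<bullet> c x)\<bar>"
  let ?G = "\<lambda>y. L (G (L' y))"
  let ?A = "\<lambda>y w. s (L' y) *\<^sub>R w + (L m \<bullet> w) *\<^sub>R L (c (L' y))"
  have img: "?G ` (L ` S) = L ` (G ` S)"
    by (auto simp: image_image)
  have der': "(?G has_derivative ?A y) (at y within L ` S)" if y: "y \<in> L ` S" for y
  proof -
    have im: "L' ` (L ` S) = S" by (auto simp: image_image)
    have yS: "L' y \<in> S" using y by auto
    have 1: "(L' has_derivative L') (at y within L ` S)"
      using lin by (rule_tac bounded_linear_imp_has_derivative)
    have 2: "(G has_derivative (\<lambda>w. s (L' y) *\<^sub>R w + (m \<bullet> w) *\<^sub>R c (L' y))) (at (L' y) within L' ` (L ` S))"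
      unfolding im by (rule der[OF yS])
    from bounded_linear.has_derivative[OF lin(1) diff_chain_within[OF 1 2]]
    have "(?G has_derivative (\<lambda>w. L (s (L' y) *\<^sub>R L' w + (m \<bullet> L' w) *\<^sub>R c (L' y)))) (at y within L ` S)"
      by (simp add: o_def)
    also have "(\<lambda>w. L (s (L' y) *\<^sub>R L' w + (m \<bullet> L' w) *\<^sub>R c (L' y))) = ?A y"
      using lin(1) by (auto simp: inner' bounded_linear.linear linear_add linear_cmul)
    finally show ?thesis .
  qed
  have inj': "inj_on ?G (L ` S)"
  proof (rule inj_onI)
    fix y z assume "y \<in> L ` S" "z \<in> L ` S" "L (G (L' y)) = L (G (L' z))"
    then have "L' y \<in> S" "L' z \<in> S" "G (L' y) = G (L' z)"
      by (auto simp: mem dest!: arg_cong[where f = L'])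
    then have "L' y = L' z" using inj by (simp add: inj_on_def)
    then show "y = z" by (metis LL'(1))
  qed
  have jac: "\<bar>det (matrix (?A y))\<bar> = ?J (L' y)" if "y \<in> L ` S" for y
    using that nz by (subst det_scaled_plus_rank_one) (auto simp: card inner)
  have fG: "f \<in> borel_measurable borel" "set_integrable lborel (L ` (G ` S)) (\<lambda>y. f (L' y))"
    using f tr(2)[OF GS f(1)] by auto
  let ?f = "\<lambda>y. vec (f (L' y)) :: real^1"
  have "(\<lambda>y. \<bar>det (matrix (?A y))\<bar> *\<^sub>R ?f (?G y)) absolutely_integrable_on L ` S \<and>
      integral (L ` S) (\<lambda>y. \<bar>det (matrix (?A y))\<bar> *\<^sub>R ?f (?G y)) = vec (integral (L ` (G ` S)) (\<lambda>y. f (L' y)))"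
    unfolding has_absolute_integral_change_of_variables[OF _ der' inj', simplified, of ?f]
    using tr(3)[OF S f(1)] absolutely_integrable_lborelI[OF fG(2)]
    by (subst has_absolute_integral_change_of_variables[OF _ der' inj'])
       (auto simp: img absolutely_integrable_on_1_iff integral_on_1_eq)
  then have ai: "(\<lambda>y. \<bar>det (matrix (?A y))\<bar> * f (G (L' y))) absolutely_integrable_on L ` S"
    and eq: "integral (L ` S) (\<lambda>y. \<bar>det (matrix (?A y))\<bar> * f (G (L' y))) = integral (L ` (G ` S)) (\<lambda>y. f (L' y))"
    by (auto simp: absolutely_integrable_on_1_iff integral_on_1_eq)
  have eqI: "integral (L ` S) (\<lambda>y. \<bar>det (matrix (?A y))\<bar> * f (G (L' y))) = integral (L ` S) (\<lambda>y. ?J (L' y) * f (G (L' y)))"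
    by (intro integral_cong) (simp only: jac)
  have ai': "(\<lambda>y. ?J (L' y) * f (G (L' y))) absolutely_integrable_on L ` S"
    using ai by (rule set_integrable_cong[THEN iffD1, rotated -1]) (auto simp: jac)
  have "set_integrable lborel (L ` S) (\<lambda>y. ?J (L' y) * f (G (L' y)))"
  proof -
    have "(\<lambda>y. ?J (L' y) * f (G (L' y))) \<in> borel_measurable borel"
      using measurable_compose[OF mL(2) meas] .
    then have "(\<lambda>y. indicator (L ` S) y *\<^sub>R (?J (L' y) * f (G (L' y)))) \<in> borel_measurable lborel"
      using tr(3)[OF S f(1)] by measurable
    then show ?thesis
      using ai' integrable_completion unfolding set_integrable_def by blast
  qed
  from set_borel_integral_eq_integral(2)[OF this] set_borel_integral_eq_integral(2)[OF fG(2)]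
  show ?thesis
    using eq eqI tr(1)[OF GS f(1)] tr(1)[OF S meas] by simp
qed

lemma AE_not_in_hyperplane:
  fixes n :: "'a::euclidean_space"
  assumes "n \<noteq> 0"
  shows "AE x in lborel. n \<bullet> x \<noteq> b"
proof (rule AE_I')
  have "negligible {x. n \<bullet> x = b}" using assms by (intro negligible_hyperplane) auto
  then show "{x. n \<bullet> x = b} \<in> null_sets lborel"
    by (simp add: negligible_iff_null_sets null_sets_completion_iff closed_hyperplane borel_closed)
qed auto

lemma set_integrable_compact:
  fixes f :: "'a::euclidean_space \<Rightarrow> real"
  assumes "compact S" "continuous_on S f"
  shows "set_integrable lborel S f"
  using borel_integrable_compact[OF assms] by (simp add: set_integrable_def)

lemma convex_hull_insert_cone:
  fixes a :: "'a::real_vector"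
  assumes "convex F" "F \<noteq> {}"
  shows "convex hull (insert a F) = {a + t *\<^sub>R (y - a) | t y. t \<in> {0..1} \<and> y \<in> F}"
proof -
  have F: "convex hull F = F" using assms(1) by (simp add: hull_same)
  have "{x. \<exists>u\<ge>0. \<exists>v\<ge>0. \<exists>b. u + v = 1 \<and> b \<in> F \<and> x = u *\<^sub>R a + v *\<^sub>R b}
      = {a + t *\<^sub>R (y - a) | t y. t \<in> {0..1} \<and> y \<in> F}" (is "?A = ?B")
  proof (intro equalityI subsetI)
    fix x assume "x \<in> ?A"
    then obtain u v b where *: "u \<ge> 0" "v \<ge> 0" "u + v = 1" "b \<in> F" "x = u *\<^sub>R a + v *\<^sub>R b" by blast
    then have u: "u = 1 - v" by simp
    have "x = a + v *\<^sub>R (b - a)" using *(5) unfolding u by (simp add: algebra_simps)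
    moreover have "v \<in> {0..1}" using * by auto
    ultimately show "x \<in> ?B" using * by blast
  next
    fix x assume "x \<in> ?B"
    then obtain t y where *: "t \<in> {0..1}" "y \<in> F" "x = a + t *\<^sub>R (y - a)" by blast
    then have "x = (1 - t) *\<^sub>R a + t *\<^sub>R y" by (simp add: algebra_simps)
    moreover have "1 - t \<ge> 0" "t \<ge> 0" "(1 - t) + t = 1" using * by auto
    ultimately show "x \<in> ?A" using * by blast
  qed
  then show ?thesis
    using assms(2) by (simp only: convex_hull_insert F not_False_eq_True)
qed

section \<open>The divergence of radial fields on a cone\<close>

text \<open>Continuous differentiability with the derivative as an explicit argument: the integrals below
contain the derivative, and products and components then come with computed derivatives.\<close>

definition C1_deriv :: "('a::euclidean_space \<Rightarrow> 'b::euclidean_space) \<Rightarrow> ('a \<Rightarrow> 'a \<Rightarrow> 'b) \<Rightarrow> bool" where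
  "C1_deriv g g' \<longleftrightarrow> (\<forall>x. (g has_derivative g' x) (at x)) \<and> (\<forall>w. continuous_on UNIV (\<lambda>x. g' x w))"

lemma C1_deriv_continuous: "C1_deriv g g' \<Longrightarrow> continuous_on UNIV g"
  by (auto simp: C1_deriv_def intro!: continuous_at_imp_continuous_on has_derivative_continuous)

lemma C1_deriv_mult:
  fixes f g :: "'a::euclidean_space \<Rightarrow> real"
  assumes "C1_deriv f f'" "C1_deriv g g'"
  shows "C1_deriv (\<lambda>x. f x * g x) (\<lambda>x w. f x * g' x w + f' x w * g x)"
  using assms C1_deriv_continuous[OF assms(1)] C1_deriv_continuous[OF assms(2)]
  by (auto simp: C1_deriv_def intro!: has_derivative_mult continuous_intros)

lemma C1_deriv_diff:
  assumes "C1_deriv f f'" "C1_deriv g g'"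
  shows "C1_deriv (\<lambda>x. f x - g x) (\<lambda>x w. f' x w - g' x w)"
  using assms by (auto simp: C1_deriv_def intro!: has_derivative_diff continuous_intros)

lemma C1_deriv_inner_left:
  assumes "C1_deriv f f'"
  shows "C1_deriv (\<lambda>x. f x \<bullet> c) (\<lambda>x w. f' x w \<bullet> c)"
  using assms by (auto simp: C1_deriv_def intro!: has_derivative_inner_left continuous_intros)

lemma C1_deriv_bounded_linear:
  assumes "C1_deriv f f'"
  shows "bounded_linear (f' x)"
  using assms by (auto simp: C1_deriv_def intro: has_derivative_bounded_linear)

lemma C1_deriv_continuous_apply:
  assumes f: "C1_deriv f f'" and h: "continuous_on UNIV h"
  shows "continuous_on UNIV (\<lambda>x. f' x (h x))"
proof -
  have "f' x (h x) = (\<Sum>b\<in>Basis. (h x \<bullet> b) *\<^sub>R f' x b)" for x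
  proof -
    have "f' x (h x) = f' x (\<Sum>b\<in>Basis. (h x \<bullet> b) *\<^sub>R b)" by (simp add: euclidean_representation)
    then show ?thesis
      using bounded_linear.linear[OF C1_deriv_bounded_linear[OF f], of x] by (simp only: linear_sum linear_cmul)
  qed
  then show ?thesis
    using f h by (auto simp: C1_deriv_def intro!: continuous_intros)
qed

lemma compact_prism:
  fixes F :: "'a::real_normed_vector set"
  assumes "compact F"
  shows "compact {x + s *\<^sub>R n | x s. x \<in> F \<and> s \<in> {0..1}}"
proof -
  have "{x + s *\<^sub>R n | x s. x \<in> F \<and> s \<in> {0..1}} = (\<lambda>(x, s). x + s *\<^sub>R n) ` (F \<times> {0..1::real})"
    by force
  then show ?thesis
    using assms by (auto intro!: compact_continuous_image compact_Times continuous_intros simp: case_prod_unfold)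
qed

text \<open>The layer between the cone and its copy shrunk by the factor \<open>r\<close> towards the apex \<open>a\<close> is the
image of the prism over the base under \<open>y + s n \<mapsto> a + u (y - a)\<close> with \<open>u = r + (1 - r) s\<close>.  This
map has Jacobian \<open>u\<^sup>d\<^sup>-\<^sup>1 (1 - r) h\<close>, where \<open>h\<close> is the height of the cone up to sign.  The shrunk copy
is treated by the substitution \<open>x \<mapsto> a + r (x - a)\<close>.\<close>

lemma integral_cone_shell:
  fixes g :: "real^'d::finite \<Rightarrow> real"
  assumes F: "compact F" "convex F" "a0 \<in> F"
    and n: "\<And>x. x \<in> F \<Longrightarrow> n \<bullet> (x - a0) = 0" "norm n = 1"
    and h: "h = n \<bullet> (a0 - a)" "h \<noteq> 0"
    and g: "continuous_on UNIV g"
    and r: "0 < r" "r < 1"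
    and S_def: "S = convex hull (insert a F)"
    and P_def: "P = {x + s *\<^sub>R n | x s. x \<in> F \<and> s \<in> {0..1}}"
  shows "(LINT x:S|lborel. g x - r ^ CARD('d) * g (a + r *\<^sub>R (x - a)))
    = (1 - r) * (\<bar>h\<bar> * (LINT z:P|lborel. (r + (1 - r) * (n \<bullet> (z - a0))) ^ (CARD('d) - 1)
          * g (a + (r + (1 - r) * (n \<bullet> (z - a0))) *\<^sub>R (z - (n \<bullet> (z - a0)) *\<^sub>R n - a))))"
proof -
  have nn: "n \<bullet> n = 1" using n(2) by (simp add: norm_eq_1)
  have g': "continuous_on X g" for X using g continuous_on_subset by blast
  define \<sigma> where "\<sigma> z = n \<bullet> (z - a0)" for z
  define pr where "pr z = z - \<sigma> z *\<^sub>R n" for z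
  define u where "u z = r + (1 - r) * \<sigma> z" for z
  define G where "G z = a + u z *\<^sub>R (pr z - a)" for z
  have cont: "continuous_on X \<sigma>" "continuous_on X pr" "continuous_on X u" "continuous_on X G" for X
    unfolding \<sigma>_def pr_def u_def G_def by (intro continuous_intros)+
  have \<sigma>P: "\<sigma> (x + s *\<^sub>R n) = s" "pr (x + s *\<^sub>R n) = x" if "x \<in> F" for x s
    using n(1)[OF that] nn by (simp_all add: \<sigma>_def pr_def inner_simps algebra_simps)
  have P: "z \<in> P \<longleftrightarrow> pr z \<in> F \<and> 0 \<le> \<sigma> z \<and> \<sigma> z \<le> 1" for z
  proof
    assume "pr z \<in> F \<and> 0 \<le> \<sigma> z \<and> \<sigma> z \<le> 1"
    moreover have "z = pr z + \<sigma> z *\<^sub>R n" by (simp add: pr_def)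
    ultimately show "z \<in> P" unfolding P_def by (metis (mono_tags, lifting) atLeastAtMost_iff mem_Collect_eq)
  qed (auto simp: P_def \<sigma>P)
  have hpr: "n \<bullet> (pr z - a) = h" for z
    using nn by (simp add: pr_def \<sigma>_def h inner_simps algebra_simps)
  have S: "S = {a + t *\<^sub>R (y - a) | t y. t \<in> {0..1} \<and> y \<in> F}"
    unfolding S_def using F(2,3) by (intro convex_hull_insert_cone) auto
  have "compact P" unfolding P_def using F(1) by (rule compact_prism)
  have "compact S" unfolding S_def using F(1) by (intro compact_convex_hull) auto
  define R where "R x = a + r *\<^sub>R (x - a)" for x
  have contR: "continuous_on X R" for X unfolding R_def by (intro continuous_intros)
  have "compact (R ` S)" using \<open>compact S\<close> contR by (intro compact_continuous_image)
  have RS: "R ` S \<subseteq> S"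
  proof (clarsimp simp: R_def)
    fix x assume "x \<in> S"
    moreover have "convex S" "a \<in> S" unfolding S_def by (auto simp: hull_inc)
    ultimately have "(1 - r) *\<^sub>R a + r *\<^sub>R x \<in> S" using r by (intro convexD_alt) auto
    then show "a + r *\<^sub>R (x - a) \<in> S" by (simp add: algebra_simps)
  qed
  \<comment> \<open>Removing the bottom of the prism, which is a null set, makes its image exactly the cone minus
    the shrunk copy.\<close>
  define P' where "P' = P - {z. n \<bullet> z = n \<bullet> a0}"
  have P'_borel: "P' \<in> sets borel"
    unfolding P'_def using \<open>compact P\<close> closed_hyperplane[of n "n \<bullet> a0"]
    by (intro sets.Diff) (auto intro: borel_compact borel_closed)
  have P': "z \<in> P' \<longleftrightarrow> pr z \<in> F \<and> 0 < \<sigma> z \<and> \<sigma> z \<le> 1" for z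
    by (auto simp: P'_def P \<sigma>_def inner_diff_right)
  have u_pos: "u z > r" if "z \<in> P'" for z
    using that r by (simp add: P' u_def)
  have GP': "G ` P' = S - R ` S"
  proof (intro equalityI subsetI)
    fix x assume "x \<in> G ` P'"
    then obtain z where z: "z \<in> P'" "x = G z" by auto
    have "(1 - r) * \<sigma> z \<le> (1 - r) * 1" using z r by (intro mult_left_mono) (auto simp: P')
    then have "u z \<le> 1" by (simp add: u_def)
    then have "x \<in> S" unfolding S using z u_pos[of z] r by (auto simp: G_def P' intro!: exI[of _ "u z"] exI[of _ "pr z"])
    moreover have "x \<notin> R ` S"
    proof
      assume "x \<in> R ` S"
      then obtain t y where ty: "t \<le> 1" "y \<in> F" "x = a + (r * t) *\<^sub>R (y - a)"
        by (auto simp: S R_def)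
      have "n \<bullet> (x - a) = r * t * h" using n(1)[OF ty(2)] by (simp add: ty(3) h inner_simps)
      moreover have "n \<bullet> (x - a) = u z * h" using hpr[of z] by (simp add: z G_def)
      ultimately have "u z = r * t" using h by simp
      then show False using u_pos[OF z(1)] r ty(1) mult_left_le[of t r] by simp
    qed
    ultimately show "x \<in> S - R ` S" by simp
  next
    fix x assume x: "x \<in> S - R ` S"
    then obtain t y where ty: "0 \<le> t" "t \<le> 1" "y \<in> F" "x = a + t *\<^sub>R (y - a)"
      by (auto simp: S)
    have "r < t"
    proof (rule ccontr)
      assume "\<not> r < t"
      then have "a + (t / r) *\<^sub>R (y - a) \<in> S" unfolding S using ty r 
        by (auto intro!: exI[of _ "t / r"] exI[of _ y])
      then have "x \<in> R ` S" using r ty by (auto simp: R_def image_iff intro!: bexI)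
      then show False using x by simp
    qed
    define z where "z = y + ((t - r) / (1 - r)) *\<^sub>R n"
    have z: "\<sigma> z = (t - r) / (1 - r)" "pr z = y" using \<sigma>P ty(3) by (auto simp: z_def)
    have "0 < (t - r) / (1 - r)" "(t - r) / (1 - r) \<le> 1" using \<open>r < t\<close> r ty by simp_all
    then have "z \<in> P'" using ty z by (simp only: P' simp_thms)
    moreover have "G z = x" using z r ty by (simp add: G_def u_def)
    ultimately show "x \<in> G ` P'" by blast
  qed
  have inj: "inj_on G P'"
  proof (rule inj_onI)
    fix y z assume yz: "y \<in> P'" "z \<in> P'" "G y = G z"
    have "u y * h = n \<bullet> (G y - a)" "u z * h = n \<bullet> (G z - a)" using hpr by (simp_all add: G_def)
    then have uu: "u y = u z" using yz(3) h(2) by (metis mult_right_cancel)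
    then have "\<sigma> y = \<sigma> z" using r by (simp add: u_def)
    moreover have "pr y = pr z" using yz(3) uu u_pos[OF yz(2)] r by (simp add: G_def)
    ultimately have "pr y + \<sigma> y *\<^sub>R n = pr z + \<sigma> z *\<^sub>R n" by simp
    then show "y = z" by (simp add: pr_def)
  qed
  define c where "c z = (1 - r) *\<^sub>R (pr z - a) - u z *\<^sub>R n" for z
  have der: "(G has_derivative (\<lambda>w. u z *\<^sub>R w + (n \<bullet> w) *\<^sub>R c z)) (at z within P')" for z
  proof -
    have d\<sigma>: "(\<sigma> has_derivative (\<lambda>w. n \<bullet> w)) (at z within P')"
      unfolding \<sigma>_def by (auto intro!: derivative_eq_intros)
    have dpr: "(pr has_derivative (\<lambda>w. w - (n \<bullet> w) *\<^sub>R n)) (at z within P')"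
      unfolding pr_def by (auto intro!: derivative_eq_intros d\<sigma>)
    have du: "(u has_derivative (\<lambda>w. (1 - r) * (n \<bullet> w))) (at z within P')"
      unfolding u_def by (auto intro!: derivative_eq_intros d\<sigma>)
    have "(G has_derivative (\<lambda>w. 0 + (u z *\<^sub>R ((w - (n \<bullet> w) *\<^sub>R n) - 0) + ((1 - r) * (n \<bullet> w)) *\<^sub>R (pr z - a)))) (at z within P')"
      unfolding G_def
      by (intro has_derivative_add has_derivative_scaleR has_derivative_diff has_derivative_const dpr du)
    moreover have "0 + (u z *\<^sub>R ((w - (n \<bullet> w) *\<^sub>R n) - 0) + ((1 - r) * (n \<bullet> w)) *\<^sub>R (pr z - a))
        = u z *\<^sub>R w + (n \<bullet> w) *\<^sub>R c z" for w
      unfolding c_def scaleR_diff_right scaleR_scaleR by (simp add: mult.commute)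
    ultimately show ?thesis by simp
  qed
  have jac: "u z + n \<bullet> c z = (1 - r) * h" for z
    using nn hpr[of z] by (simp add: c_def inner_diff_right)
  have "(LINT x:G ` P'|lborel. g x)
    = (LINT z:P'|lborel. \<bar>u z ^ (CARD('d) - 1) * (u z + n \<bullet> c z)\<bar> * g (G z))"
  proof (rule integral_rank_one_substitution[OF P'_borel _ der _ inj])
    show "G ` P' \<in> sets borel" unfolding GP' using \<open>compact S\<close> \<open>compact (R ` S)\<close>
      by (intro sets.Diff borel_compact)
    show "u z \<noteq> 0" if "z \<in> P'" for z using u_pos[OF that] r by simp
    show "g \<in> borel_measurable borel" using g by (rule borel_measurable_continuous_onI)
    show "set_integrable lborel (G ` P') g"
      by (rule set_integrable_subset[OF set_integrable_compact[OF \<open>compact S\<close> g'[of S]]])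
         (use \<open>G ` P' \<in> sets borel\<close> GP' in auto)
    show "(\<lambda>z. \<bar>u z ^ (CARD('d) - 1) * (u z + n \<bullet> c z)\<bar> * g (G z)) \<in> borel_measurable borel"
      unfolding jac
      by (intro borel_measurable_continuous_onI continuous_intros cont continuous_on_compose2[OF g]) auto
  qed
  also have "\<dots> = (LINT z:P|lborel. (1 - r) * \<bar>h\<bar> * (u z ^ (CARD('d) - 1) * g (G z)))"
  proof -
    have n0: "n \<noteq> 0" using nn by auto
    have pt: "indicator P' z *\<^sub>R (\<bar>u z ^ (CARD('d) - 1) * (u z + n \<bullet> c z)\<bar> * g (G z))
       = indicator P z *\<^sub>R ((1 - r) * \<bar>h\<bar> * (u z ^ (CARD('d) - 1) * g (G z)))" if "n \<bullet> z \<noteq> n \<bullet> a0" for z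
    proof (cases "z \<in> P'")
      case True
      then have "u z > 0" "z \<in> P" using u_pos[OF True] r by (auto simp: P'_def)
      then show ?thesis using True r by (simp add: jac abs_mult)
    next
      case False
      then show ?thesis using that by (simp add: P'_def)
    qed
    have mP: "P \<in> sets borel" using \<open>compact P\<close> by (rule borel_compact)
    have m1: "(\<lambda>z. u z ^ (CARD('d) - 1) * g (G z)) \<in> borel_measurable borel"
      by (intro borel_measurable_continuous_onI continuous_intros cont continuous_on_compose2[OF g]) auto
    show ?thesis
      unfolding set_lebesgue_integral_def
    proof (rule integral_cong_AE)
      show "AE z in lborel. indicator P' z *\<^sub>R (\<bar>u z ^ (CARD('d) - 1) * (u z + n \<bullet> c z)\<bar> * g (G z))
          = indicator P z *\<^sub>R ((1 - r) * \<bar>h\<bar> * (u z ^ (CARD('d) - 1) * g (G z)))"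
        by (rule eventually_mono[OF AE_not_in_hyperplane[OF n0, of "n \<bullet> a0"]]) (rule pt)
      show "(\<lambda>z. indicator P z *\<^sub>R ((1 - r) * \<bar>h\<bar> * (u z ^ (CARD('d) - 1) * g (G z)))) \<in> borel_measurable lborel"
        using m1 mP by measurable
      have m2: "(\<lambda>z. \<bar>u z ^ (CARD('d) - 1) * (u z + n \<bullet> c z)\<bar> * g (G z)) \<in> borel_measurable borel"
        unfolding jac
        by (intro borel_measurable_continuous_onI continuous_intros cont continuous_on_compose2[OF g]) auto
      then show "(\<lambda>z. indicator P' z *\<^sub>R (\<bar>u z ^ (CARD('d) - 1) * (u z + n \<bullet> c z)\<bar> * g (G z))) \<in> borel_measurable lborel"
        using P'_borel by measurable
    qed
  qed
  also have "\<dots> = (1 - r) * (\<bar>h\<bar> * (LINT z:P|lborel. u z ^ (CARD('d) - 1) * g (G z)))"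
    by (simp add: mult.assoc)
  finally have shell: "(LINT x:S - R ` S|lborel. g x) = (1 - r) * (\<bar>h\<bar> * (LINT z:P|lborel. u z ^ (CARD('d) - 1) * g (G z)))"
    by (simp add: GP')
  have injR: "inj_on R S" using r by (auto simp: inj_on_def R_def)
  have intg: "set_integrable lborel S g" "set_integrable lborel (R ` S) g"
    using \<open>compact S\<close> \<open>compact (R ` S)\<close> g' by (auto intro: set_integrable_compact)
  have "(LINT x:R ` S|lborel. g x)
    = (LINT x:S|lborel. \<bar>r ^ (CARD('d) - 1) * (r + 0 \<bullet> (0::real^'d))\<bar> * g (R x))"
  proof (rule integral_rank_one_substitution[OF _ _ _ _ injR])
    show "(R has_derivative (\<lambda>w. r *\<^sub>R w + ((0::real^'d) \<bullet> w) *\<^sub>R 0)) (at x within S)" for x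
      unfolding R_def by (auto intro!: derivative_eq_intros)
    show "(\<lambda>x. \<bar>r ^ (CARD('d) - 1) * (r + 0 \<bullet> (0::real^'d))\<bar> * g (R x)) \<in> borel_measurable borel"
      by (intro borel_measurable_continuous_onI continuous_intros continuous_on_compose2[OF g] contR) auto
  qed (use r intg \<open>compact S\<close> \<open>compact (R ` S)\<close> g in \<open>auto intro: borel_compact borel_measurable_continuous_onI\<close>)
  also have "\<dots> = (LINT x:S|lborel. r ^ CARD('d) * g (R x))"
    using r by (simp add: power_eq_if[of r "CARD('d)"] mult.commute)
  finally have scaled: "(LINT x:R ` S|lborel. g x) = (LINT x:S|lborel. r ^ CARD('d) * g (R x))" .
  have intR: "set_integrable lborel S (\<lambda>x. r ^ CARD('d) * g (R x))"
    by (intro set_integrable_compact \<open>compact S\<close> continuous_intros continuous_on_compose2[OF g] contR) auto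
  have "(LINT x:S|lborel. g x) = (LINT x:(S - R ` S) \<union> R ` S|lborel. g x)"
    using RS by (simp add: Un_absorb2)
  also have "\<dots> = (LINT x:S - R ` S|lborel. g x) + (LINT x:R ` S|lborel. g x)"
    by (rule set_integral_Un)
       (use intg \<open>compact S\<close> \<open>compact (R ` S)\<close> in \<open>auto intro!: set_integrable_subset[OF intg(1)] borel_compact\<close>)
  finally have "(LINT x:S|lborel. g x - r ^ CARD('d) * g (R x)) = (LINT x:S - R ` S|lborel. g x)"
    using scaled by (subst set_integral_diff(2)[OF intg(1) intR]) simp
  then show ?thesis using shell by (simp add: R_def G_def u_def pr_def \<sigma>_def)
qed

text \<open>The identity for the layer is divided by \<open>1 - r\<close>, and \<open>r\<close> tends to 1.  On the left the limit is the
integral of the derivative of \<open>r\<^sup>d g (a + r (x - a))\<close> at \<open>r = 1\<close>, which is the divergence of the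
radial field \<open>(x - a) g(x)\<close>; on the right the layer collapses onto the base, and the integrand
becomes the value of \<open>g\<close> at the foot point in the base.\<close>

lemma integral_cone_divergence:
  fixes g :: "real^'d::finite \<Rightarrow> real"
  assumes F: "compact F" "convex F" "a0 \<in> F"
    and n: "\<And>x. x \<in> F \<Longrightarrow> n \<bullet> (x - a0) = 0" "norm n = 1"
    and h: "h = n \<bullet> (a0 - a)" "h \<noteq> 0"
    and g': "C1_deriv g g'"
    and S_def: "S = convex hull (insert a F)"
    and P_def: "P = {x + s *\<^sub>R n | x s. x \<in> F \<and> s \<in> {0..1}}"
  shows "(LINT x:S|lborel. CARD('d) * g x + g' x (x - a))
    = \<bar>h\<bar> * (LINT z:P|lborel. g (z - (n \<bullet> (z - a0)) *\<^sub>R n))"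
proof -
  have nn: "n \<bullet> n = 1" using n(2) by (simp add: norm_eq_1)
  have g: "continuous_on UNIV g" using g' by (rule C1_deriv_continuous)
  have "compact S" unfolding S_def using F(1) by (intro compact_convex_hull) auto
  have "convex S" "a \<in> S" unfolding S_def by (auto simp: hull_inc)
  have "compact P" unfolding P_def using F(1) by (rule compact_prism)
  have S: "S = {a + t *\<^sub>R (y - a) | t y. t \<in> {0..1} \<and> y \<in> F}"
    unfolding S_def using F by (intro convex_hull_insert_cone) auto
  let ?d = "CARD('d)"
  \<comment> \<open>Any sequence in the open unit interval that tends to 1 would do.\<close>
  define r where "r j = 1 - 1 / (real j + 2)" for j :: nat
  have r: "0 < r j" "r j < 1" for j by (simp_all add: r_def)
  have rlim: "r \<longlonglongrightarrow> 1"
    unfolding r_def using tendsto_diff[OF tendsto_const[of 1] LIMSEQ_Suc[OF LIMSEQ_Suc[OF lim_const_over_n[of 1]]]] by (simp add: add.commute)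
  define f where "f y = ?d * g y + g' y (y - a)" for y
  have f: "continuous_on UNIV f"
    unfolding f_def by (intro continuous_intros g C1_deriv_continuous_apply[OF g'])
  define \<phi> where "\<phi> x t = t ^ ?d * g (a + t *\<^sub>R (x - a))" for x and t :: real
  define \<phi>' where "\<phi>' x t = t ^ (?d - 1) * f (a + t *\<^sub>R (x - a))" for x and t :: real
  have \<phi>_der: "(\<phi> x has_real_derivative \<phi>' x t) (at t)" for x t
  proof -
    let ?y = "a + t *\<^sub>R (x - a)"
    have gd: "(g has_derivative g' y) (at y)" for y using g' by (simp add: C1_deriv_def)
    have lin: "g' ?y (s *\<^sub>R v) = s * g' ?y v" for s v
      using linear_cmul[OF bounded_linear.linear[OF C1_deriv_bounded_linear[OF g']]] by simp
    have "((\<lambda>t. g (a + t *\<^sub>R (x - a))) has_derivative (\<lambda>s. g' ?y (s *\<^sub>R (x - a)))) (at t)"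
      by (rule has_derivative_compose[OF _ gd]) (auto intro!: derivative_eq_intros)
    then have 1: "((\<lambda>t. g (a + t *\<^sub>R (x - a))) has_real_derivative g' ?y (x - a)) (at t)"
      by (rule has_derivative_imp_has_field_derivative) (simp add: lin)
    have "t ^ ?d = t ^ (?d - 1) * t" by (simp add: power_eq_if[of t ?d])
    moreover have "f ?y = ?d * g ?y + t * g' ?y (x - a)" by (simp add: f_def lin)
    ultimately have "\<phi>' x t = real ?d * t ^ (?d - Suc 0) * g ?y + g' ?y (x - a) * t ^ ?d"
      by (simp add: \<phi>'_def algebra_simps)
    then show ?thesis
      using DERIV_mult[OF DERIV_pow[of ?d t] 1] by (simp only: \<phi>_def[abs_def])
  qed
  have bounded_on_S: "\<exists>M. \<forall>x\<in>S. \<bar>k x\<bar> \<le> M" if "continuous_on UNIV k" for k :: "real^'d \<Rightarrow> real"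
    using compact_imp_bounded[OF compact_continuous_image[OF continuous_on_subset[OF that] \<open>compact S\<close>]]
    by (auto simp: bounded_iff)
  obtain M0 where M0: "\<bar>g x\<bar> \<le> M0" if "x \<in> S" for x using bounded_on_S[OF g] by blast
  obtain M where M: "\<bar>f x\<bar> \<le> M" if "x \<in> S" for x using bounded_on_S[OF f] by blast
  have inS: "a + t *\<^sub>R (x - a) \<in> S" if "x \<in> S" "0 \<le> t" "t \<le> 1" for x t
  proof -
    have "(1 - t) *\<^sub>R a + t *\<^sub>R x \<in> S" using \<open>convex S\<close> \<open>a \<in> S\<close> that by (intro convexD_alt) auto
    then show ?thesis by (simp add: algebra_simps)
  qed
  have bound: "\<bar>\<phi>' x t\<bar> \<le> M" if "x \<in> S" "0 \<le> t" "t \<le> 1" for x t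
  proof -
    have y: "a + t *\<^sub>R (x - a) \<in> S" using that by (intro inS)
    have "\<bar>\<phi>' x t\<bar> \<le> 1 * M"
      unfolding \<phi>'_def abs_mult using M[OF y] that by (intro mult_mono) (auto simp: power_le_one)
    then show ?thesis by simp
  qed
  define q where "q j x = (\<phi> x 1 - \<phi> x (r j)) / (1 - r j)" for j x
  define k where "k j z = (r j + (1 - r j) * (n \<bullet> (z - a0))) ^ (?d - 1)
          * g (a + (r j + (1 - r j) * (n \<bullet> (z - a0))) *\<^sub>R (z - (n \<bullet> (z - a0)) *\<^sub>R n - a))" for j z
  have eq: "(LINT x:S|lborel. q j x) = \<bar>h\<bar> * (LINT z:P|lborel. k j z)" for j
  proof -
    have "(LINT x:S|lborel. q j x) = (LINT x:S|lborel. g x - r j ^ ?d * g (a + r j *\<^sub>R (x - a))) / (1 - r j)"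
      by (simp add: q_def \<phi>_def)
    also have "\<dots> = \<bar>h\<bar> * (LINT z:P|lborel. k j z)"
      unfolding k_def
      by (subst integral_cone_shell[OF F n h g r S_def P_def]) (use r[of j] in auto)
    finally show ?thesis .
  qed
  have "(\<lambda>j. LINT x:S|lborel. q j x) \<longlonglongrightarrow> (LINT x:S|lborel. \<phi>' x 1)"
    unfolding set_lebesgue_integral_def
  proof (rule integral_dominated_convergence[where w = "\<lambda>x. indicator S x * M"])
    have mS: "S \<in> sets borel" using \<open>compact S\<close> by (rule borel_compact)
    have "\<phi>' x 1 = f x" for x by (simp add: \<phi>'_def)
    then have "(\<lambda>x. \<phi>' x 1) \<in> borel_measurable borel"
      using f by (simp add: borel_measurable_continuous_onI)
    then show "(\<lambda>x. indicator S x *\<^sub>R \<phi>' x 1) \<in> borel_measurable lborel" using mS by measurable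
    have "q j \<in> borel_measurable borel" for j
      unfolding q_def \<phi>_def
      by (intro borel_measurable_continuous_onI continuous_intros continuous_on_compose2[OF g]) (use r[of j] in auto)
    then show "(\<lambda>x. indicator S x *\<^sub>R q j x) \<in> borel_measurable lborel" for j using mS by measurable
    show "integrable lborel (\<lambda>x. indicator S x * M)"
      using set_integrable_compact[OF \<open>compact S\<close>, of "\<lambda>_. M"] by (simp add: set_integrable_def)
    have "(\<lambda>j. q j x) \<longlonglongrightarrow> \<phi>' x 1" for x
    proof -
      have "((\<lambda>t. (\<phi> x t - \<phi> x 1) / (t - 1)) \<longlongrightarrow> \<phi>' x 1) (at 1)"
        using \<phi>_der[of x 1] by (simp add: has_field_derivative_iff)
      then have "(\<lambda>j. (\<phi> x (r j) - \<phi> x 1) / (r j - 1)) \<longlonglongrightarrow> \<phi>' x 1"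
        by (rule filterlim_compose) (use rlim r in \<open>auto simp: filterlim_at less_imp_neq intro!: always_eventually\<close>)
      moreover have "(\<phi> x (r j) - \<phi> x 1) / (r j - 1) = q j x" for j
        unfolding q_def by (metis minus_diff_eq minus_divide_divide)
      ultimately show ?thesis by simp
    qed
    then show "AE x in lborel. (\<lambda>j. indicator S x *\<^sub>R q j x) \<longlonglongrightarrow> indicator S x *\<^sub>R \<phi>' x 1"
      by (auto intro!: tendsto_intros)
    have "\<bar>q j x\<bar> \<le> M" if x: "x \<in> S" for j x
    proof -
      obtain t where t: "r j < t" "t < 1" "\<phi> x 1 - \<phi> x (r j) = (1 - r j) * \<phi>' x t"
        using MVT2[of "r j" 1 "\<phi> x" "\<phi>' x"] \<phi>_der r by blast
      then have "q j x = \<phi>' x t" using r[of j] by (simp add: q_def)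
      then show ?thesis using bound[OF x, of t] t r[of j] by simp
    qed
    then show "AE x in lborel. norm (indicator S x *\<^sub>R q j x) \<le> indicator S x * M" for j
      by (auto simp: indicator_def)
  qed
  moreover have "(\<lambda>j. LINT z:P|lborel. k j z) \<longlonglongrightarrow> (LINT z:P|lborel. g (z - (n \<bullet> (z - a0)) *\<^sub>R n))"
    unfolding set_lebesgue_integral_def
  proof (rule integral_dominated_convergence[where w = "\<lambda>x. indicator P x * M0"])
    have mP: "P \<in> sets borel" using \<open>compact P\<close> by (rule borel_compact)
    have "(\<lambda>z. g (z - (n \<bullet> (z - a0)) *\<^sub>R n)) \<in> borel_measurable borel"
      by (intro borel_measurable_continuous_onI continuous_intros continuous_on_compose2[OF g]) auto
    then show "(\<lambda>z. indicator P z *\<^sub>R g (z - (n \<bullet> (z - a0)) *\<^sub>R n)) \<in> borel_measurable lborel" using mP by measurable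
    have "k j \<in> borel_measurable borel" for j
      unfolding k_def
      by (intro borel_measurable_continuous_onI continuous_intros continuous_on_compose2[OF g]) auto
    then show "(\<lambda>x. indicator P x *\<^sub>R k j x) \<in> borel_measurable lborel" for j using mP by measurable
    show "integrable lborel (\<lambda>x. indicator P x * M0)"
      using set_integrable_compact[OF \<open>compact P\<close>, of "\<lambda>_. M0"] by (simp add: set_integrable_def)
    have "(\<lambda>j. k j z) \<longlonglongrightarrow> g (z - (n \<bullet> (z - a0)) *\<^sub>R n)" for z
    proof -
      have u: "(\<lambda>j. r j + (1 - r j) * (n \<bullet> (z - a0))) \<longlonglongrightarrow> 1"
        by (rule tendsto_eq_intros rlim refl | simp)+
      have "isCont g y" for y using g by (simp add: continuous_on_eq_continuous_at)
      then have "(\<lambda>j. k j z) \<longlonglongrightarrow> 1 ^ (?d - 1) * g (a + 1 *\<^sub>R (z - (n \<bullet> (z - a0)) *\<^sub>R n - a))"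
        unfolding k_def by (intro tendsto_intros u isCont_tendsto_compose[of _ g])
      then show ?thesis by simp
    qed
    then show "AE z in lborel. (\<lambda>j. indicator P z *\<^sub>R k j z) \<longlonglongrightarrow> indicator P z *\<^sub>R g (z - (n \<bullet> (z - a0)) *\<^sub>R n)"
      by (auto intro!: tendsto_intros)
    have "\<bar>k j z\<bar> \<le> M0" if z: "z \<in> P" for j z
    proof -
      obtain x s where xs: "z = x + s *\<^sub>R n" "x \<in> F" "0 \<le> s" "s \<le> 1" using z by (auto simp: P_def)
      have s: "n \<bullet> (z - a0) = s" using n(1)[OF xs(2)] nn xs(1) by (simp add: inner_simps algebra_simps)
      let ?u = "r j + (1 - r j) * s"
      have "(1 - r j) * s \<le> (1 - r j) * 1" using r[of j] xs by (intro mult_left_mono) auto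
      then have u1: "?u \<le> 1" by (simp only: mult_1_right)
      have u0: "0 \<le> ?u" using r[of j] xs by simp
      note u = u0 u1
      have inSu: "a + ?u *\<^sub>R (x - a) \<in> S" unfolding S
        by (intro CollectI exI[of _ ?u] exI[of _ x] conjI refl) (use u xs(2) in simp_all)
      have "\<bar>k j z\<bar> = \<bar>?u ^ (?d - 1)\<bar> * \<bar>g (a + ?u *\<^sub>R (x - a))\<bar>"
        by (simp add: k_def s abs_mult) (simp add: xs(1))
      also have "\<dots> \<le> 1 * M0"
        using u M0[OF inSu] by (intro mult_mono) (auto simp: power_le_one)
      finally show ?thesis by simp
    qed
    then show "AE z in lborel. norm (indicator P z *\<^sub>R k j z) \<le> indicator P z * M0" for j
      by (auto simp: indicator_def)
  qed
  ultimately have "(LINT x:S|lborel. \<phi>' x 1) = \<bar>h\<bar> * (LINT z:P|lborel. g (z - (n \<bullet> (z - a0)) *\<^sub>R n))"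
    unfolding eq by (intro LIMSEQ_unique) (auto intro!: tendsto_intros)
  then show ?thesis by (simp add: \<phi>'_def f_def)
qed

section \<open>Surface measure of a flat set\<close>

definition unit_normal :: "(real^'d) set \<Rightarrow> real^'d \<Rightarrow> bool" where
  "unit_normal F n \<longleftrightarrow> norm n = 1 \<and> (\<forall>x\<in>F. \<forall>y\<in>F. n \<bullet> (x - y) = 0)"

lemma unit_normalD:
  assumes "unit_normal F n"
  shows "norm n = 1" "n \<bullet> n = 1" "\<lbrakk>x \<in> F; y \<in> F\<rbrakk> \<Longrightarrow> n \<bullet> (x - y) = 0"
    "\<lbrakk>x \<in> F; y \<in> F\<rbrakk> \<Longrightarrow> n \<bullet> (x - a) = n \<bullet> (y - a)"
proof -
  show 1: "n \<bullet> (x - y) = 0" if "x \<in> F" "y \<in> F" for x y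
    using assms that by (simp add: unit_normal_def)
  show "n \<bullet> (x - a) = n \<bullet> (y - a)" if "x \<in> F" "y \<in> F"
    using 1[OF that] by (simp add: inner_diff_right)
qed (use assms in \<open>simp_all add: unit_normal_def norm_eq_1\<close>)

lemma unit_normal_uminus [simp]: "unit_normal F (- n) \<longleftrightarrow> unit_normal F n"
  by (auto simp: unit_normal_def)

lemma facet_measure_eq_distr:
  fixes F :: "(real^'d::finite) set"
  assumes "F \<noteq> {}" "unit_normal F m"
  obtains n a where "unit_normal F n" "a \<in> F"
    "facet_measure F = distr (restrict_space lborel {x + s *\<^sub>R n | x s. x \<in> F \<and> s \<in> {0..1}}) borel
       (\<lambda>y. y - (n \<bullet> (y - a)) *\<^sub>R n)"
proof -
  let ?n = "SOME n. norm n = 1 \<and> (\<forall>x\<in>F. \<forall>y\<in>F. n \<bullet> (x - y) = 0)" and ?a = "SOME a. a \<in> F"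
  have "unit_normal F ?n"
    unfolding unit_normal_def by (rule someI[of _ m]) (use assms in \<open>simp add: unit_normal_def\<close>)
  moreover have "?a \<in> F" using assms(1) by (simp add: some_in_eq)
  ultimately show ?thesis
    by (rule that) (simp add: facet_measure_def Let_def)
qed

context
  fixes F :: "(real^'d::finite) set" and m
  assumes F: "compact F" "F \<noteq> {}" "unit_normal F m"
begin

lemma facet_measure_prism:
  obtains n a P where "unit_normal F n" "a \<in> F" "P = {x + s *\<^sub>R n | x s. x \<in> F \<and> s \<in> {0..1}}"
    "compact P" "\<forall>z\<in>P. z - (n \<bullet> (z - a)) *\<^sub>R n \<in> F"
    "facet_measure F = distr (restrict_space lborel P) borel (\<lambda>y. y - (n \<bullet> (y - a)) *\<^sub>R n)"
    "(\<lambda>y. y - (n \<bullet> (y - a)) *\<^sub>R n) \<in> measurable (restrict_space lborel P) borel"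
proof -
  obtain n a where na: "unit_normal F n" "a \<in> F"
    "facet_measure F = distr (restrict_space lborel {x + s *\<^sub>R n | x s. x \<in> F \<and> s \<in> {0..1}}) borel
       (\<lambda>y. y - (n \<bullet> (y - a)) *\<^sub>R n)"
    using facet_measure_eq_distr[OF F(2,3)] .
  let ?P = "{x + s *\<^sub>R n | x s. x \<in> F \<and> s \<in> {0..1}}"
  have 1: "compact ?P" using F(1) by (rule compact_prism)
  have 2: "z - (n \<bullet> (z - a)) *\<^sub>R n \<in> F" if z: "z \<in> ?P" for z
  proof -
    obtain x s where xs: "z = x + s *\<^sub>R n" "x \<in> F" using z by auto
    have "n \<bullet> (x - a) = 0" "n \<bullet> n = 1" using unit_normalD[OF na(1)] na(2) xs by blast+
    then have "n \<bullet> (z - a) = s" by (simp add: xs inner_simps algebra_simps)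
    then show ?thesis using xs by simp
  qed
  have 3: "(\<lambda>y. y - (n \<bullet> (y - a)) *\<^sub>R n) \<in> measurable (restrict_space lborel ?P) borel"
    by (intro measurable_restrict_space1) (auto intro!: borel_measurable_continuous_onI continuous_intros)
  show ?thesis by (rule that[OF na(1,2) refl 1 ballI[OF 2] na(3) 3])
qed

lemma sets_facet_measure [measurable_cong]: "sets (facet_measure F) = sets borel"
  by (rule facet_measure_prism) simp

lemma AE_in_facet: "AE x in facet_measure F. x \<in> F"
proof -
  obtain n a P where P: "unit_normal F n" "a \<in> F" "P = {x + s *\<^sub>R n | x s. x \<in> F \<and> s \<in> {0..1}}"
    "compact P" "\<forall>z\<in>P. z - (n \<bullet> (z - a)) *\<^sub>R n \<in> F"
    "facet_measure F = distr (restrict_space lborel P) borel (\<lambda>y. y - (n \<bullet> (y - a)) *\<^sub>R n)"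
    "(\<lambda>y. y - (n \<bullet> (y - a)) *\<^sub>R n) \<in> measurable (restrict_space lborel P) borel"
    using facet_measure_prism .
  have "F \<in> sets borel" using F(1) by (rule borel_compact)
  then show ?thesis
    unfolding P(6) by (subst AE_distr_iff) (use P in \<open>auto intro!: AE_I2 simp: space_restrict_space\<close>)
qed

lemma finite_measure_facet_measure: "finite_measure (facet_measure F)"
proof -
  obtain n a P where P: "unit_normal F n" "a \<in> F" "P = {x + s *\<^sub>R n | x s. x \<in> F \<and> s \<in> {0..1}}"
    "compact P" "\<forall>z\<in>P. z - (n \<bullet> (z - a)) *\<^sub>R n \<in> F"
    "facet_measure F = distr (restrict_space lborel P) borel (\<lambda>y. y - (n \<bullet> (y - a)) *\<^sub>R n)"
    "(\<lambda>y. y - (n \<bullet> (y - a)) *\<^sub>R n) \<in> measurable (restrict_space lborel P) borel"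
    using facet_measure_prism .
  have "P \<in> sets borel" using P(4) by (rule borel_compact)
  then have "emeasure (restrict_space lborel P) (space (restrict_space lborel P)) = emeasure lborel P"
    by (simp add: space_restrict_space emeasure_restrict_space)
  also have "\<dots> < \<infinity>" using emeasure_compact_finite[OF P(4)] by simp
  finally have "finite_measure (restrict_space lborel P)" by (intro finite_measureI) auto
  then show ?thesis unfolding P(6) using P(7) by (rule finite_measure.finite_measure_distr)
qed

lemma integrable_facet_measure_continuous:
  fixes f :: "real^'d \<Rightarrow> 'b::euclidean_space"
  assumes "continuous_on UNIV f"
  shows "integrable (facet_measure F) f"
proof -
  interpret finite_measure "facet_measure F" by (rule finite_measure_facet_measure)
  have "bounded (f ` F)"
    using F(1) assms by (intro compact_imp_bounded compact_continuous_image) (auto intro: continuous_on_subset)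
  then obtain B where "\<And>x. x \<in> F \<Longrightarrow> norm (f x) \<le> B" by (auto simp: bounded_iff)
  then have "AE x in facet_measure F. norm (f x) \<le> B" using AE_in_facet by auto
  moreover have "f \<in> borel_measurable (facet_measure F)"
    using borel_measurable_continuous_onI[OF assms] by (simp add: measurable_cong_sets[OF sets_facet_measure refl])
  ultimately show ?thesis by (intro integrable_const_bound[of _ B]) 
qed

lemma L2_fun_facet_measure_continuous:
  fixes f :: "real^'d \<Rightarrow> 'b::euclidean_space"
  assumes "continuous_on UNIV f"
  shows "L2_fun (facet_measure F) f"
  unfolding L2_fun_def
  using borel_measurable_integrable[OF integrable_facet_measure_continuous[OF assms]]
  by (auto intro!: integrable_facet_measure_continuous continuous_intros assms)

end

text \<open>The vectors from the apex to the base span the space, since otherwise the cone would lie in a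
hyperplane; two normals of the base are therefore proportional.  The normal that enters the
surface measure is an arbitrary choice, and this is why it may be replaced by the outward one.\<close>

lemma unit_normal_unique:
  fixes F :: "(real^'d::finite) set"
  assumes n: "unit_normal F n1" "unit_normal F n2"
    and F: "convex F" "F \<noteq> {}" and int: "interior (convex hull (insert a F)) \<noteq> {}"
  shows "n1 = n2 \<or> n1 = - n2"
proof -
  obtain y0 where y0: "y0 \<in> F" using F(2) by blast
  have zero: "w = 0" if w: "\<And>y. y \<in> F \<Longrightarrow> w \<bullet> (y - a) = 0" for w
  proof -
    obtain c e where ce: "0 < e" "ball c e \<subseteq> convex hull (insert a F)"
      using int by (auto simp: mem_interior)
    have perp: "w \<bullet> (x - a) = 0" if "x \<in> convex hull (insert a F)" for x
      using that w unfolding convex_hull_insert_cone[OF F] by auto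
    have "c \<in> ball c e" using ce(1) by simp
    then have c: "w \<bullet> (c - a) = 0" using ce(2) perp by blast
    show "w = 0"
    proof (rule ccontr)
      assume "w \<noteq> 0"
      define x where "x = c + (e / 2 / norm w) *\<^sub>R w"
      have "x \<in> ball c e" using ce(1) \<open>w \<noteq> 0\<close> by (simp add: x_def dist_norm)
      then have "w \<bullet> (x - a) = 0" using ce(2) perp by blast
      then have "w \<bullet> (x - c) = 0" using c by (simp add: inner_diff_right)
      then show False using \<open>w \<noteq> 0\<close> ce(1) by (simp add: x_def)
    qed
  qed
  have const: "k \<bullet> (y - a) = k \<bullet> (y0 - a)" if "unit_normal F k" "y \<in> F" for k y
    using unit_normalD(4)[OF that(1,2) y0] .
  have "n2 \<bullet> (y0 - a) \<noteq> 0"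
  proof
    assume "n2 \<bullet> (y0 - a) = 0"
    then have "n2 = 0" using const[OF n(2)] by (intro zero) simp
    then show False using n(2) by (simp add: unit_normal_def)
  qed
  moreover define c where "c = (n1 \<bullet> (y0 - a)) / (n2 \<bullet> (y0 - a))"
  ultimately have "(n1 - c *\<^sub>R n2) \<bullet> (y - a) = 0" if "y \<in> F" for y
    using const[OF n(1) that] const[OF n(2) that] by (simp add: inner_diff_left)
  then have "n1 - c *\<^sub>R n2 = 0" by (rule zero)
  then have "n1 = c *\<^sub>R n2" by simp
  moreover have "\<bar>c\<bar> = 1" using n calculation by (simp add: unit_normal_def)
  ultimately show ?thesis by (auto simp: abs_if split: if_splits)
qed

text \<open>The normal that defines the surface measure may point inwards.  The height of the cone enters
\<open>integral_cone_divergence\<close> through its absolute value, so that the result does not depend on this.\<close>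

lemma integral_cone_facet:
  fixes g :: "real^'d::finite \<Rightarrow> real"
  assumes F: "compact F" "convex F" "y0 \<in> F"
    and int: "interior (convex hull (insert a F)) \<noteq> {}"
    and n: "unit_normal F n" "n \<bullet> (y0 - a) > 0"
    and g': "C1_deriv g g'"
  shows "(LINT x:convex hull (insert a F)|lborel. CARD('d) * g x + g' x (x - a))
    = n \<bullet> (y0 - a) * (\<integral>x. g x \<partial>facet_measure F)"
proof -
  have "F \<noteq> {}" using F(3) by auto
  obtain k b P where P: "unit_normal F k" "b \<in> F" "P = {x + s *\<^sub>R k | x s. x \<in> F \<and> s \<in> {0..1}}"
    "compact P" "\<forall>z\<in>P. z - (k \<bullet> (z - b)) *\<^sub>R k \<in> F"
    "facet_measure F = distr (restrict_space lborel P) borel (\<lambda>y. y - (k \<bullet> (y - b)) *\<^sub>R k)"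
    "(\<lambda>y. y - (k \<bullet> (y - b)) *\<^sub>R k) \<in> measurable (restrict_space lborel P) borel"
    using facet_measure_prism[OF F(1) \<open>F \<noteq> {}\<close> n(1)] .
  have g: "continuous_on UNIV g" using g' by (rule C1_deriv_continuous)
  have h: "\<bar>k \<bullet> (b - a)\<bar> = n \<bullet> (y0 - a)"
  proof -
    have "n \<bullet> (b - a) = n \<bullet> (y0 - a)"
      using unit_normalD(4)[OF n(1) P(2) F(3)] .
    then show ?thesis
      using unit_normal_unique[OF P(1) n(1) F(2) \<open>F \<noteq> {}\<close> int] n(2) by auto
  qed
  have kF: "k \<bullet> (x - b) = 0" if "x \<in> F" for x using unit_normalD(3)[OF P(1) that P(2)] .
  have k1: "norm k = 1" using P(1) by (simp add: unit_normal_def)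
  have k0: "k \<bullet> (b - a) \<noteq> 0" using h n(2) by auto
  have "P \<in> sets borel" using P(4) by (rule borel_compact)
  then have "(\<integral>x. g x \<partial>facet_measure F) = (LINT z:P|lborel. g (z - (k \<bullet> (z - b)) *\<^sub>R k))"
    unfolding P(6) set_lebesgue_integral_def
    by (subst integral_distr[OF P(7)]) (use g in \<open>auto simp: integral_restrict_space intro: borel_measurable_continuous_onI\<close>)
  then show ?thesis
    using integral_cone_divergence[OF F(1,2) P(2) kF k1 refl k0 g' refl P(3)] h by simp
qed

section \<open>The divergence theorem on a simplex\<close>

lemma integrable_lebesgue_on_compact_subset:
  fixes f :: "'a::euclidean_space \<Rightarrow> 'b::euclidean_space"
  assumes "K \<in> sets borel" "bounded K" "continuous_on UNIV f"
  shows "integrable (lebesgue_on K) f"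
proof -
  have K: "compact (closure K)" using assms(2) by (simp add: compact_closure)
  have "set_integrable lborel (closure K) f"
    unfolding set_integrable_def
    by (rule borel_integrable_compact[OF K]) (use assms(3) in \<open>auto intro: continuous_on_subset\<close>)
  then have "set_integrable lborel K f"
    by (rule set_integrable_subset) (use assms(1) in \<open>auto simp: closure_subset\<close>)
  then have "f absolutely_integrable_on K" by (rule absolutely_integrable_lborelI)
  then show ?thesis
    using assms(1) by (simp add: set_integrable_def integrable_restrict_space)
qed

lemma lebesgue_integral_interior_convex:
  fixes f :: "'a::euclidean_space \<Rightarrow> real"
  assumes S: "compact S" "convex S" and f: "continuous_on UNIV f"
  shows "(LINT x|lebesgue_on (interior S). f x) = (LINT x:S|lborel. f x)"
proof -
  have i: "integrable (lebesgue_on (interior S)) f"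
    using S f by (intro integrable_lebesgue_on_compact_subset) (auto intro: bounded_subset[OF compact_imp_bounded interior_subset])
  have "(LINT x|lebesgue_on (interior S). f x) = integral (interior S) f"
    by (rule lebesgue_integral_eq_integral[OF i]) auto
  also have "\<dots> = integral S f"
  proof (rule integral_spike_set)
    have n: "negligible (S - interior S)"
      using negligible_convex_frontier[OF S(2)] S(1)
      by (simp add: frontier_def compact_imp_closed closure_closed)
    show "negligible {x \<in> interior S - S. f x \<noteq> 0}"
      by (rule negligible_subset[OF negligible_empty]) (use interior_subset in auto)
    show "negligible {x \<in> S - interior S. f x \<noteq> 0}"
      by (rule negligible_subset[OF n]) auto
  qed
  also have "\<dots> = (LINT x:S|lborel. f x)"
  proof -
    have "set_integrable lborel S f"
      unfolding set_integrable_def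
      by (rule borel_integrable_compact[OF S(1)]) (use f in \<open>auto intro: continuous_on_subset\<close>)
    then show ?thesis by (simp add: set_borel_integral_eq_integral)
  qed
  finally show ?thesis .
qed

locale nondegenerate_simplex =
  fixes C :: "(real^'d::finite) set"
  assumes independent: "\<not> affine_dependent C"
    and card: "card C = CARD('d) + 1"
begin

abbreviation S where "S \<equiv> convex hull C"
abbreviation K where "K \<equiv> interior S"
abbreviation opposite where "opposite a \<equiv> convex hull (C - {a})"

lemma finite_vertices: "finite C"
  using independent by (rule aff_independent_finite)

lemma compact_S: "compact S"
  using finite_vertices by (rule finite_imp_compact_convex_hull)

lemma interior_nonempty: "K \<noteq> {}"
  using interior_convex_hull_eq_empty[of C] independent card by simp

lemma closure_K: "closure K = S"
  using convex_closure_interior[of S] interior_nonempty compact_S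
  by (simp add: compact_imp_closed closure_closed)

lemma affine_hull_eq_UNIV: "affine hull C = UNIV"
proof -
  have "aff_dim C = DIM(real^'d)"
    using aff_dim_affine_independent[OF independent] card by simp
  then show ?thesis by (simp only: aff_dim_eq_full)
qed

lemma opposite_nonempty: "a \<in> C \<Longrightarrow> opposite a \<noteq> {}"
proof
  assume "a \<in> C" "opposite a = {}"
  then have "C \<subseteq> {a}" by simp
  then have "card C \<le> 1" using card_mono[of "{a}" C] by simp
  then show False using card zero_less_card_finite[where 'a = 'd] by simp
qed

lemma compact_opposite: "compact (opposite a)"
  using finite_vertices by (intro finite_imp_compact_convex_hull) auto

lemma convex_hull_insert_opposite: "a \<in> C \<Longrightarrow> convex hull (insert a (opposite a)) = S"
  using hull_insert[of convex a "C - {a}"] by (simp add: insert_absorb)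

lemma facets: "{F. F facet_of S} = opposite ` C"
  using facet_of_convex_hull_affine_independent[OF independent] opposite_nonempty by auto

lemma inj_opposite: "inj_on opposite C"
proof (rule inj_onI, rule ccontr)
  fix a b assume ab: "a \<in> C" "b \<in> C" "opposite a = opposite b" "a \<noteq> b"
  then have "a \<in> opposite b" by (intro hull_inc) auto
  then have "a \<in> opposite a" using ab by simp
  then have "a \<in> affine hull (C - {a})" using convex_hull_subset_affine_hull by blast
  then show False using independent ab by (auto simp: affine_dependent_def)
qed

lemma unit_normal_exists:
  assumes "a \<in> C"
  obtains n where "unit_normal (opposite a) n" "\<forall>y\<in>opposite a. n \<bullet> (y - a) > 0"
proof -
  have "\<not> affine_dependent (C - {a})"
    using independent affine_dependent_subset by blast
  then have "aff_dim (C - {a}) = CARD('d) - 1"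
    using aff_dim_affine_independent[of "C - {a}"] card assms finite_vertices
    by (simp add: card_Diff_singleton of_nat_diff)
  then have "aff_dim (opposite a) < DIM(real^'d)"
    by (simp add: aff_dim_convex_hull of_nat_diff)
  then obtain m b where m: "m \<noteq> 0" "opposite a \<subseteq> {x. m \<bullet> x = b}"
    by (rule aff_lowdim_subset_hyperplane)
  define n where "n = m /\<^sub>R norm m"
  have n: "unit_normal (opposite a) n"
  proof -
    have "n \<bullet> (x - y) = 0" if "x \<in> opposite a" "y \<in> opposite a" for x y
    proof -
      have "m \<bullet> x = b" "m \<bullet> y = b" using m(2) that by auto
      then show ?thesis by (simp add: n_def inner_diff_right)
    qed
    then show ?thesis using m(1) by (simp add: unit_normal_def n_def)
  qed
  obtain y0 where y0: "y0 \<in> opposite a" using opposite_nonempty[OF assms] by blast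
  have "n \<bullet> (y0 - a) \<noteq> 0"
  proof
    assume h: "n \<bullet> (y0 - a) = 0"
    have "n \<bullet> x = n \<bullet> a" if "x \<in> C" for x
    proof (cases "x = a")
      case False
      then have "x \<in> opposite a" using that by (intro hull_inc) auto
      then have "n \<bullet> (x - a) = 0" using unit_normalD(4)[OF n _ y0] h by metis
      then show ?thesis by (simp add: inner_diff_right)
    qed simp
    then have "C \<subseteq> {x. n \<bullet> x = n \<bullet> a}" by blast
    then have "affine hull C \<subseteq> {x. n \<bullet> x = n \<bullet> a}" by (intro hull_minimal affine_hyperplane)
    then have "n \<bullet> (a + n) = n \<bullet> a" using affine_hull_eq_UNIV by auto
    then show False using unit_normalD(2)[OF n] by (simp add: inner_add_right)
  qed
  then consider "n \<bullet> (y0 - a) > 0" | "(- n) \<bullet> (y0 - a) > 0" by fastforce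
  then show ?thesis
  proof cases
    case 1
    show ?thesis by (rule that[OF n]) (metis 1 unit_normalD(4)[OF n _ y0])
  next
    case 2
    have n': "unit_normal (opposite a) (- n)" using n by simp
    show ?thesis by (rule that[OF n']) (metis 2 unit_normalD(4)[OF n' _ y0])
  qed
qed

lemma outward_normal:
  assumes "a \<in> C"
  shows "unit_normal (opposite a) (outward_normal K (opposite a))"
    and "\<And>y. y \<in> opposite a \<Longrightarrow> outward_normal K (opposite a) \<bullet> (y - a) > 0"
    and "\<And>x y. x \<in> opposite a \<Longrightarrow> y \<in> K \<Longrightarrow> outward_normal K (opposite a) \<bullet> (y - x) < 0"
proof -
  obtain n where n: "unit_normal (opposite a) n" "\<forall>y\<in>opposite a. n \<bullet> (y - a) > 0"
    using unit_normal_exists[OF assms] .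
  obtain y0 where y0: "y0 \<in> opposite a" using opposite_nonempty[OF assms] by blast
  have S: "S = {a + t *\<^sub>R (y - a) | t y. t \<in> {0..1} \<and> y \<in> opposite a}"
    using convex_hull_insert_cone[OF convex_convex_hull opposite_nonempty[OF assms], of a]
    unfolding convex_hull_insert_opposite[OF assms] .
  have le: "n \<bullet> z \<le> n \<bullet> y0" if z: "z \<in> S" for z
  proof -
    obtain t y where ty: "z = a + t *\<^sub>R (y - a)" "0 \<le> t" "t \<le> 1" "y \<in> opposite a" using z S by auto
    have "n \<bullet> (z - a) = t * (n \<bullet> (y0 - a))"
      using unit_normalD(4)[OF n(1) ty(4) y0] by (simp add: ty(1))
    also have "\<dots> \<le> 1 * (n \<bullet> (y0 - a))"
      using ty bspec[OF n(2) y0] by (intro mult_right_mono) auto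
    finally show ?thesis by (simp add: inner_diff_right)
  qed
  have neg: "n \<bullet> (y - x) < 0" if x: "x \<in> opposite a" and y: "y \<in> K" for x y
  proof -
    obtain e where e: "0 < e" "cball y e \<subseteq> S" using y by (auto simp: mem_interior_cball)
    have "y + e *\<^sub>R n \<in> cball y e" using e unit_normalD(1)[OF n(1)] by (simp add: dist_norm)
    then have "n \<bullet> (y + e *\<^sub>R n) \<le> n \<bullet> y0" using e le by blast
    then have "n \<bullet> y + e \<le> n \<bullet> y0" using unit_normalD(2)[OF n(1)] by (simp add: inner_add_right)
    moreover have "n \<bullet> (x - y0) = 0" by (rule unit_normalD(3)[OF n(1) x y0])
    ultimately show ?thesis using e by (simp add: inner_diff_right)
  qed
  have "outward_normal K (opposite a) = n"
    unfolding outward_normal_def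
  proof (rule the_equality)
    show "norm n = 1 \<and> (\<forall>x\<in>opposite a. \<forall>y\<in>opposite a. n \<bullet> (x - y) = 0) \<and> (\<forall>x\<in>opposite a. \<forall>y\<in>K. n \<bullet> (y - x) < 0)"
      using n(1) neg by (simp add: unit_normal_def)
    fix m assume m: "norm m = 1 \<and> (\<forall>x\<in>opposite a. \<forall>y\<in>opposite a. m \<bullet> (x - y) = 0) \<and> (\<forall>x\<in>opposite a. \<forall>y\<in>K. m \<bullet> (y - x) < 0)"
    then have "unit_normal (opposite a) m" by (simp add: unit_normal_def)
    then have "m = n \<or> m = - n"
      using unit_normal_unique[OF _ n(1) convex_convex_hull opposite_nonempty[OF assms], of m a]
        interior_nonempty by (simp add: convex_hull_insert_opposite[OF assms])
    moreover obtain y where y: "y \<in> K" using interior_nonempty by blast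
    moreover have "m \<bullet> (y - y0) < 0" using m y y0 by blast
    ultimately show "m = n" using neg[OF y0 y] by auto
  qed
  then show "unit_normal (opposite a) (outward_normal K (opposite a))"
    "\<And>y. y \<in> opposite a \<Longrightarrow> outward_normal K (opposite a) \<bullet> (y - a) > 0"
    "\<And>x y. x \<in> opposite a \<Longrightarrow> y \<in> K \<Longrightarrow> outward_normal K (opposite a) \<bullet> (y - x) < 0"
    using n neg by auto
qed

text \<open>Writing \<open>a0 - e\<close> as an affine combination of the vertices and subtracting the vertex \<open>a0\<close> gives the
coefficients.  They sum to zero, so the combination of the fields \<open>x - a\<close> does not depend on \<open>x\<close>.  This reduces the
divergence theorem in direction \<open>e\<close> to radial fields.\<close>

lemma constant_vector_as_combination:
  obtains c where "sum c C = 0" "\<And>x. e = (\<Sum>a\<in>C. c a *\<^sub>R (x - a))"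
proof -
  obtain a0 where a0: "a0 \<in> C" using card by fastforce
  have "a0 - e \<in> affine hull C" using affine_hull_eq_UNIV by simp
  then obtain u where u: "sum u C = 1" "(\<Sum>a\<in>C. u a *\<^sub>R a) = a0 - e"
    using affine_hull_finite[OF finite_vertices] by auto
  define c where "c a = u a - (if a = a0 then 1 else 0)" for a
  have c0: "sum c C = 0"
    using u(1) a0 finite_vertices by (simp add: c_def sum_subtractf)
  have "(\<Sum>a\<in>C. c a *\<^sub>R a) = (\<Sum>a\<in>C. u a *\<^sub>R a) - (\<Sum>a\<in>C. (if a = a0 then a else 0))"
    by (simp add: c_def sum_subtractf[symmetric] scaleR_diff_left if_distrib[of "\<lambda>r. r *\<^sub>R _"] cong: if_cong)
  also have "\<dots> = - e" using u(2) a0 finite_vertices by simp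
  finally have "e = (\<Sum>a\<in>C. c a *\<^sub>R (x - a))" for x
    using c0 by (simp add: scaleR_diff_right sum_subtractf scaleR_sum_left[symmetric])
  with c0 show ?thesis by (rule that)
qed

lemma integral_cone_vertex:
  fixes g :: "real^'d \<Rightarrow> real"
  assumes a: "a \<in> C" and g: "C1_deriv g g'" and y: "y \<in> opposite a"
  shows "(LINT x|lebesgue_on K. CARD('d) * g x + g' x (x - a))
    = outward_normal K (opposite a) \<bullet> (y - a) * (\<integral>x. g x \<partial>facet_measure (opposite a))"
proof -
  have cont: "continuous_on UNIV (\<lambda>x. CARD('d) * g x + g' x (x - a))"
    by (intro continuous_intros C1_deriv_continuous[OF g] C1_deriv_continuous_apply[OF g])
  have "(LINT x|lebesgue_on K. CARD('d) * g x + g' x (x - a)) = (LINT x:S|lborel. CARD('d) * g x + g' x (x - a))"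
    by (rule lebesgue_integral_interior_convex[OF compact_S convex_convex_hull cont])
  also have "\<dots> = outward_normal K (opposite a) \<bullet> (y - a) * (\<integral>x. g x \<partial>facet_measure (opposite a))"
    using integral_cone_facet[OF compact_opposite convex_convex_hull y _ outward_normal(1)[OF a] outward_normal(2)[OF a y], of g g']
      g interior_nonempty
    by (simp add: convex_hull_insert_opposite[OF a])
  finally show ?thesis .
qed

text \<open>Let \<open>c\<close> be the coefficients of \<open>e\<close> with respect to the radial fields.  In the combination of the
divergences of \<open>(x - a) g(x)\<close> the terms \<open>d g(x)\<close> cancel, because the coefficients sum to zero, and
the derivative of \<open>g\<close> along \<open>e\<close> remains.  On the facet opposite \<open>a\<close> only the field based at \<open>a\<close> has
a normal component, and this component is constant; hence \<open>n \<bullet> e = c a * (n \<bullet> (y - a))\<close>.\<close>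

theorem gauss_simplex:
  fixes g :: "real^'d \<Rightarrow> real"
  assumes g: "C1_deriv g g'"
  shows "(LINT x|lebesgue_on K. g' x e)
    = (\<Sum>F | F facet_of S. (outward_normal K F \<bullet> e) * (\<integral>x. g x \<partial>facet_measure F))"
proof -
  obtain c where c: "sum c C = 0" "\<And>x. e = (\<Sum>a\<in>C. c a *\<^sub>R (x - a))"
    using constant_vector_as_combination by blast
  let ?d = "real CARD('d)"
  have lin: "linear (g' x)" for x using bounded_linear.linear[OF C1_deriv_bounded_linear[OF g]] .
  have pt: "g' x e = (\<Sum>a\<in>C. c a * (?d * g x + g' x (x - a)))" for x
  proof -
    have "g' x e = (\<Sum>a\<in>C. c a * g' x (x - a))"
      by (subst c(2)[of x]) (simp only: linear_sum[OF lin] linear_cmul[OF lin] real_scaleR_def)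
    also have "\<dots> = (\<Sum>a\<in>C. c a * (?d * g x + g' x (x - a))) - sum c C * (?d * g x)"
      by (simp add: sum_distrib_right distrib_left sum.distrib)
    finally show ?thesis using c(1) by simp
  qed
  have borel_K: "K \<in> sets borel" "bounded K"
    by (auto intro: bounded_subset[OF compact_imp_bounded[OF compact_S] interior_subset])
  have int: "integrable (lebesgue_on K) (\<lambda>x. ?d * g x + g' x (x - a))" for a
    by (intro integrable_lebesgue_on_compact_subset[OF borel_K] continuous_intros
        C1_deriv_continuous[OF g] C1_deriv_continuous_apply[OF g])
  have vertex: "c a * (LINT x|lebesgue_on K. ?d * g x + g' x (x - a))
      = (outward_normal K (opposite a) \<bullet> e) * (\<integral>x. g x \<partial>facet_measure (opposite a))"
    if a: "a \<in> C" for a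
  proof -
    let ?n = "outward_normal K (opposite a)"
    obtain y where y: "y \<in> opposite a" using opposite_nonempty[OF a] by blast
    have "?n \<bullet> e = (\<Sum>b\<in>C. c b * (?n \<bullet> (y - b)))"
      by (subst c(2)[of y]) (simp add: inner_sum_right)
    also have "\<dots> = (\<Sum>b\<in>C. if b = a then c a * (?n \<bullet> (y - a)) else 0)"
    proof (rule sum.cong[OF refl])
      fix b assume b: "b \<in> C"
      show "c b * (?n \<bullet> (y - b)) = (if b = a then c a * (?n \<bullet> (y - a)) else 0)"
      proof (cases "b = a")
        case False
        then have "b \<in> opposite a" using b by (intro hull_inc) auto
        then show ?thesis using unit_normalD(3)[OF outward_normal(1)[OF a] y, of b] False by simp
      qed simp
    qed
    also have "\<dots> = c a * (?n \<bullet> (y - a))" using a finite_vertices by simp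
    finally show ?thesis using integral_cone_vertex[OF a g y] by simp
  qed
  have "(LINT x|lebesgue_on K. g' x e) = (\<Sum>a\<in>C. c a * (LINT x|lebesgue_on K. ?d * g x + g' x (x - a)))"
    unfolding pt using int by (subst Bochner_Integration.integral_sum) auto
  also have "\<dots> = (\<Sum>a\<in>C. (outward_normal K (opposite a) \<bullet> e) * (\<integral>x. g x \<partial>facet_measure (opposite a)))"
    by (rule sum.cong[OF refl vertex])
  also have "\<dots> = (\<Sum>F\<in>opposite ` C. (outward_normal K F \<bullet> e) * (\<integral>x. g x \<partial>facet_measure F))"
    using inj_opposite by (subst sum.reindex) auto
  finally show ?thesis by (simp only: facets)
qed

end

section \<open>Polynomials are smooth\<close>

lemma smooth_imp_C1_deriv:
  fixes f :: "'a::euclidean_space \<Rightarrow> 'b::euclidean_space"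
  assumes "smooth f"
  shows "C1_deriv f (\<lambda>x. frechet_derivative f (at x))"
proof -
  have "C_k (Suc 0) f" using assms by (simp add: smooth_def)
  then have d: "(f has_derivative frechet_derivative f (at x)) (at x)" 
    and c: "\<And>b. b \<in> Basis \<Longrightarrow> continuous_on UNIV (\<lambda>x. frechet_derivative f (at x) b)" for x
    by (auto simp: frechet_derivative_works)
  have E: "frechet_derivative f (at x) w = (\<Sum>b\<in>Basis. (w \<bullet> b) *\<^sub>R frechet_derivative f (at x) b)" for x w
  proof -
    have "frechet_derivative f (at x) w = frechet_derivative f (at x) (\<Sum>b\<in>Basis. (w \<bullet> b) *\<^sub>R b)"
      by (simp add: euclidean_representation)
    then show ?thesis
      using has_derivative_linear[OF d[of x]] by (simp only: linear_sum linear_cmul)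
  qed
  have "continuous_on UNIV (\<lambda>x. \<Sum>b\<in>Basis. (w \<bullet> b) *\<^sub>R frechet_derivative f (at x) b)" for w
    by (intro continuous_intros c)
  then have "continuous_on UNIV (\<lambda>x. frechet_derivative f (at x) w)" for w
    by (rule continuous_on_eq) (rule E[symmetric])
  then show ?thesis using d by (auto simp: C1_deriv_def)
qed

lemma real_polynomial_function_has_derivative:
  fixes f :: "'a::real_normed_vector \<Rightarrow> real"
  assumes "real_polynomial_function f"
  shows "\<exists>f'. \<forall>x. (f has_derivative f' x) (at x) \<and> (\<forall>w. real_polynomial_function (\<lambda>x. f' x w))"
  using assms
proof induction
  case (linear f)
  then show ?case
    by (intro exI[of _ "\<lambda>_. f"]) (auto intro: bounded_linear_imp_has_derivative)
next
  case (const c)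
  then show ?case by (intro exI[of _ "\<lambda>_ _. 0"]) auto
next
  case (add f g)
  then obtain f' g' where "\<And>x. (f has_derivative f' x) (at x)" "\<And>x. (g has_derivative g' x) (at x)"
    "\<And>w. real_polynomial_function (\<lambda>x. f' x w)" "\<And>w. real_polynomial_function (\<lambda>x. g' x w)" by metis
  then show ?case
    by (intro exI[of _ "\<lambda>x w. f' x w + g' x w"]) (auto intro: has_derivative_add)
next
  case (mult f g)
  then obtain f' g' where "\<And>x. (f has_derivative f' x) (at x)" "\<And>x. (g has_derivative g' x) (at x)"
    "\<And>w. real_polynomial_function (\<lambda>x. f' x w)" "\<And>w. real_polynomial_function (\<lambda>x. g' x w)" by metis
  then show ?case using mult.hyps
    by (intro exI[of _ "\<lambda>x w. f x * g' x w + f' x w * g x"]) (intro allI conjI has_derivative_mult real_polynomial_function.intros(3,4), auto)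
qed

lemma polynomial_function_frechet:
  fixes f :: "'a::real_normed_vector \<Rightarrow> 'b::euclidean_space"
  assumes "polynomial_function f"
  shows "(f has_derivative frechet_derivative f (at x)) (at x)"
    and "polynomial_function (\<lambda>x. frechet_derivative f (at x) w)"
proof -
  have "\<forall>b\<in>Basis. real_polynomial_function (\<lambda>x. f x \<bullet> b)"
    using assms polynomial_function_iff_Basis_inner by blast
  then have "\<forall>b\<in>Basis. \<exists>f'. \<forall>x. ((\<lambda>x. f x \<bullet> b) has_derivative f' x) (at x) \<and> (\<forall>w. real_polynomial_function (\<lambda>x. f' x w))"
    using real_polynomial_function_has_derivative by blast
  then obtain D where D: "\<And>b x. b \<in> Basis \<Longrightarrow> ((\<lambda>x. f x \<bullet> b) has_derivative D b x) (at x)"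
    "\<And>b w. b \<in> Basis \<Longrightarrow> real_polynomial_function (\<lambda>x. D b x w)" by metis
  have der: "(f has_derivative (\<lambda>w. \<Sum>b\<in>Basis. D b x w *\<^sub>R b)) (at x)" for x
    by (subst has_derivative_componentwise_within) (simp add: D(1) inner_sum_left inner_Basis if_distrib cong: if_cong)
  have eq: "frechet_derivative f (at x) = (\<lambda>w. \<Sum>b\<in>Basis. D b x w *\<^sub>R b)" for x
    by (rule frechet_derivative_at[OF der, symmetric])
  show "(f has_derivative frechet_derivative f (at x)) (at x)" unfolding eq by (rule der)
  show "polynomial_function (\<lambda>x. frechet_derivative f (at x) w)"
    unfolding eq polynomial_function_iff_Basis_inner
    using D(2) by (simp add: inner_sum_left inner_Basis if_distrib cong: if_cong)
qed

lemma polynomial_function_continuous_on: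
  fixes f :: "'a::real_normed_vector \<Rightarrow> 'b::euclidean_space"
  assumes "polynomial_function f"
  shows "continuous_on X f"
  using polynomial_function_frechet(1)[OF assms]
  by (intro continuous_at_imp_continuous_on) (auto intro: has_derivative_continuous)

lemma polynomial_function_smooth:
  fixes f :: "'a::euclidean_space \<Rightarrow> 'b::euclidean_space"
  assumes "polynomial_function f"
  shows "smooth f"
proof -
  have "C_k k f" if "polynomial_function f" for k and f :: "'a \<Rightarrow> 'b"
    using that
  proof (induction k arbitrary: f)
    case 0
    then show ?case by (simp add: polynomial_function_continuous_on)
  next
    case (Suc k)
    then show ?case using polynomial_function_frechet[OF Suc.prems]
      by (auto simp: differentiable_def)
  qed
  then show ?thesis using assms by (simp add: smooth_def)
qed

text \<open>The sum in \<open>polynomial_deg\<close> ranges over this set and would be zero if the set were infinite.\<close>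

lemma finite_multi_indices: "finite {\<alpha> :: 'd::finite \<Rightarrow> nat. (\<Sum>i\<in>UNIV. \<alpha> i) \<le> p}"
proof (rule finite_subset)
  have "\<alpha> i \<le> (\<Sum>i\<in>UNIV. \<alpha> i)" for \<alpha> :: "'d \<Rightarrow> nat" and i
    by (rule member_le_sum) auto
  then show "{\<alpha> :: 'd \<Rightarrow> nat. (\<Sum>i\<in>UNIV. \<alpha> i) \<le> p} \<subseteq> PiE UNIV (\<lambda>_. {..p})"
    using le_trans by (fastforce simp: PiE_UNIV_domain)
  show "finite (PiE (UNIV :: 'd set) (\<lambda>_. {..p}))" by (intro finite_PiE) auto
qed

lemma polynomial_deg_imp_polynomial_function:
  assumes "polynomial_deg p f"
  shows "polynomial_function f"
proof -
  obtain c where f: "f = (\<lambda>x. \<Sum>\<alpha> | (\<Sum>i\<in>UNIV. \<alpha> i) \<le> p. (\<Prod>i\<in>UNIV. (x $ i) ^ \<alpha> i) *\<^sub>R c \<alpha>)"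
    using assms by (auto simp: polynomial_deg_def)
  have "real_polynomial_function (\<lambda>x::real^'a. x $ i)" for i
    by (intro real_polynomial_function.intros(1) bounded_linear_vec_nth)
  then have "real_polynomial_function (\<lambda>x::real^'a. (\<Prod>i\<in>UNIV. (x $ i) ^ \<alpha> i))" for \<alpha>
    by (intro real_polynomial_function_prod real_polynomial_function_power) auto
  then show ?thesis
    unfolding f polynomial_function_iff_Basis_inner using finite_multi_indices[of p]
    by (auto simp: inner_sum_left intro!: real_polynomial_function_sum real_polynomial_function.intros(4))
qed

lemma polynomial_deg_linear_combination:
  assumes "polynomial_deg p f" "polynomial_deg p g"
  shows "polynomial_deg p (\<lambda>x. a *\<^sub>R f x + b *\<^sub>R g x)"
proof -
  obtain c d where "\<And>x. f x = (\<Sum>\<alpha> | (\<Sum>i\<in>UNIV. \<alpha> i) \<le> p. (\<Prod>i\<in>UNIV. (x $ i) ^ \<alpha> i) *\<^sub>R c \<alpha>)"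
    "\<And>x. g x = (\<Sum>\<alpha> | (\<Sum>i\<in>UNIV. \<alpha> i) \<le> p. (\<Prod>i\<in>UNIV. (x $ i) ^ \<alpha> i) *\<^sub>R d \<alpha>)"
    using assms by (auto simp: polynomial_deg_def)
  then show ?thesis
    unfolding polynomial_deg_def
    by (intro exI[of _ "\<lambda>\<alpha>. a *\<^sub>R c \<alpha> + b *\<^sub>R d \<alpha>"])
       (simp add: scaleR_sum_right scaleR_add_right sum.distrib mult.commute)
qed

lemma polynomial_deg_const: "polynomial_deg p (\<lambda>x::real^'d::finite. c)"
proof -
  have "(\<Sum>\<alpha> | (\<Sum>i\<in>UNIV. \<alpha> i) \<le> p. (\<Prod>i\<in>UNIV. (x $ i) ^ \<alpha> i) *\<^sub>R (if \<alpha> = (\<lambda>_. 0) then c else 0)) = c"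
    for x :: "real^'d"
  proof -
    have "(\<Sum>\<alpha> | (\<Sum>i\<in>UNIV. \<alpha> i) \<le> p. (\<Prod>i\<in>UNIV. (x $ i) ^ \<alpha> i) *\<^sub>R (if \<alpha> = (\<lambda>_. 0) then c else 0))
      = (\<Sum>\<alpha> :: 'd \<Rightarrow> nat | (\<Sum>i\<in>UNIV. \<alpha> i) \<le> p. if \<alpha> = (\<lambda>_. 0) then c else 0)"
      by (intro sum.cong refl) auto
    also have "\<dots> = c"
      by (subst sum.delta[OF finite_multi_indices]) simp
    finally show ?thesis .
  qed
  then show ?thesis unfolding polynomial_deg_def
    by (intro exI[of _ "\<lambda>\<alpha>. if \<alpha> = (\<lambda>_. 0) then c else 0"]) simp
qed

section \<open>Traces of smooth functions on the facets of a simplex\<close>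

lemma norm_diff_square_bound:
  fixes a b :: "'a::real_inner"
  shows "(norm (a - b))\<^sup>2 \<le> 2 * (norm a)\<^sup>2 + 2 * (norm b)\<^sup>2"
proof -
  have "0 \<le> (norm (a + b))\<^sup>2" by simp
  then show ?thesis
    unfolding power2_norm_eq_inner by (simp add: inner_simps inner_commute)
qed

lemma L2_fun_diff:
  fixes f g :: "'a \<Rightarrow> 'b::euclidean_space"
  assumes "L2_fun M f" "L2_fun M g"
  shows "L2_fun M (\<lambda>x. f x - g x)"
proof -
  have m: "f \<in> borel_measurable M" "g \<in> borel_measurable M" using assms by (auto simp: L2_fun_def)
  have "integrable M (\<lambda>x. 2 * (norm (f x))\<^sup>2 + 2 * (norm (g x))\<^sup>2)"
    using assms by (auto simp: L2_fun_def)
  then have "integrable M (\<lambda>x. (norm (f x - g x))\<^sup>2)"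
  proof (rule Bochner_Integration.integrable_bound)
    show "(\<lambda>x. (norm (f x - g x))\<^sup>2) \<in> borel_measurable M" using m by measurable
    have "(norm (f x - g x))\<^sup>2 \<le> 2 * (norm (f x))\<^sup>2 + 2 * (norm (g x))\<^sup>2" for x
      using norm_diff_square_bound[of "f x" "g x"] .
    then show "AE x in M. norm ((norm (f x - g x))\<^sup>2) \<le> norm (2 * (norm (f x))\<^sup>2 + 2 * (norm (g x))\<^sup>2)"
      by (intro AE_I2) simp
  qed
  then show ?thesis using m by (auto simp: L2_fun_def)
qed
lemma sum_Basis_cart: "(\<Sum>b\<in>(Basis::(real^'n) set). f b) = (\<Sum>i\<in>UNIV. f (axis i 1))"
proof -
  have "bij_betw (\<lambda>i. axis i (1::real)) (UNIV::'n set) Basis"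
    by (auto simp: bij_betw_def inj_on_def axis_eq_axis Basis_vec_def)
  from sum.reindex_bij_betw[OF this, of f] show ?thesis by simp
qed

context nondegenerate_simplex
begin

lemma borel_K: "K \<in> sets borel" "bounded K"
  by (auto intro: bounded_subset[OF compact_imp_bounded[OF compact_S] interior_subset])

lemma integrable_K: "continuous_on UNIV f \<Longrightarrow> integrable (lebesgue_on K) f"
  for f :: "real^'d \<Rightarrow> 'b::euclidean_space"
  by (rule integrable_lebesgue_on_compact_subset[OF borel_K])

lemma L2_fun_K:
  fixes f :: "real^'d \<Rightarrow> 'b::euclidean_space"
  assumes "continuous_on UNIV f" "\<And>x. x \<in> K \<Longrightarrow> u x = f x"
  shows "L2_fun (lebesgue_on K) u"
proof -
  have "f \<in> borel_measurable (lebesgue_on K)"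
    using integrable_K[OF assms(1)] by (rule borel_measurable_integrable)
  then have "u \<in> borel_measurable (lebesgue_on K)"
    by (rule measurable_cong[THEN iffD1, rotated]) (simp add: assms(2) space_restrict_space)
  moreover have "integrable (lebesgue_on K) (\<lambda>x. (norm (f x))\<^sup>2)"
    by (intro integrable_K continuous_intros assms(1))
  then have "integrable (lebesgue_on K) (\<lambda>x. (norm (u x))\<^sup>2)"
    by (rule Bochner_Integration.integrable_cong[THEN iffD1, rotated -1]) (simp_all add: assms(2) space_restrict_space)
  ultimately show ?thesis by (simp add: L2_fun_def)
qed

lemma facet_cases:
  assumes "F facet_of S"
  obtains a where "a \<in> C" "F = opposite a"
  using assms facets by blast

lemma facet_has_normal:
  assumes "F facet_of S"
  shows "compact F" "F \<noteq> {}" "unit_normal F (outward_normal K F)"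
proof -
  obtain a where "a \<in> C" "F = opposite a" using assms by (rule facet_cases)
  then show "compact F" "F \<noteq> {}" "unit_normal F (outward_normal K F)"
    using compact_opposite opposite_nonempty outward_normal(1) by auto
qed

lemma facet_disjoint_K:
  assumes "F facet_of S" "x \<in> F"
  shows "x \<notin> K"
proof
  assume "x \<in> K"
  obtain a where a: "a \<in> C" "F = opposite a" using assms(1) by (rule facet_cases)
  have "x \<in> opposite a" using assms(2) a by simp
  from outward_normal(3)[OF a(1) this \<open>x \<in> K\<close>] show False by simp
qed

text \<open>The divergence theorem for the radial field \<open>(x - a) |\<psi>|\<^sup>2\<close>, which is tangential to all facets but
the one opposite \<open>a\<close>.  The free parameter \<open>\<delta>\<close> replaces the Cauchy-Schwarz inequality: the bound
will be used for functions that tend to zero in \<open>L\<^sup>2\<close> while their gradients merely stay bounded, and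
then the gradient term can be made small by the choice of \<open>\<delta>\<close>.\<close>

lemma trace_inequality:
  assumes F: "F facet_of S"
  obtains M where "\<forall>(\<psi> :: real^'d \<Rightarrow> 'b::euclidean_space) \<psi>' \<delta>. C1_deriv \<psi> \<psi>' \<and> \<delta> > 0 \<longrightarrow>
      (\<integral>x. (norm (\<psi> x))\<^sup>2 \<partial>facet_measure F)
        \<le> M * ((1 + 1 / \<delta>) * (LINT x|lebesgue_on K. (norm (\<psi> x))\<^sup>2)
             + \<delta> * (\<Sum>i\<in>UNIV. LINT x|lebesgue_on K. (norm (\<psi>' x (axis i 1)))\<^sup>2))" "M \<ge> 0"
proof -
  obtain a where a: "a \<in> C" "F = opposite a" using F by (rule facet_cases)
  obtain y where y: "y \<in> opposite a" using opposite_nonempty[OF a(1)] by blast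
  define h where "h = outward_normal K F \<bullet> (y - a)"
  have h: "h > 0" using outward_normal(2)[OF a(1) y] by (simp add: h_def a(2))
  have "bounded ((\<lambda>x. x - a) ` K)"
    using borel_K(2) by (rule bounded_translation_minus)
  then obtain R where R: "\<And>x. x \<in> K \<Longrightarrow> norm (x - a) \<le> R" "R > 0"
    by (auto simp: bounded_pos)
  let ?d = "real CARD('d)"
  define M where "M = (?d + ?d * R + R) / h"
  have "M \<ge> 0" using h R(2) by (simp add: M_def)
  moreover have "(\<integral>x. (norm (\<psi> x))\<^sup>2 \<partial>facet_measure F)
        \<le> M * ((1 + 1 / \<delta>) * (LINT x|lebesgue_on K. (norm (\<psi> x))\<^sup>2)
             + \<delta> * (\<Sum>i\<in>UNIV. LINT x|lebesgue_on K. (norm (\<psi>' x (axis i 1)))\<^sup>2))"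
    if C1: "C1_deriv \<psi> \<psi>'" and \<delta>: "\<delta> > 0" for \<psi> :: "real^'d \<Rightarrow> 'b" and \<psi>' \<delta>
  proof -
    define I where "I = (LINT x|lebesgue_on K. (norm (\<psi> x))\<^sup>2)"
    define J where "J = (\<Sum>i\<in>UNIV. LINT x|lebesgue_on K. (norm (\<psi>' x (axis i 1)))\<^sup>2)"
    have IJ: "I \<ge> 0" "J \<ge> 0"
      unfolding I_def J_def by (auto intro!: sum_nonneg)
    have cont: "continuous_on UNIV \<psi>" "\<And>w. continuous_on UNIV (\<lambda>x. \<psi>' x w)"
      using C1_deriv_continuous[OF C1] C1 by (auto simp: C1_deriv_def)
    have g: "C1_deriv (\<lambda>x. (norm (\<psi> x))\<^sup>2) (\<lambda>x w. 2 * (\<psi> x \<bullet> \<psi>' x w))"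
      using C1 cont unfolding C1_deriv_def power2_norm_eq_inner
      by (auto intro!: derivative_eq_intros continuous_intros simp: inner_commute)
    have pt: "2 * (\<psi> x \<bullet> \<psi>' x (x - a)) \<le> ?d * R / \<delta> * (norm (\<psi> x))\<^sup>2 + \<delta> * R * (\<Sum>i\<in>UNIV. (norm (\<psi>' x (axis i 1)))\<^sup>2)"
      if x: "x \<in> K" for x
    proof -
      have lin: "linear (\<psi>' x)" using bounded_linear.linear[OF C1_deriv_bounded_linear[OF C1]] .
      have "\<psi>' x (x - a) = \<psi>' x (\<Sum>b\<in>Basis. ((x - a) \<bullet> b) *\<^sub>R b)" by (simp add: euclidean_representation)
      also have "\<dots> = (\<Sum>i\<in>UNIV. ((x - a) \<bullet> axis i 1) *\<^sub>R \<psi>' x (axis i 1))"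
        by (simp only: sum_Basis_cart linear_sum[OF lin] linear_cmul[OF lin])
      finally have "2 * (\<psi> x \<bullet> \<psi>' x (x - a)) = (\<Sum>i\<in>UNIV. 2 * (((x - a) \<bullet> axis i 1) * (\<psi> x \<bullet> \<psi>' x (axis i 1))))"
        by (simp add: inner_sum_right sum_distrib_left)
      also have "\<dots> \<le> (\<Sum>i\<in>(UNIV::'d set). R * ((norm (\<psi> x))\<^sup>2 / \<delta> + \<delta> * (norm (\<psi>' x (axis i 1)))\<^sup>2))"
      proof (rule sum_mono)
        fix i :: 'd
        let ?p = "norm (\<psi> x)" and ?q = "norm (\<psi>' x (axis i 1))"
        have c1: "\<bar>(x - a) \<bullet> axis i 1\<bar> \<le> R"
          using component_le_norm_cart[of "x - a" i] R(1)[OF x] by (simp add: inner_axis)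
        have c2: "\<bar>\<psi> x \<bullet> \<psi>' x (axis i 1)\<bar> \<le> ?p * ?q" by (rule Cauchy_Schwarz_ineq2)
        have "((x - a) \<bullet> axis i 1) * (\<psi> x \<bullet> \<psi>' x (axis i 1)) \<le> \<bar>(x - a) \<bullet> axis i 1\<bar> * \<bar>\<psi> x \<bullet> \<psi>' x (axis i 1)\<bar>"
          by (metis abs_ge_self abs_mult)
        also have "\<dots> \<le> R * (?p * ?q)" using c1 c2 R(2) by (intro mult_mono) auto
        finally have 1: "2 * (((x - a) \<bullet> axis i 1) * (\<psi> x \<bullet> \<psi>' x (axis i 1))) \<le> R * (2 * (?p * ?q))" by simp
        have "0 \<le> (?p - \<delta> * ?q)\<^sup>2 / \<delta>" using \<delta> by simp
        also have "\<dots> = ?p\<^sup>2 / \<delta> + \<delta> * ?q\<^sup>2 - 2 * (?p * ?q)"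
          using \<delta> by (simp add: power2_eq_square field_simps)
        finally have "2 * (?p * ?q) \<le> ?p\<^sup>2 / \<delta> + \<delta> * ?q\<^sup>2" by simp
        then have "R * (2 * (?p * ?q)) \<le> R * (?p\<^sup>2 / \<delta> + \<delta> * ?q\<^sup>2)" using R(2) by (intro mult_left_mono) auto
        with 1 show "2 * (((x - a) \<bullet> axis i 1) * (\<psi> x \<bullet> \<psi>' x (axis i 1))) \<le> R * (?p\<^sup>2 / \<delta> + \<delta> * ?q\<^sup>2)" by linarith
      qed
      also have "\<dots> = ?d * R / \<delta> * (norm (\<psi> x))\<^sup>2 + \<delta> * R * (\<Sum>i\<in>(UNIV::'d set). (norm (\<psi>' x (axis i 1)))\<^sup>2)"
        by (simp add: sum.distrib sum_distrib_left distrib_left mult_ac)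
      finally show ?thesis .
    qed
    have int: "integrable (lebesgue_on K) (\<lambda>x. (norm (\<psi> x))\<^sup>2)"
      "\<And>i. integrable (lebesgue_on K) (\<lambda>x. (norm (\<psi>' x (axis i 1)))\<^sup>2)"
      by (intro integrable_K continuous_intros cont)+
    have "h * (\<integral>x. (norm (\<psi> x))\<^sup>2 \<partial>facet_measure F)
        = (LINT x|lebesgue_on K. ?d * (norm (\<psi> x))\<^sup>2 + 2 * (\<psi> x \<bullet> \<psi>' x (x - a)))"
      unfolding h_def a(2) using integral_cone_vertex[OF a(1) g y] by simp
    also have "\<dots> \<le> (LINT x|lebesgue_on K. ?d * (norm (\<psi> x))\<^sup>2
        + (?d * R / \<delta> * (norm (\<psi> x))\<^sup>2 + \<delta> * R * (\<Sum>i\<in>UNIV. (norm (\<psi>' x (axis i 1)))\<^sup>2)))"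
    proof (rule integral_mono_AE)
      show "integrable (lebesgue_on K) (\<lambda>x. ?d * (norm (\<psi> x))\<^sup>2 + 2 * (\<psi> x \<bullet> \<psi>' x (x - a)))"
        by (intro integrable_K continuous_intros cont C1_deriv_continuous_apply[OF C1])
      show "AE x in lebesgue_on K. ?d * (norm (\<psi> x))\<^sup>2 + 2 * (\<psi> x \<bullet> \<psi>' x (x - a))
         \<le> ?d * (norm (\<psi> x))\<^sup>2 + (?d * R / \<delta> * (norm (\<psi> x))\<^sup>2 + \<delta> * R * (\<Sum>i\<in>UNIV. (norm (\<psi>' x (axis i 1)))\<^sup>2))"
        by (intro AE_I2 add_left_mono pt) (simp add: space_restrict_space)
    qed (use int in auto)
    also have "\<dots> = ?d * I + (?d * R / \<delta> * I + \<delta> * R * J)"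
      unfolding I_def J_def using int by simp
    also have "\<dots> \<le> (?d + ?d * R + R) * ((1 + 1 / \<delta>) * I + \<delta> * J)"
    proof -
      have "(?d + ?d * R + R) * ((1 + 1 / \<delta>) * I + \<delta> * J) - (?d * I + (?d * R / \<delta> * I + \<delta> * R * J))
        = ?d / \<delta> * I + ?d * R * I + (R * (1 + 1 / \<delta>) * I) + (?d + ?d * R) * \<delta> * J"
        by (simp add: algebra_simps add_divide_distrib)
      also have "\<dots> \<ge> 0" using IJ R(2) \<delta> by simp
      finally show ?thesis by simp
    qed
    finally have "h * (\<integral>x. (norm (\<psi> x))\<^sup>2 \<partial>facet_measure F) \<le> (?d + ?d * R + R) * ((1 + 1 / \<delta>) * I + \<delta> * J)" .
    then show ?thesis
      using h unfolding M_def I_def[symmetric] J_def[symmetric] by (simp add: field_simps)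
  qed
  ultimately show ?thesis using that by blast
qed

end

context nondegenerate_simplex
begin

text \<open>Integration by parts against a test function: the product vanishes outside a compact subset of
the open simplex, in particular on all facets, so the divergence theorem has no boundary terms.\<close>

lemma weak_partial_classical:
  fixes f :: "real^'d \<Rightarrow> 'b::euclidean_space"
  assumes f: "C1_deriv f f'" and u: "\<And>x. x \<in> K \<Longrightarrow> u x = f x"
  shows "weak_partial K i u (\<lambda>x. f' x (axis i 1))"
proof -
  have cont: "continuous_on UNIV f" "\<And>w. continuous_on UNIV (\<lambda>x. f' x w)"
    using C1_deriv_continuous[OF f] f by (auto simp: C1_deriv_def)
  have "(LINT x|lebesgue_on K. partial i \<phi> x *\<^sub>R u x) = - (LINT x|lebesgue_on K. \<phi> x *\<^sub>R f' x (axis i 1))"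
    if test: "test_function K \<phi>" for \<phi>
  proof -
    obtain X where X: "X \<subseteq> K" "\<And>x. x \<notin> X \<Longrightarrow> \<phi> x = 0" and "smooth \<phi>"
      using test by (auto simp: test_function_def)
    define \<phi>' where "\<phi>' x = frechet_derivative \<phi> (at x)" for x
    have \<phi>: "C1_deriv \<phi> \<phi>'" using smooth_imp_C1_deriv[OF \<open>smooth \<phi>\<close>] by (simp add: \<phi>'_def[abs_def])
    have \<phi>cont: "continuous_on UNIV \<phi>" "\<And>w. continuous_on UNIV (\<lambda>x. \<phi>' x w)"
      using C1_deriv_continuous[OF \<phi>] \<phi> by (auto simp: C1_deriv_def)
    let ?e = "axis i 1 :: real^'d"
    have int: "integrable (lebesgue_on K) (\<lambda>x. \<phi>' x ?e *\<^sub>R f x)" "integrable (lebesgue_on K) (\<lambda>x. \<phi> x *\<^sub>R f' x ?e)"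
      by (intro integrable_K continuous_intros cont \<phi>cont)+
    have "(LINT x|lebesgue_on K. \<phi>' x ?e *\<^sub>R f x) + (LINT x|lebesgue_on K. \<phi> x *\<^sub>R f' x ?e) = 0"
    proof (rule euclidean_eqI)
      fix b :: 'b assume "b \<in> Basis"
      have "(\<integral>x. \<phi> x * (f x \<bullet> b) \<partial>facet_measure F) = 0" if F: "F facet_of S" for F
      proof (rule integral_eq_zero_AE)
        have "\<phi> x = 0" if "x \<in> F" for x using facet_disjoint_K[OF F that] X by blast
        then show "AE x in facet_measure F. \<phi> x * (f x \<bullet> b) = 0"
          using AE_in_facet[OF facet_has_normal[OF F]] by auto
      qed
      moreover have "C1_deriv (\<lambda>x. \<phi> x * (f x \<bullet> b)) (\<lambda>x w. \<phi> x * (f' x w \<bullet> b) + \<phi>' x w * (f x \<bullet> b))"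
        by (rule C1_deriv_mult[OF \<phi> C1_deriv_inner_left[OF f]])
      ultimately have "(LINT x|lebesgue_on K. \<phi> x * (f' x ?e \<bullet> b) + \<phi>' x ?e * (f x \<bullet> b)) = 0"
        by (subst gauss_simplex) auto
      moreover have "(LINT x|lebesgue_on K. \<phi> x * (f' x ?e \<bullet> b) + \<phi>' x ?e * (f x \<bullet> b))
          = (LINT x|lebesgue_on K. (\<phi> x *\<^sub>R f' x ?e) \<bullet> b) + (LINT x|lebesgue_on K. (\<phi>' x ?e *\<^sub>R f x) \<bullet> b)"
      proof -
        have "integrable (lebesgue_on K) (\<lambda>x. \<phi> x * (f' x ?e \<bullet> b))" "integrable (lebesgue_on K) (\<lambda>x. \<phi>' x ?e * (f x \<bullet> b))"
          by (intro integrable_K continuous_intros cont \<phi>cont)+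
        then show ?thesis by simp
      qed
      moreover have "\<dots> = (LINT x|lebesgue_on K. \<phi> x *\<^sub>R f' x ?e) \<bullet> b + (LINT x|lebesgue_on K. \<phi>' x ?e *\<^sub>R f x) \<bullet> b"
        by (simp only: integral_inner_left[OF int(1)] integral_inner_left[OF int(2)])
      ultimately show "((LINT x|lebesgue_on K. \<phi>' x ?e *\<^sub>R f x) + (LINT x|lebesgue_on K. \<phi> x *\<^sub>R f' x ?e)) \<bullet> b = 0 \<bullet> b"
        by (simp add: inner_add_left)
    qed
    moreover have "(LINT x|lebesgue_on K. partial i \<phi> x *\<^sub>R u x) = (LINT x|lebesgue_on K. \<phi>' x ?e *\<^sub>R f x)"
      by (intro Bochner_Integration.integral_cong) (auto simp: partial_def \<phi>'_def u space_restrict_space)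
    ultimately show ?thesis by (simp add: eq_neg_iff_add_eq_0)
  qed
  then show ?thesis
    unfolding weak_partial_def using L2_fun_K[OF cont(1) u] L2_fun_K[OF cont(2), of "\<lambda>x. f' x (axis i 1)"] by simp
qed

lemma H1_classical:
  fixes f :: "real^'d \<Rightarrow> 'b::euclidean_space"
  assumes f: "C1_deriv f f'" and u: "\<And>x. x \<in> K \<Longrightarrow> u x = f x"
  shows "u \<in> H1 K"
  unfolding H1_def using weak_partial_classical[OF f u] by blast

lemma is_trace_smooth:
  fixes f :: "real^'d \<Rightarrow> 'b::euclidean_space"
  assumes F: "F facet_of S" and f: "smooth f" and u: "\<And>x. x \<in> K \<Longrightarrow> u x = f x"
  shows "is_trace K F u f"
proof -
  define f' where "f' x = frechet_derivative f (at x)" for x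
  have C1: "C1_deriv f f'" using smooth_imp_C1_deriv[OF f] by (simp add: f'_def[abs_def])
  have z1: "(LINT x|lebesgue_on K. (norm (f x - u x))\<^sup>2) = 0"
    by (intro integral_eq_zero_AE AE_I2) (simp add: u space_restrict_space)
  have z2: "(LINT x|lebesgue_on K. (norm (partial i f x - f' x (axis i 1)))\<^sup>2) = 0" for i
    by (intro integral_eq_zero_AE AE_I2) (simp add: partial_def f'_def)
  show ?thesis
    unfolding is_trace_def
    by (intro conjI exI[of _ "\<lambda>i x. f' x (axis i 1)"] exI[of _ "\<lambda>_. f"] allI f
        weak_partial_classical[OF C1 u] L2_fun_facet_measure_continuous[OF facet_has_normal[OF F] C1_deriv_continuous[OF C1]])
       (simp_all add: z1 z2)
qed

text \<open>The approximating functions differ from \<open>f\<close> by functions \<open>\<psi>\<close> that tend to zero in \<open>L\<^sup>2\<close>.  Their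
gradients are bounded in \<open>L\<^sup>2\<close>, because those of the approximating functions converge, to
whatever limit.  So the trace inequality makes the restrictions of \<open>\<psi>\<close> to the facet tend to zero.\<close>

lemma trace_smooth_unique:
  fixes f :: "real^'d \<Rightarrow> 'b::euclidean_space"
  assumes F: "F facet_of S" and f: "smooth f" and u: "\<And>x. x \<in> K \<Longrightarrow> u x = f x"
    and w: "is_trace K F u w"
  shows "AE x in facet_measure F. w x = f x"
proof -
  define f' where "f' x = frechet_derivative f (at x)" for x
  have C1: "C1_deriv f f'" using smooth_imp_C1_deriv[OF f] by (simp add: f'_def[abs_def])
  have fcont: "continuous_on UNIV f" "\<And>w. continuous_on UNIV (\<lambda>x. f' x w)"
    using C1_deriv_continuous[OF C1] C1 by (auto simp: C1_deriv_def)
  have wL2: "L2_fun (facet_measure F) w" using w by (simp add: is_trace_def)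
  obtain g \<phi> where g: "\<And>i. weak_partial K i u (g i)" and \<phi>: "\<And>j::nat. smooth (\<phi> j)"
    and lim0: "(\<lambda>j. LINT x|lebesgue_on K. (norm (\<phi> j x - u x))\<^sup>2) \<longlonglongrightarrow> 0"
    and lim1: "\<And>i. (\<lambda>j. LINT x|lebesgue_on K. (norm (partial i (\<phi> j) x - g i x))\<^sup>2) \<longlonglongrightarrow> 0"
    and limF: "(\<lambda>j. LINT x|facet_measure F. (norm (\<phi> j x - w x))\<^sup>2) \<longlonglongrightarrow> 0"
    using w unfolding is_trace_def by blast
  define \<phi>' where "\<phi>' j x = frechet_derivative (\<phi> j) (at x)" for j x
  have \<phi>C1: "C1_deriv (\<phi> j) (\<phi>' j)" for j
    using smooth_imp_C1_deriv[OF \<phi>] by (simp add: \<phi>'_def[abs_def])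
  have \<phi>cont: "continuous_on UNIV (\<phi> j)" "\<And>w. continuous_on UNIV (\<lambda>x. \<phi>' j x w)" for j
    using C1_deriv_continuous[OF \<phi>C1] \<phi>C1[of j] by (auto simp: C1_deriv_def)
  define A where "A j = (LINT x|lebesgue_on K. (norm (\<phi> j x - f x))\<^sup>2)" for j
  define D where "D j = (\<Sum>i\<in>UNIV. LINT x|lebesgue_on K. (norm (\<phi>' j x (axis i 1) - f' x (axis i 1)))\<^sup>2)" for j
  define E where "E j = (\<integral>x. (norm (\<phi> j x - f x))\<^sup>2 \<partial>facet_measure F)" for j
  have A: "A \<longlonglongrightarrow> 0"
  proof -
    have "A = (\<lambda>j. LINT x|lebesgue_on K. (norm (\<phi> j x - u x))\<^sup>2)"
      unfolding A_def by (intro ext Bochner_Integration.integral_cong) (auto simp: u space_restrict_space)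
    then show ?thesis using lim0 by simp
  qed
  have "Bseq D"
  proof -
    have Di: "(LINT x|lebesgue_on K. (norm (\<phi>' j x (axis i 1) - f' x (axis i 1)))\<^sup>2)
      \<le> 2 * (LINT x|lebesgue_on K. (norm (partial i (\<phi> j) x - g i x))\<^sup>2)
        + 2 * (LINT x|lebesgue_on K. (norm (g i x - f' x (axis i 1)))\<^sup>2)" for i j
    proof -
      have gL2: "L2_fun (lebesgue_on K) (g i)" using g[of i] by (simp add: weak_partial_def)
      have p: "partial i (\<phi> j) = (\<lambda>x. \<phi>' j x (axis i 1))" by (simp add: partial_def[abs_def] \<phi>'_def)
      have i1: "integrable (lebesgue_on K) (\<lambda>x. (norm (partial i (\<phi> j) x - g i x))\<^sup>2)"
        using L2_fun_diff[OF L2_fun_K[OF \<phi>cont(2) refl] gL2, of j "axis i 1"] by (simp add: L2_fun_def p)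
      have i2: "integrable (lebesgue_on K) (\<lambda>x. (norm (g i x - f' x (axis i 1)))\<^sup>2)"
        using L2_fun_diff[OF gL2 L2_fun_K[OF fcont(2) refl], of "axis i 1"] by (simp add: L2_fun_def)
      have "(LINT x|lebesgue_on K. (norm (\<phi>' j x (axis i 1) - f' x (axis i 1)))\<^sup>2)
        \<le> (LINT x|lebesgue_on K. 2 * (norm (partial i (\<phi> j) x - g i x))\<^sup>2 + 2 * (norm (g i x - f' x (axis i 1)))\<^sup>2)"
      proof (rule integral_mono)
        show "integrable (lebesgue_on K) (\<lambda>x. (norm (\<phi>' j x (axis i 1) - f' x (axis i 1)))\<^sup>2)"
          by (intro integrable_K continuous_intros \<phi>cont fcont)
        show "(norm (\<phi>' j x (axis i 1) - f' x (axis i 1)))\<^sup>2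
            \<le> 2 * (norm (partial i (\<phi> j) x - g i x))\<^sup>2 + 2 * (norm (g i x - f' x (axis i 1)))\<^sup>2" for x
          using norm_diff_square_bound[of "partial i (\<phi> j) x - g i x" "f' x (axis i 1) - g i x"]
          by (simp add: p norm_minus_commute)
      qed (use i1 i2 in auto)
      then show ?thesis using i1 i2 by simp
    qed
    have "Bseq (\<lambda>j. LINT x|lebesgue_on K. (norm (partial i (\<phi> j) x - g i x))\<^sup>2)" for i
      using lim1[of i] by (intro convergent_imp_Bseq) (auto simp: convergent_def)
    then have "\<forall>i. \<exists>B. \<forall>j. \<bar>LINT x|lebesgue_on K. (norm (partial i (\<phi> j) x - g i x))\<^sup>2\<bar> \<le> B"
      unfolding Bseq_def by (metis real_norm_def)
    then obtain B where B: "\<And>i j. \<bar>LINT x|lebesgue_on K. (norm (partial i (\<phi> j) x - g i x))\<^sup>2\<bar> \<le> B i" by metis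
    have "D j \<le> (\<Sum>i\<in>UNIV. 2 * B i + 2 * (LINT x|lebesgue_on K. (norm (g i x - f' x (axis i 1)))\<^sup>2))" for j
      unfolding D_def
    proof (rule sum_mono)
      fix i
      show "(LINT x|lebesgue_on K. (norm (\<phi>' j x (axis i 1) - f' x (axis i 1)))\<^sup>2)
          \<le> 2 * B i + 2 * (LINT x|lebesgue_on K. (norm (g i x - f' x (axis i 1)))\<^sup>2)"
        using Di[of j i] B[of i j] by linarith
    qed
    moreover have "D j \<ge> 0" for j unfolding D_def by (intro sum_nonneg) auto
    ultimately show ?thesis by (intro BseqI'[where K = "\<Sum>i\<in>UNIV. 2 * B i + 2 * (LINT x|lebesgue_on K. (norm (g i x - f' x (axis i 1)))\<^sup>2)"]) simp
  qed
  then obtain G where G: "G > 0" "\<And>j. \<bar>D j\<bar> \<le> G" by (auto simp: Bseq_def)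
  obtain M where M0: "M \<ge> 0" and M: "\<forall>(\<psi> :: real^'d \<Rightarrow> 'b) \<psi>' \<delta>. C1_deriv \<psi> \<psi>' \<and> \<delta> > 0 \<longrightarrow>
      (\<integral>x. (norm (\<psi> x))\<^sup>2 \<partial>facet_measure F)
        \<le> M * ((1 + 1 / \<delta>) * (LINT x|lebesgue_on K. (norm (\<psi> x))\<^sup>2)
             + \<delta> * (\<Sum>i\<in>UNIV. LINT x|lebesgue_on K. (norm (\<psi>' x (axis i 1)))\<^sup>2))"
    using trace_inequality[OF F, where 'b = 'b] by metis
  have EM: "E j \<le> M * ((1 + 1 / \<delta>) * A j + \<delta> * D j)" if "\<delta> > 0" for j \<delta>
    using M[rule_format, OF conjI[OF C1_deriv_diff[OF \<phi>C1[of j] C1] that]] unfolding E_def A_def D_def .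
  have E0: "E j \<ge> 0" for j unfolding E_def by simp
  have E: "E \<longlonglongrightarrow> 0"
  proof (rule LIMSEQ_I)
    fix \<epsilon> :: real assume "\<epsilon> > 0"
    \<comment> \<open>This value makes the gradient term at most half of the prescribed accuracy.\<close>
    define \<delta> where "\<delta> = \<epsilon> / (2 * (M + 1) * G)"
    have \<delta>: "\<delta> > 0" using \<open>\<epsilon> > 0\<close> M0 G(1) by (simp add: \<delta>_def)
    have "(\<lambda>j. M * (1 + 1 / \<delta>) * A j) \<longlonglongrightarrow> M * (1 + 1 / \<delta>) * 0" by (intro tendsto_intros A)
    then obtain N where N: "\<And>j. j \<ge> N \<Longrightarrow> \<bar>M * (1 + 1 / \<delta>) * A j\<bar> < \<epsilon> / 2"
      using LIMSEQ_D[of _ 0 "\<epsilon> / 2"] \<open>\<epsilon> > 0\<close> by fastforce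
    have "norm (E j - 0) < \<epsilon>" if "j \<ge> N" for j
    proof -
      have \<delta>G: "\<delta> * G = \<epsilon> / (2 * (M + 1))" using G(1) by (simp add: \<delta>_def)
      have "M * (\<delta> * D j) \<le> M * (\<delta> * G)" using M0 \<delta> G(2)[of j] by (intro mult_left_mono) auto
      also have "\<dots> = \<epsilon> / 2 * (M / (M + 1))" unfolding \<delta>G by simp
      also have "\<dots> \<le> \<epsilon> / 2 * 1" using M0 \<open>\<epsilon> > 0\<close> by (intro mult_left_mono) auto
      finally have 1: "M * (\<delta> * D j) \<le> \<epsilon> / 2" by simp
      have "E j \<le> M * (1 + 1 / \<delta>) * A j + M * (\<delta> * D j)"
        using EM[OF \<delta>, of j] by (simp only: distrib_left[of M "(1 + 1 / \<delta>) * A j"] mult.assoc)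
      then show ?thesis using 1 N[OF that] E0[of j] by (simp only: real_norm_def diff_zero abs_of_nonneg)
    qed
    then show "\<exists>N. \<forall>j\<ge>N. norm (E j - 0) < \<epsilon>" by blast
  qed
  note FN = facet_has_normal[OF F]
  have fL2: "L2_fun (facet_measure F) f"
    using L2_fun_facet_measure_continuous[OF FN fcont(1)] .
  have intwf: "integrable (facet_measure F) (\<lambda>x. (norm (w x - f x))\<^sup>2)"
    using L2_fun_diff[OF wL2 fL2] by (simp add: L2_fun_def)
  define Q where "Q = (\<integral>x. (norm (w x - f x))\<^sup>2 \<partial>facet_measure F)"
  have "Q \<le> 2 * E j + 2 * (\<integral>x. (norm (\<phi> j x - w x))\<^sup>2 \<partial>facet_measure F)" for j
  proof -
    have i1: "integrable (facet_measure F) (\<lambda>x. (norm (\<phi> j x - f x))\<^sup>2)"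
      by (intro integrable_facet_measure_continuous[OF FN] continuous_intros \<phi>cont fcont)
    have i2: "integrable (facet_measure F) (\<lambda>x. (norm (\<phi> j x - w x))\<^sup>2)"
      using L2_fun_diff[OF L2_fun_facet_measure_continuous[OF FN \<phi>cont(1)] wL2] by (simp add: L2_fun_def)
    have "Q \<le> (\<integral>x. 2 * (norm (\<phi> j x - f x))\<^sup>2 + 2 * (norm (\<phi> j x - w x))\<^sup>2 \<partial>facet_measure F)"
      unfolding Q_def
    proof (rule integral_mono[OF intwf])
      show "(norm (w x - f x))\<^sup>2 \<le> 2 * (norm (\<phi> j x - f x))\<^sup>2 + 2 * (norm (\<phi> j x - w x))\<^sup>2" for x
        using norm_diff_square_bound[of "\<phi> j x - f x" "\<phi> j x - w x"] by simp
    qed (use i1 i2 in auto)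
    then show ?thesis using i1 i2 by (simp add: E_def)
  qed
  moreover have "(\<lambda>j. 2 * E j + 2 * (\<integral>x. (norm (\<phi> j x - w x))\<^sup>2 \<partial>facet_measure F)) \<longlonglongrightarrow> 2 * 0 + 2 * 0"
    by (intro tendsto_intros E limF)
  ultimately have "Q \<le> 0" by (intro LIMSEQ_le_const) auto
  moreover have "Q \<ge> 0" unfolding Q_def by simp
  ultimately have "Q = 0" by simp
  then have "AE x in facet_measure F. (norm (w x - f x))\<^sup>2 = 0"
    unfolding Q_def using intwf by (subst (asm) integral_nonneg_eq_0_iff_AE) auto
  then show ?thesis by simp
qed

lemma trace_on_smooth:
  fixes f :: "real^'d \<Rightarrow> 'b::euclidean_space"
  assumes F: "F facet_of S" and f: "smooth f" and u: "\<And>x. x \<in> K \<Longrightarrow> u x = f x"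
  shows "L2_fun (facet_measure F) (trace_on K F u)"
    and "AE x in facet_measure F. trace_on K F u x = f x"
proof -
  have "is_trace K F u f" by (rule is_trace_smooth[OF F f]) (rule u)
  then have tr: "is_trace K F u (trace_on K F u)"
    unfolding trace_on_def by (rule someI[of "is_trace K F u"])
  moreover have "AE x in facet_measure F. trace_on K F u x = f x"
    by (rule trace_smooth_unique[OF F f _ tr]) (rule u)
  ultimately show "L2_fun (facet_measure F) (trace_on K F u)"
    "AE x in facet_measure F. trace_on K F u x = f x"
    by (auto simp: is_trace_def)
qed

end

section \<open>Triangulated domains\<close>

locale triangulated_domain =
  fixes \<sigma> :: real and \<Omega> :: "(real^'d::finite) set" and \<T> :: "(real^'d) set set"
  assumes mesh: "conforming_triangulation \<sigma> \<Omega> \<T>"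
    and open_\<Omega>: "open \<Omega>"
begin

lemma finite_\<T>: "finite \<T>"
  using mesh by (simp add: conforming_triangulation_def)

lemma element_simplex:
  assumes "K \<in> \<T>"
  obtains C where "nondegenerate_simplex C" "K = interior (convex hull C)" "closure K = convex hull C"
proof -
  obtain S where S: "int CARD('d) simplex S" "K = interior S"
    using mesh assms unfolding conforming_triangulation_def by meson
  then obtain C where C: "\<not> affine_dependent C" "int (card C) = int CARD('d) + 1" "S = convex hull C"
    by (auto simp: simplex_def)
  then have "nondegenerate_simplex C" by unfold_locales auto
  moreover from this have "closure K = convex hull C"
    unfolding S(2) C(3) by (rule nondegenerate_simplex.closure_K)
  ultimately show ?thesis using that S(2) C(3) by blast
qed

lemma element_properties:
  assumes "K \<in> \<T>"
  shows "open K" "K \<noteq> {}" "interior (closure K) = K" "convex (closure K)" "compact (closure K)"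
    "finite {F. F facet_of closure K}" "aff_dim (closure K) = CARD('d)" "negligible (closure K - K)"
proof -
  obtain C where C: "nondegenerate_simplex C" "K = interior (convex hull C)" "closure K = convex hull C"
    using element_simplex[OF assms] .
  interpret nondegenerate_simplex C by (rule C(1))
  show "open K" "interior (closure K) = K" "convex (closure K)" using C by auto
  show "K \<noteq> {}" using interior_nonempty C(2) by simp
  show "compact (closure K)" using compact_S C(3) by simp
  show "finite {F. F facet_of closure K}" using facets finite_vertices C(3) by simp
  show "aff_dim (closure K) = CARD('d)"
    using card aff_dim_affine_independent[OF independent] by (simp add: C(3) aff_dim_convex_hull)
  have "negligible (frontier (convex hull C))" by (rule negligible_convex_frontier) simp
  then show "negligible (closure K - K)"
    using C(2,3) compact_S by (simp add: frontier_def compact_imp_closed closure_closed)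
qed

lemma element_subset: "K \<in> \<T> \<Longrightarrow> K \<subseteq> \<Omega>"
  using mesh by (simp add: conforming_triangulation_def)

lemma cover: "(\<Union>K\<in>\<T>. closure K) = closure \<Omega>"
  using mesh by (simp add: conforming_triangulation_def)

lemma common_face:
  "\<lbrakk>K \<in> \<T>; L \<in> \<T>\<rbrakk> \<Longrightarrow> (closure K \<inter> closure L) face_of closure K \<and> (closure K \<inter> closure L) face_of closure L"
  using mesh unfolding conforming_triangulation_def by blast

text \<open>If two elements meet, their common face contains an interior point of either simplex, and a face
with an interior point is the whole simplex.\<close>

lemma elements_disjoint:
  assumes "K \<in> \<T>" "L \<in> \<T>" "K \<noteq> L"
  shows "K \<inter> L = {}"
proof (rule ccontr)
  assume "K \<inter> L \<noteq> {}"
  then obtain x where x: "x \<in> K" "x \<in> L" by blast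
  then have "x \<in> closure K \<inter> closure L" using closure_subset by blast
  then have "closure K \<inter> closure L = closure K" "closure K \<inter> closure L = closure L"
    using face_of_disjoint_interior common_face[OF assms(1,2)] x
      element_properties(3)[OF assms(1)] element_properties(3)[OF assms(2)] by blast+
  then have "interior (closure K) = interior (closure L)" by simp
  then show False using assms element_properties(3) by simp
qed

text \<open>Take a relative interior point \<open>x\<close> of \<open>F\<close> in the domain.  Points of the domain just outside \<open>K\<close>, in
the direction of the outward normal at \<open>x\<close>, lie in other elements; these are finitely many closed
sets, so \<open>x\<close> lies in one of them, say \<open>L\<close>.  The common face of \<open>K\<close> and \<open>L\<close> contains \<open>x\<close> and hence \<open>F\<close>; it is
a proper face of \<open>K\<close>, and so it is \<open>F\<close> for reasons of dimension.\<close>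

lemma facet_in_interfaces:
  assumes K: "K \<in> \<T>" and F: "F facet_of closure K" and meets: "F \<inter> \<Omega> \<noteq> {}"
  shows "F \<in> interfaces \<Omega> \<T>"
proof -
  obtain C where C: "nondegenerate_simplex C" "K = interior (convex hull C)" "closure K = convex hull C"
    using element_simplex[OF K] .
  interpret S: nondegenerate_simplex C by (rule C(1))
  have FS: "F facet_of convex hull C" using F C(3) by simp
  obtain a where a: "a \<in> C" "F = convex hull (C - {a})" using FS by (rule S.facet_cases)
  have F_face: "F face_of closure K" using F by (simp add: facet_of_def)
  have "convex F" using a by simp
  then have "\<Omega> \<inter> closure (rel_interior F) \<noteq> {}"
    using meets closure_subset[of F] by (auto simp: convex_closure_rel_interior)
  then obtain x where x: "x \<in> \<Omega>" "x \<in> rel_interior F"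
    using open_Int_closure_eq_empty[OF open_\<Omega>] by blast
  have xF: "x \<in> F" using x(2) rel_interior_subset by blast
  define \<nu> where "\<nu> = outward_normal K F"
  have \<nu>: "norm \<nu> = 1" "\<nu> \<bullet> \<nu> = 1" and out: "\<nu> \<bullet> (y - x) < 0" if "y \<in> K" for y
    using unit_normalD(1,2)[OF S.outward_normal(1)[OF a(1)]] S.outward_normal(3)[OF a(1), of x y] that xF
    by (auto simp: \<nu>_def C(2) a(2))
  have "closure K \<subseteq> {y. \<nu> \<bullet> y \<le> \<nu> \<bullet> x}"
    using out by (intro closure_minimal closed_halfspace_le) (auto simp: inner_diff_right less_imp_le)
  then have out_le: "\<nu> \<bullet> y \<le> \<nu> \<bullet> x" if "y \<in> closure K" for y using that by blast
  have \<nu>1: "norm \<nu> = 1" "\<nu> \<bullet> \<nu> = 1" using \<nu> element_properties(2)[OF K] by auto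
  define X where "X = (\<Union>L\<in>\<T> - {K}. closure L)"
  have "closed X" unfolding X_def using finite_\<T> by (intro closed_UN) auto
  have "x \<in> X"
  proof (rule ccontr)
    assume "x \<notin> X"
    then have "open (\<Omega> \<inter> - X)" "x \<in> \<Omega> \<inter> - X" using x open_\<Omega> \<open>closed X\<close> by auto
    then obtain e where e: "e > 0" "cball x e \<subseteq> \<Omega> \<inter> - X" using open_contains_cball by blast
    have "x + e *\<^sub>R \<nu> \<in> cball x e" using e(1) \<nu>1 by (simp add: dist_norm)
    then have "x + e *\<^sub>R \<nu> \<in> \<Omega>" "x + e *\<^sub>R \<nu> \<notin> X" using e(2) by blast+
    then have "x + e *\<^sub>R \<nu> \<in> closure K" using cover closure_subset[of \<Omega>] by (auto simp: X_def)
    from out_le[OF this] show False using e(1) \<nu>1 by (simp add: inner_add_right)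
  qed
  then obtain L where L: "L \<in> \<T>" "L \<noteq> K" "x \<in> closure L" by (auto simp: X_def)
  define G where "G = closure K \<inter> closure L"
  have G: "G face_of closure K" "G face_of closure L" using common_face[OF K L(1)] by (auto simp: G_def)
  have "F \<subseteq> closure K" using F by (rule facet_of_imp_subset)
  have FG: "F \<subseteq> G"
    using L(3) x(2) xF \<open>F \<subseteq> closure K\<close> by (intro subset_of_face_of[OF G(1)]) (auto simp: G_def)
  have "G \<noteq> closure K"
  proof
    assume "G = closure K"
    then have "interior (closure K) \<subseteq> interior (closure L)" by (intro interior_mono) (auto simp: G_def)
    then have "K \<subseteq> L" using element_properties(3) K L by simp
    then show False using elements_disjoint[OF K L(1)] L(2) element_properties(2)[OF K] by blast
  qed
  then have "aff_dim G < aff_dim (closure K)"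
    using G(1) element_properties(4)[OF K] by (intro face_of_aff_dim_lt)
  moreover have "aff_dim F = aff_dim (closure K) - 1" using F by (simp add: facet_of_def)
  ultimately have "aff_dim G \<le> aff_dim F" by simp
  moreover have "F face_of G" using F_face FG by (rule face_of_subset) (auto simp: G_def)
  moreover have "convex G" using G(1) face_of_imp_convex by blast
  ultimately have "F = G" using face_of_aff_dim_lt[of G F] by force
  then have "F facet_of closure L"
    using G(2) F element_properties(7)[OF K] element_properties(7)[OF L(1)] by (auto simp: facet_of_def)
  then show ?thesis using meets K L F unfolding interfaces_def by blast
qed

lemma negligible_skeleton: "negligible (\<Omega> - \<Union>\<T>)"
proof (rule negligible_subset)
  show "negligible (\<Union>K\<in>\<T>. closure K - K)"
    using finite_\<T> element_properties(8) by (intro negligible_Union) auto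
  show "\<Omega> - \<Union>\<T> \<subseteq> (\<Union>K\<in>\<T>. closure K - K)"
    using cover closure_subset[of \<Omega>] by blast
qed

text \<open>Discrete functions are determined on the open elements only, where they agree with a polynomial
that is defined everywhere.  With \<open>P\<close> for the kind of the global function, one closure lemma for
each operation shows that the integrands of the scheme are integrable and that their traces can
be computed; differentiation stays within the class because the elements are open.\<close>

definition elementwise :: "((real^'d \<Rightarrow> 'b) \<Rightarrow> bool) \<Rightarrow> (real^'d \<Rightarrow> 'b) \<Rightarrow> bool" where
  "elementwise P u \<longleftrightarrow> (\<forall>K\<in>\<T>. \<exists>f. P f \<and> (\<forall>x\<in>K. u x = f x))"

abbreviation "pw_continuous u \<equiv> elementwise (continuous_on UNIV) u"
abbreviation "pw_polynomial u \<equiv> elementwise polynomial_function u"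

lemma elementwise_map:
  assumes "elementwise P u" and "\<And>f. P f \<Longrightarrow> Q (\<lambda>x. h (f x))"
  shows "elementwise Q (\<lambda>x. h (u x))"
  unfolding elementwise_def
proof
  fix K assume K: "K \<in> \<T>"
  obtain f where f: "P f" "\<forall>x\<in>K. u x = f x" using assms(1) K unfolding elementwise_def by blast
  show "\<exists>k. Q k \<and> (\<forall>x\<in>K. h (u x) = k x)"
    by (rule exI[of _ "\<lambda>x. h (f x)"]) (use f assms(2)[OF f(1)] in simp)
qed

lemma elementwise_map2:
  assumes "elementwise P u" "elementwise R w" and "\<And>f g. P f \<Longrightarrow> R g \<Longrightarrow> Q (\<lambda>x. h (f x) (g x))"
  shows "elementwise Q (\<lambda>x. h (u x) (w x))"
  unfolding elementwise_def
proof
  fix K assume K: "K \<in> \<T>"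
  obtain f where f: "P f" "\<forall>x\<in>K. u x = f x" using assms(1) K unfolding elementwise_def by blast
  obtain g where g: "R g" "\<forall>x\<in>K. w x = g x" using assms(2) K unfolding elementwise_def by blast
  show "\<exists>k. Q k \<and> (\<forall>x\<in>K. h (u x) (w x) = k x)"
    by (rule exI[of _ "\<lambda>x. h (f x) (g x)"]) (use f g assms(3)[OF f(1) g(1)] in simp)
qed

lemma elementwise_cong:
  assumes "elementwise P u" "\<And>K x. \<lbrakk>K \<in> \<T>; x \<in> K\<rbrakk> \<Longrightarrow> w x = u x"
  shows "elementwise P w"
  unfolding elementwise_def
proof
  fix K assume K: "K \<in> \<T>"
  obtain f where "P f" "\<forall>x\<in>K. u x = f x" using assms(1) K unfolding elementwise_def by blast
  then show "\<exists>f. P f \<and> (\<forall>x\<in>K. w x = f x)" using assms(2) K by (intro exI[of _ f]) auto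
qed

lemma pw_polynomial_continuous:
  fixes u :: "real^'d \<Rightarrow> 'b::euclidean_space"
  shows "pw_polynomial u \<Longrightarrow> pw_continuous u"
  using polynomial_function_continuous_on unfolding elementwise_def by blast

lemma absolutely_integrable_pw_continuous:
  fixes u :: "real^'d \<Rightarrow> 'b::euclidean_space"
  assumes u: "pw_continuous u"
  shows "K \<in> \<T> \<Longrightarrow> u absolutely_integrable_on K" and "u absolutely_integrable_on \<Omega>"
proof -
  show K: "u absolutely_integrable_on K" if K: "K \<in> \<T>" for K
  proof -
    obtain f where f: "continuous_on UNIV f" "\<forall>x\<in>K. u x = f x" using u K unfolding elementwise_def by blast
    have "integrable (lebesgue_on K) f"
      using element_properties[OF K] f(1)
      by (intro integrable_lebesgue_on_compact_subset) (auto intro: bounded_subset[OF compact_imp_bounded closure_subset])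
    then have "f absolutely_integrable_on K"
      using element_properties(1)[OF K] by (simp add: set_integrable_def integrable_restrict_space)
    then show ?thesis
      by (rule set_integrable_cong[THEN iffD1, rotated -1]) (use f in auto)
  qed
  have "u absolutely_integrable_on \<Union>\<A>" if "finite \<A>" "\<A> \<subseteq> \<T>" for \<A>
    using that
  proof induction
    case empty
    then show ?case by (simp add: absolutely_integrable_negligible)
  next
    case (insert K \<A>)
    then show ?case using K by (auto intro: absolutely_integrable_Un)
  qed
  then have "u absolutely_integrable_on \<Union>\<T>" using finite_\<T> by blast
  then show "u absolutely_integrable_on \<Omega>"
  proof (rule absolutely_integrable_spike_set)
    show "negligible {x \<in> \<Omega> - \<Union>\<T>. u x \<noteq> 0}"
      by (rule negligible_subset[OF negligible_skeleton]) auto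
    show "negligible {x \<in> \<Union>\<T> - \<Omega>. u x \<noteq> 0}"
      by (rule negligible_subset[OF negligible_empty]) (use element_subset in auto)
  qed
qed

lemma integrable_pw_continuous:
  fixes u :: "real^'d \<Rightarrow> 'b::euclidean_space"
  assumes "pw_continuous u"
  shows "integrable (lebesgue_on \<Omega>) u"
  using absolutely_integrable_pw_continuous(2)[OF assms] open_\<Omega>
  by (simp add: set_integrable_def integrable_restrict_space)

lemma integral_by_elements:
  fixes u :: "real^'d \<Rightarrow> real"
  assumes u: "pw_continuous u"
  shows "(LINT x|lebesgue_on \<Omega>. u x) = (\<Sum>K\<in>\<T>. LINT x|lebesgue_on K. u x)"
proof -
  have "(LINT x|lebesgue_on \<Omega>. u x) = integral \<Omega> u"
    using open_\<Omega> by (intro lebesgue_integral_eq_integral integrable_pw_continuous u) auto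
  also have "\<dots> = integral (\<Union>\<T>) u"
  proof (rule integral_spike_set)
    show "negligible {x \<in> \<Omega> - \<Union>\<T>. u x \<noteq> 0}"
      by (rule negligible_subset[OF negligible_skeleton]) auto
    show "negligible {x \<in> \<Union>\<T> - \<Omega>. u x \<noteq> 0}"
      by (rule negligible_subset[OF negligible_empty]) (use element_subset in auto)
  qed
  also have "\<dots> = (\<Sum>K\<in>\<T>. integral K u)"
  proof (rule integral_unique, rule has_integral_Union[OF finite_\<T>])
    show "(u has_integral integral K u) K" if "K \<in> \<T>" for K
      using absolutely_integrable_pw_continuous(1)[OF u that] by (intro integrable_integral) (simp add: absolutely_integrable_on_def)
    show "pairwise (\<lambda>S S'. negligible (S \<inter> S')) \<T>"
      by (auto simp: pairwise_def elements_disjoint)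
  qed
  also have "\<dots> = (\<Sum>K\<in>\<T>. LINT x|lebesgue_on K. u x)"
  proof (rule sum.cong[OF refl])
    fix K assume K: "K \<in> \<T>"
    have "integrable (lebesgue_on K) u"
      using absolutely_integrable_pw_continuous(1)[OF u K] element_properties(1)[OF K]
      by (simp add: set_integrable_def integrable_restrict_space)
    then show "integral K u = (LINT x|lebesgue_on K. u x)"
      using element_properties(1)[OF K] by (subst lebesgue_integral_eq_integral) auto
  qed
  finally show ?thesis .
qed

text \<open>Identities between derivatives of discrete functions hold on the open elements only; the values
on the remaining null set are arbitrary.\<close>

lemma integral_elementwise_cong:
  fixes u :: "real^'d \<Rightarrow> real"
  assumes u: "pw_continuous u" and eq: "\<And>K x. \<lbrakk>K \<in> \<T>; x \<in> K\<rbrakk> \<Longrightarrow> w x = u x"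
  shows "(LINT x|lebesgue_on \<Omega>. w x) = (LINT x|lebesgue_on \<Omega>. u x)"
proof -
  have w: "pw_continuous w" using elementwise_cong[OF u eq] .
  show ?thesis
    unfolding integral_by_elements[OF u] integral_by_elements[OF w]
    by (intro sum.cong refl Bochner_Integration.integral_cong) (auto simp: eq space_restrict_space)
qed

end

section \<open>The divergence theorem for piecewise polynomials\<close>

lemma polynomial_function_inner_product:
  fixes f g :: "'a::real_normed_vector \<Rightarrow> 'b::euclidean_space"
  assumes "polynomial_function f" "polynomial_function g"
  shows "polynomial_function (\<lambda>x. f x \<bullet> g x)"
proof -
  have "real_polynomial_function (\<lambda>x. \<Sum>b\<in>Basis. (f x \<bullet> b) * (g x \<bullet> b))"
    using assms unfolding polynomial_function_iff_Basis_inner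
    by (intro real_polynomial_function_sum real_polynomial_function.intros(4)) auto
  then show ?thesis
    by (subst euclidean_inner) (simp only: real_polynomial_function_eq)
qed

lemma partial_eqI:
  fixes u :: "real^'d::finite \<Rightarrow> 'b::real_normed_vector"
  assumes "(u has_derivative D) (at x)"
  shows "partial i u x = D (axis i 1)"
  using frechet_derivative_at[OF assms] by (simp add: partial_def)

context triangulated_domain
begin

lemma pw_polynomial_has_derivative:
  fixes u :: "real^'d \<Rightarrow> 'b::euclidean_space"
  assumes K: "K \<in> \<T>" "x \<in> K" and f: "polynomial_function f" "\<forall>x\<in>K. u x = f x"
  shows "(u has_derivative frechet_derivative f (at x)) (at x)"
  using polynomial_function_frechet(1)[OF f(1)]
  by (rule has_derivative_transform_within_open[OF _ element_properties(1)[OF K(1)] K(2)]) (use f in auto)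

lemma pw_polynomial_differentiable:
  fixes u :: "real^'d \<Rightarrow> 'b::euclidean_space"
  assumes "pw_polynomial u" "K \<in> \<T>" "x \<in> K"
  shows "u differentiable (at x)"
proof -
  obtain f where "polynomial_function f" "\<forall>x\<in>K. u x = f x" using assms unfolding elementwise_def by blast
  from pw_polynomial_has_derivative[OF assms(2,3) this] show ?thesis by (auto simp: differentiable_def)
qed

lemma pw_polynomial_partial:
  fixes u :: "real^'d \<Rightarrow> 'b::euclidean_space"
  assumes "pw_polynomial u"
  shows "pw_polynomial (partial i u)"
  unfolding elementwise_def
proof
  fix K assume K: "K \<in> \<T>"
  obtain f where f: "polynomial_function f" "\<forall>x\<in>K. u x = f x" using assms K unfolding elementwise_def by blast
  show "\<exists>g. polynomial_function g \<and> (\<forall>x\<in>K. partial i u x = g x)"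
    by (intro exI[of _ "\<lambda>x. frechet_derivative f (at x) (axis i 1)"] conjI ballI
        polynomial_function_frechet(2)[OF f(1)] partial_eqI pw_polynomial_has_derivative[OF K _ f])
qed

lemma pw_polynomial_const: "pw_polynomial (\<lambda>_. c)"
  unfolding elementwise_def by (intro ballI exI[of _ "\<lambda>_. c"]) auto

lemma pw_polynomial_add:
  fixes u w :: "real^'d \<Rightarrow> 'b::euclidean_space"
  shows "\<lbrakk>pw_polynomial u; pw_polynomial w\<rbrakk> \<Longrightarrow> pw_polynomial (\<lambda>x. u x + w x)"
  by (rule elementwise_map2[where P = polynomial_function and R = polynomial_function and h = "(+)"]) auto

lemma pw_polynomial_diff:
  fixes u w :: "real^'d \<Rightarrow> 'b::euclidean_space"
  shows "\<lbrakk>pw_polynomial u; pw_polynomial w\<rbrakk> \<Longrightarrow> pw_polynomial (\<lambda>x. u x - w x)"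
  by (rule elementwise_map2[where P = polynomial_function and R = polynomial_function and h = "(-)"]) auto

lemma pw_polynomial_scaleR:
  fixes u :: "real^'d \<Rightarrow> real" and w :: "real^'d \<Rightarrow> 'b::euclidean_space"
  shows "\<lbrakk>pw_polynomial u; pw_polynomial w\<rbrakk> \<Longrightarrow> pw_polynomial (\<lambda>x. u x *\<^sub>R w x)"
  by (rule elementwise_map2[where P = polynomial_function and R = polynomial_function and h = "(*\<^sub>R)"]) auto

lemma pw_polynomial_mult:
  fixes u w :: "real^'d \<Rightarrow> real"
  shows "\<lbrakk>pw_polynomial u; pw_polynomial w\<rbrakk> \<Longrightarrow> pw_polynomial (\<lambda>x. u x * w x)"
  by (rule elementwise_map2[where P = polynomial_function and R = polynomial_function and h = "(*)"]) (auto simp: real_polynomial_function_eq[symmetric])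

lemma pw_polynomial_inner:
  fixes u w :: "real^'d \<Rightarrow> 'b::euclidean_space"
  shows "\<lbrakk>pw_polynomial u; pw_polynomial w\<rbrakk> \<Longrightarrow> pw_polynomial (\<lambda>x. u x \<bullet> w x)"
  by (rule elementwise_map2[where P = polynomial_function and R = polynomial_function and h = "(\<bullet>)"])
     (auto intro: polynomial_function_inner_product)

lemma pw_polynomial_norm_square:
  fixes u :: "real^'d \<Rightarrow> 'b::euclidean_space"
  shows "pw_polynomial u \<Longrightarrow> pw_polynomial (\<lambda>x. (norm (u x))\<^sup>2)"
  unfolding power2_norm_eq_inner by (rule pw_polynomial_inner)

lemma pw_polynomial_component:
  fixes u :: "real^'d \<Rightarrow> real^'n"
  assumes "pw_polynomial u"
  shows "pw_polynomial (\<lambda>x. u x $ i)"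
  using pw_polynomial_inner[OF assms pw_polynomial_const[of "axis i 1"]]
  by (simp add: inner_axis)

lemma pw_polynomial_sum:
  fixes u :: "'i \<Rightarrow> real^'d \<Rightarrow> real"
  assumes "finite I" "\<And>i. i \<in> I \<Longrightarrow> pw_polynomial (u i)"
  shows "pw_polynomial (\<lambda>x. \<Sum>i\<in>I. u i x)"
  using assms by induction (auto intro: pw_polynomial_const pw_polynomial_add)

lemma pw_polynomial_div_op:
  assumes "pw_polynomial v"
  shows "pw_polynomial (div_op v)"
  unfolding div_op_def[abs_def]
  by (intro pw_polynomial_sum pw_polynomial_partial pw_polynomial_component assms) auto

lemma trace_on_polynomial:
  fixes u :: "real^'d \<Rightarrow> 'b::euclidean_space"
  assumes K: "K \<in> \<T>" and F: "F facet_of closure K" and f: "polynomial_function f" "\<forall>x\<in>K. u x = f x"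
  shows "L2_fun (facet_measure F) (trace_on K F u)" "AE x in facet_measure F. trace_on K F u x = f x"
proof -
  obtain C where C: "nondegenerate_simplex C" "K = interior (convex hull C)" "closure K = convex hull C"
    using element_simplex[OF K] .
  interpret S: nondegenerate_simplex C by (rule C(1))
  have FS: "F facet_of convex hull C" using F C(3) by simp
  have u: "x \<in> interior (convex hull C) \<Longrightarrow> u x = f x" for x using f(2) C(2) by simp
  show "L2_fun (facet_measure F) (trace_on K F u)"
    unfolding C(2) by (rule S.trace_on_smooth(1)[OF FS polynomial_function_smooth[OF f(1)]]) (rule u)
  show "AE x in facet_measure F. trace_on K F u x = f x"
    unfolding C(2) by (rule S.trace_on_smooth(2)[OF FS polynomial_function_smooth[OF f(1)]]) (rule u)
qed

lemma facet_properties: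
  assumes K: "K \<in> \<T>" and F: "F facet_of closure K"
  shows "compact F" "F \<noteq> {}" "unit_normal F (outward_normal K F)"
proof -
  obtain C where C: "nondegenerate_simplex C" "K = interior (convex hull C)" "closure K = convex hull C"
    using element_simplex[OF K] .
  interpret S: nondegenerate_simplex C by (rule C(1))
  have FS: "F facet_of convex hull C" using F C(3) by simp
  show "compact F" "F \<noteq> {}" "unit_normal F (outward_normal K F)"
    unfolding C(2) using S.facet_has_normal[OF FS] by auto
qed

lemma L2_fun_facet_integrable:
  fixes f :: "real^'d \<Rightarrow> 'b::euclidean_space"
  assumes "K \<in> \<T>" "F facet_of closure K" "L2_fun (facet_measure F) f"
  shows "integrable (facet_measure F) f"
proof -
  interpret finite_measure "facet_measure F"
    using facet_properties[OF assms(1,2)] by (rule finite_measure_facet_measure)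
  have "integrable (facet_measure F) (\<lambda>x. 1 + (norm (f x))\<^sup>2)"
    using assms(3) by (auto simp: L2_fun_def)
  then show ?thesis
  proof (rule Bochner_Integration.integrable_bound)
    have "norm (f x) \<le> 1 + (norm (f x))\<^sup>2" for x
      using sum_power2_ge_zero[of "norm (f x) - 1" 0] self_le_power[of "norm (f x)" 2]
      by (cases "norm (f x) \<ge> 1") (auto simp: add_increasing2)
    then show "AE x in facet_measure F. norm (f x) \<le> norm (1 + (norm (f x))\<^sup>2)" by simp
  qed (use assms(3) in \<open>simp add: L2_fun_def\<close>)
qed

lemma gauss_element:
  assumes K: "K \<in> \<T>" and v: "pw_polynomial v"
  shows "(LINT x|lebesgue_on K. div_op v x)
    = (\<Sum>F | F facet_of closure K. \<integral>x. trace_on K F v x \<bullet> outward_normal K F \<partial>facet_measure F)"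
proof -
  obtain C where C: "nondegenerate_simplex C" "K = interior (convex hull C)" "closure K = convex hull C"
    using element_simplex[OF K] .
  interpret S: nondegenerate_simplex C by (rule C(1))
  obtain f where f: "polynomial_function f" "\<forall>x\<in>K. v x = f x" using v K unfolding elementwise_def by blast
  have comp: "C1_deriv (\<lambda>x. f x $ i) (\<lambda>x w. frechet_derivative f (at x) w $ i)" for i
    using C1_deriv_inner_left[OF smooth_imp_C1_deriv[OF polynomial_function_smooth[OF f(1)]], of "axis i 1"]
    by (simp add: inner_axis)
  let ?n = "outward_normal K"
  have div: "div_op v x = (\<Sum>i\<in>UNIV. frechet_derivative f (at x) (axis i 1) $ i)" if "x \<in> K" for x
    unfolding div_op_def
  proof (intro sum.cong refl partial_eqI)
    fix i
    have "((\<lambda>x. f x $ i) has_derivative (\<lambda>w. frechet_derivative f (at x) w $ i)) (at x)"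
      using comp[of i] by (simp add: C1_deriv_def)
    then show "((\<lambda>y. v y $ i) has_derivative (\<lambda>w. frechet_derivative f (at x) w $ i)) (at x)"
      by (rule has_derivative_transform_within_open[OF _ element_properties(1)[OF K] that]) (use f in auto)
  qed
  have fin: "finite {F. F facet_of closure K}" by (rule element_properties(6)[OF K])
  have ci: "continuous_on UNIV (\<lambda>x. f x $ i)" for i by (rule C1_deriv_continuous[OF comp])
  have int: "integrable (lebesgue_on K) (\<lambda>x. frechet_derivative f (at x) (axis i 1) $ i)" for i
    using S.integrable_K[of "\<lambda>x. frechet_derivative f (at x) (axis i 1) $ i"] comp[of i] by (simp add: C1_deriv_def C(2))
  have "(LINT x|lebesgue_on K. div_op v x) = (LINT x|lebesgue_on K. (\<Sum>i\<in>UNIV. frechet_derivative f (at x) (axis i 1) $ i))"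
    by (intro Bochner_Integration.integral_cong) (auto simp: div space_restrict_space)
  also have "\<dots> = (\<Sum>i\<in>UNIV. LINT x|lebesgue_on K. frechet_derivative f (at x) (axis i 1) $ i)"
    by (rule Bochner_Integration.integral_sum) (rule int)
  also have "\<dots> = (\<Sum>i\<in>UNIV. \<Sum>F | F facet_of closure K. (?n F \<bullet> axis i 1) * (\<integral>x. f x $ i \<partial>facet_measure F))"
    unfolding C(3) using S.gauss_simplex[OF comp] by (simp add: C(2))
  also have "\<dots> = (\<Sum>F | F facet_of closure K. \<Sum>i\<in>UNIV. (?n F \<bullet> axis i 1) * (\<integral>x. f x $ i \<partial>facet_measure F))"
    by (rule sum.swap)
  also have "\<dots> = (\<Sum>F | F facet_of closure K. \<integral>x. trace_on K F v x \<bullet> ?n F \<partial>facet_measure F)"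
  proof (rule sum.cong[OF refl])
    fix F assume "F \<in> {F. F facet_of closure K}"
    then have F: "F facet_of closure K" by simp
    have "(\<Sum>i\<in>UNIV. (?n F \<bullet> axis i 1) * (\<integral>x. f x $ i \<partial>facet_measure F)) = (\<integral>x. (\<Sum>i\<in>UNIV. (?n F \<bullet> axis i 1) * f x $ i) \<partial>facet_measure F)"
      using integrable_facet_measure_continuous[OF facet_properties[OF K F] ci] by simp
    also have "\<dots> = (\<integral>x. f x \<bullet> ?n F \<partial>facet_measure F)"
      by (simp add: inner_axis) (simp add: inner_vec_def mult.commute)
    also have "\<dots> = (\<integral>x. trace_on K F v x \<bullet> ?n F \<partial>facet_measure F)"
    proof (rule integral_cong_AE)
      show "AE x in facet_measure F. f x \<bullet> ?n F = trace_on K F v x \<bullet> ?n F"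
        by (rule eventually_mono[OF trace_on_polynomial(2)[OF K F f]]) simp
      have "f \<in> borel_measurable (facet_measure F)" "trace_on K F v \<in> borel_measurable (facet_measure F)"
        using L2_fun_facet_measure_continuous[OF facet_properties[OF K F] polynomial_function_continuous_on[OF f(1)]]
          trace_on_polynomial(1)[OF K F f] by (auto simp: L2_fun_def)
      then show "(\<lambda>x. f x \<bullet> ?n F) \<in> borel_measurable (facet_measure F)"
        "(\<lambda>x. trace_on K F v x \<bullet> ?n F) \<in> borel_measurable (facet_measure F)" by measurable
    qed
    finally show "(\<Sum>i\<in>UNIV. (?n F \<bullet> axis i 1) * (\<integral>x. f x $ i \<partial>facet_measure F)) = (\<integral>x. trace_on K F v x \<bullet> ?n F \<partial>facet_measure F)" .
  qed
  finally show ?thesis .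
qed

lemma finite_interfaces: "finite (interfaces \<Omega> \<T>)"
proof (rule finite_subset)
  show "interfaces \<Omega> \<T> \<subseteq> (\<Union>K\<in>\<T>. {F. F facet_of closure K})" by (auto simp: interfaces_def)
  show "finite (\<Union>K\<in>\<T>. {F. F facet_of closure K})" using finite_\<T> element_properties(6) by auto
qed

definition skeleton_integrable :: "((real^'d) set \<Rightarrow> real^'d \<Rightarrow> real) \<Rightarrow> bool" where
  "skeleton_integrable g \<longleftrightarrow> (\<forall>F\<in>interfaces \<Omega> \<T>. integrable (facet_measure F) (g F))"

lemma interface_integral_add:
  "\<lbrakk>skeleton_integrable g; skeleton_integrable h\<rbrakk> \<Longrightarrow>
    interface_integral \<Omega> \<T> (\<lambda>F x. g F x + h F x) = interface_integral \<Omega> \<T> g + interface_integral \<Omega> \<T> h"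
  by (simp add: interface_integral_def skeleton_integrable_def sum.distrib)

lemma interface_integral_cmult:
  "interface_integral \<Omega> \<T> (\<lambda>F x. c * g F x) = c * interface_integral \<Omega> \<T> g"
  by (simp add: interface_integral_def sum_distrib_left)

lemma skeleton_integrable_add:
  "\<lbrakk>skeleton_integrable g; skeleton_integrable h\<rbrakk> \<Longrightarrow> skeleton_integrable (\<lambda>F x. g F x + h F x)"
  by (simp add: skeleton_integrable_def)

lemma skeleton_integrable_cmult:
  "skeleton_integrable g \<Longrightarrow> skeleton_integrable (\<lambda>F x. c * g F x)"
  by (simp add: skeleton_integrable_def)

lemma interface_facet:
  assumes "F \<in> interfaces \<Omega> \<T>"
  obtains K where "K \<in> \<T>" "F facet_of closure K"
proof -
  have "\<exists>K\<in>\<T>. F facet_of closure K" using assms unfolding interfaces_def by blast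
  then show ?thesis using that by blast
qed

lemma skeleton_integrable_L2:
  "g \<in> L2_interfaces \<Omega> \<T> \<Longrightarrow> skeleton_integrable (\<lambda>_. g)"
  unfolding skeleton_integrable_def L2_interfaces_def using L2_fun_facet_integrable interface_facet by blast

lemma integrable_normal_trace:
  assumes K: "K \<in> \<T>" and F: "F facet_of closure K" and v: "pw_polynomial v"
  shows "integrable (facet_measure F) (\<lambda>x. trace_on K F v x \<bullet> outward_normal K F)"
proof -
  obtain f where "polynomial_function f" "\<forall>x\<in>K. v x = f x" using v K unfolding elementwise_def by blast
  from L2_fun_facet_integrable[OF K F trace_on_polynomial(1)[OF K F this]] show ?thesis by simp
qed

lemma skeleton_integrable_jump:
  assumes "pw_polynomial v"
  shows "skeleton_integrable (jump \<T> v)"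
  unfolding skeleton_integrable_def jump_def
  by (auto intro!: Bochner_Integration.integrable_sum integrable_normal_trace assms)

text \<open>Sum the divergence theorem over all elements and collect the terms facet by facet.  A facet that
meets the domain is an interior interface and contributes its jump; every other facet lies in the
boundary, where the normal trace is assumed to vanish.\<close>

theorem broken_gauss:
  assumes v: "pw_polynomial v"
    and boundary: "\<And>K F. \<lbrakk>K \<in> \<T>; F facet_of closure K; F \<subseteq> frontier \<Omega>\<rbrakk> \<Longrightarrow>
      AE x in facet_measure F. trace_on K F v x \<bullet> outward_normal K F = 0"
  shows "(LINT x|lebesgue_on \<Omega>. div_op v x) = interface_integral \<Omega> \<T> (jump \<T> v)"
proof -
  let ?I = "\<lambda>K F. \<integral>x. trace_on K F v x \<bullet> outward_normal K F \<partial>facet_measure F"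
  define A where "A = (\<Union>K\<in>\<T>. {F. F facet_of closure K})"
  have finA: "finite A" unfolding A_def using finite_\<T> element_properties(6) by auto
  have "(LINT x|lebesgue_on \<Omega>. div_op v x) = (\<Sum>K\<in>\<T>. LINT x|lebesgue_on K. div_op v x)"
    by (intro integral_by_elements pw_polynomial_continuous pw_polynomial_div_op v)
  also have "\<dots> = (\<Sum>K\<in>\<T>. \<Sum>F | F \<in> A \<and> F facet_of closure K. ?I K F)"
  proof (rule sum.cong[OF refl])
    fix K assume K: "K \<in> \<T>"
    have "{F. F \<in> A \<and> F facet_of closure K} = {F. F facet_of closure K}" using K by (auto simp: A_def)
    then show "(LINT x|lebesgue_on K. div_op v x) = (\<Sum>F | F \<in> A \<and> F facet_of closure K. ?I K F)"
      using gauss_element[OF K v] by simp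
  qed
  also have "\<dots> = (\<Sum>F\<in>A. \<Sum>K | K \<in> \<T> \<and> F facet_of closure K. ?I K F)"
    by (rule sum.swap_restrict[OF finite_\<T> finA])
  also have "\<dots> = (\<Sum>F\<in>interfaces \<Omega> \<T>. \<Sum>K | K \<in> \<T> \<and> F facet_of closure K. ?I K F)"
  proof (rule sum.mono_neutral_right[OF finA])
    show "interfaces \<Omega> \<T> \<subseteq> A" by (auto simp: A_def interfaces_def)
    show "\<forall>F\<in>A - interfaces \<Omega> \<T>. (\<Sum>K | K \<in> \<T> \<and> F facet_of closure K. ?I K F) = 0"
    proof
      fix F assume F: "F \<in> A - interfaces \<Omega> \<T>"
      show "(\<Sum>K | K \<in> \<T> \<and> F facet_of closure K. ?I K F) = 0"
      proof (rule sum.neutral, rule ballI)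
        fix K assume "K \<in> {K. K \<in> \<T> \<and> F facet_of closure K}"
        then have K: "K \<in> \<T>" "F facet_of closure K" by auto
        have "F \<inter> \<Omega> = {}" using facet_in_interfaces[OF K] F by blast
        moreover have "F \<subseteq> closure \<Omega>"
          using facet_of_imp_subset[OF K(2)] cover K(1) by blast
        ultimately have "F \<subseteq> frontier \<Omega>"
          using interior_subset[of \<Omega>] by (auto simp: frontier_def)
        then show "?I K F = 0" by (intro integral_eq_zero_AE boundary K)
      qed
    qed
  qed
  also have "\<dots> = interface_integral \<Omega> \<T> (jump \<T> v)"
    unfolding interface_integral_def jump_def
  proof (rule sum.cong[OF refl])
    fix F
    show "(\<Sum>K | K \<in> \<T> \<and> F facet_of closure K. ?I K F)
      = (\<integral>x. (\<Sum>K | K \<in> \<T> \<and> F facet_of closure K. trace_on K F v x \<bullet> outward_normal K F) \<partial>facet_measure F)"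
      by (subst Bochner_Integration.integral_sum) (auto intro: integrable_normal_trace v)
  qed
  finally show ?thesis .
qed

end

section \<open>The discrete spaces\<close>

context triangulated_domain
begin

lemma V_space_pw_polynomial: "u \<in> V_space p \<T> \<Longrightarrow> pw_polynomial u"
  unfolding V_space_def elementwise_def using polynomial_deg_imp_polynomial_function by blast

lemma V0_spaceD: "w \<in> V0_space p \<Omega> \<T> \<Longrightarrow> w \<in> V_space p \<T> \<and> w \<in> broken_H10 \<Omega> \<T>"
  by (simp add: V0_space_def)

lemma Vn_spaceD: "w \<in> Vn_space p \<Omega> \<T> \<Longrightarrow> w \<in> V_space p \<T> \<and> w \<in> broken_H1n \<Omega> \<T>"
  by (simp add: Vn_space_def)

lemma V_space_linear_combination:
  assumes "u \<in> V_space p \<T>" "w \<in> V_space p \<T>"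
  shows "(\<lambda>x. a *\<^sub>R u x + b *\<^sub>R w x) \<in> V_space p \<T>"
  unfolding V_space_def
proof (intro CollectI ballI)
  fix K assume K: "K \<in> \<T>"
  obtain f where f: "polynomial_deg p f" "\<forall>x\<in>K. u x = f x" using assms(1) K unfolding V_space_def by blast
  obtain g where g: "polynomial_deg p g" "\<forall>x\<in>K. w x = g x" using assms(2) K unfolding V_space_def by blast
  show "\<exists>h. polynomial_deg p h \<and> (\<forall>x\<in>K. a *\<^sub>R u x + b *\<^sub>R w x = h x)"
    using polynomial_deg_linear_combination[OF f(1) g(1), of a b] f(2) g(2) by (intro exI conjI) auto
qed

lemma V_space_const: "(\<lambda>_. c) \<in> V_space p \<T>"
  unfolding V_space_def using polynomial_deg_const by blast

lemma pw_polynomial_broken_H1: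
  fixes u :: "real^'d \<Rightarrow> 'b::euclidean_space"
  assumes "pw_polynomial u"
  shows "u \<in> broken_H1 \<T>"
  unfolding broken_H1_def
proof (intro CollectI ballI)
  fix K assume K: "K \<in> \<T>"
  obtain f where f: "polynomial_function f" "\<forall>x\<in>K. u x = f x" using assms K unfolding elementwise_def by blast
  obtain C where C: "nondegenerate_simplex C" "K = interior (convex hull C)" "closure K = convex hull C"
    using element_simplex[OF K] .
  interpret S: nondegenerate_simplex C by (rule C(1))
  show "u \<in> H1 K"
    unfolding C(2) by (rule S.H1_classical[OF smooth_imp_C1_deriv[OF polynomial_function_smooth[OF f(1)]]]) (use f C(2) in auto)
qed

lemma trace_on_map2:
  fixes u :: "real^'d \<Rightarrow> 'b::euclidean_space" and w :: "real^'d \<Rightarrow> 'c::euclidean_space"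
    and h :: "'b \<Rightarrow> 'c \<Rightarrow> 'e::euclidean_space"
  assumes K: "K \<in> \<T>" and F: "F facet_of closure K" and u: "pw_polynomial u" and w: "pw_polynomial w"
    and h: "\<And>f g :: real^'d \<Rightarrow> _. polynomial_function f \<Longrightarrow> polynomial_function g \<Longrightarrow> polynomial_function (\<lambda>x. h (f x) (g x))"
  shows "AE x in facet_measure F. trace_on K F (\<lambda>x. h (u x) (w x)) x = h (trace_on K F u x) (trace_on K F w x)"
proof -
  obtain f where f: "polynomial_function f" "\<forall>x\<in>K. u x = f x" using u K unfolding elementwise_def by blast
  obtain g where g: "polynomial_function g" "\<forall>x\<in>K. w x = g x" using w K unfolding elementwise_def by blast
  have fg: "\<forall>x\<in>K. h (u x) (w x) = h (f x) (g x)" using f g by simp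
  from trace_on_polynomial(2)[OF K F h[OF f(1) g(1)] fg] trace_on_polynomial(2)[OF K F f] trace_on_polynomial(2)[OF K F g]
  show ?thesis by (rule AE_mp[OF _ AE_mp[OF _ AE_mp[OF _ AE_I2]]]) simp
qed

lemma trace_on_linear_combination:
  fixes u w :: "real^'d \<Rightarrow> 'b::euclidean_space"
  assumes "K \<in> \<T>" "F facet_of closure K" "pw_polynomial u" "pw_polynomial w"
  shows "AE x in facet_measure F. trace_on K F (\<lambda>x. a *\<^sub>R u x + b *\<^sub>R w x) x
    = a *\<^sub>R trace_on K F u x + b *\<^sub>R trace_on K F w x"
  by (rule trace_on_map2[OF assms, where h = "\<lambda>s t. a *\<^sub>R s + b *\<^sub>R t"]) auto

lemma trace_on_scaleR:
  fixes w :: "real^'d \<Rightarrow> 'b::euclidean_space"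
  assumes "K \<in> \<T>" "F facet_of closure K" "pw_polynomial r" "pw_polynomial w"
  shows "AE x in facet_measure F. trace_on K F (\<lambda>x. r x *\<^sub>R w x) x = trace_on K F r x *\<^sub>R trace_on K F w x"
  by (rule trace_on_map2[OF assms, where h = "\<lambda>s t. s *\<^sub>R t"]) auto

lemma V0_space_linear_combination:
  fixes u w :: "real^'d \<Rightarrow> 'b::euclidean_space"
  assumes "u \<in> V0_space p \<Omega> \<T>" "w \<in> V0_space p \<Omega> \<T>"
  shows "(\<lambda>x. a *\<^sub>R u x + b *\<^sub>R w x) \<in> V0_space p \<Omega> \<T>"
proof -
  have V: "u \<in> V_space p \<T>" "w \<in> V_space p \<T>" using assms V0_spaceD by blast+
  have comb: "(\<lambda>x. a *\<^sub>R u x + b *\<^sub>R w x) \<in> V_space p \<T>" using V by (rule V_space_linear_combination)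
  have "AE x in facet_measure F. x \<in> frontier \<Omega> \<longrightarrow> trace_on K F (\<lambda>x. a *\<^sub>R u x + b *\<^sub>R w x) x = 0"
    if KF: "K \<in> \<T>" "F facet_of closure K" for K F
  proof -
    have "AE x in facet_measure F. x \<in> frontier \<Omega> \<longrightarrow> trace_on K F u x = 0"
      "AE x in facet_measure F. x \<in> frontier \<Omega> \<longrightarrow> trace_on K F w x = 0"
      using assms KF unfolding V0_space_def broken_H10_def by blast+
    with trace_on_linear_combination[OF KF V_space_pw_polynomial[OF V(1)] V_space_pw_polynomial[OF V(2)], of a b]
    show ?thesis by (rule AE_mp[OF _ AE_mp[OF _ AE_mp[OF _ AE_I2]]]) simp
  qed
  then show ?thesis
    using comb pw_polynomial_broken_H1[OF V_space_pw_polynomial[OF comb]]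
    unfolding V0_space_def broken_H10_def by blast
qed

lemma Vn_space_linear_combination:
  assumes "u \<in> Vn_space p \<Omega> \<T>" "w \<in> Vn_space p \<Omega> \<T>"
  shows "(\<lambda>x. a *\<^sub>R u x + b *\<^sub>R w x) \<in> Vn_space p \<Omega> \<T>"
proof -
  have V: "u \<in> V_space p \<T>" "w \<in> V_space p \<T>" using assms Vn_spaceD by blast+
  have comb: "(\<lambda>x. a *\<^sub>R u x + b *\<^sub>R w x) \<in> V_space p \<T>" using V by (rule V_space_linear_combination)
  have "AE x in facet_measure F. x \<in> frontier \<Omega> \<longrightarrow> trace_on K F (\<lambda>x. a *\<^sub>R u x + b *\<^sub>R w x) x \<bullet> outward_normal K F = 0"
    if KF: "K \<in> \<T>" "F facet_of closure K" for K F
  proof -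
    have "AE x in facet_measure F. x \<in> frontier \<Omega> \<longrightarrow> trace_on K F u x \<bullet> outward_normal K F = 0"
      "AE x in facet_measure F. x \<in> frontier \<Omega> \<longrightarrow> trace_on K F w x \<bullet> outward_normal K F = 0"
      using assms KF unfolding Vn_space_def broken_H1n_def by blast+
    with trace_on_linear_combination[OF KF V_space_pw_polynomial[OF V(1)] V_space_pw_polynomial[OF V(2)], of a b]
    show ?thesis by (rule AE_mp[OF _ AE_mp[OF _ AE_mp[OF _ AE_I2]]]) (simp add: inner_add_left)
  qed
  then show ?thesis
    using comb pw_polynomial_broken_H1[OF V_space_pw_polynomial[OF comb]]
    unfolding Vn_space_def broken_H1n_def by blast
qed

lemma gauss_Vn:
  assumes r: "pw_polynomial r" and w: "w \<in> Vn_space p \<Omega> \<T>"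
  shows "(LINT x|lebesgue_on \<Omega>. div_op (\<lambda>x. r x *\<^sub>R w x) x) = interface_integral \<Omega> \<T> (jump \<T> (\<lambda>x. r x *\<^sub>R w x))"
proof (rule broken_gauss)
  have wp: "pw_polynomial w" using w Vn_spaceD V_space_pw_polynomial by blast
  then show "pw_polynomial (\<lambda>x. r x *\<^sub>R w x)" using r by (intro pw_polynomial_scaleR)
  fix K F assume KF: "K \<in> \<T>" "F facet_of closure K" and sub: "F \<subseteq> frontier \<Omega>"
  have "AE x in facet_measure F. x \<in> frontier \<Omega> \<longrightarrow> trace_on K F w x \<bullet> outward_normal K F = 0"
    using w KF unfolding Vn_space_def broken_H1n_def by blast
  with AE_in_facet[OF facet_properties[OF KF]] trace_on_scaleR[OF KF r wp]
  show "AE x in facet_measure F. trace_on K F (\<lambda>x. r x *\<^sub>R w x) x \<bullet> outward_normal K F = 0"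
    by (rule AE_mp[OF _ AE_mp[OF _ AE_mp[OF _ AE_I2]]]) (use sub in auto)
qed

lemma V0_space_imp_Vn_space: "w \<in> V0_space p \<Omega> \<T> \<Longrightarrow> w \<in> Vn_space p \<Omega> \<T>"
  unfolding V0_space_def Vn_space_def broken_H10_def broken_H1n_def by (fastforce elim: eventually_mono)

end

section \<open>Product rules for the elementwise operators\<close>

lemma partial_mult:
  fixes f g :: "real^'d::finite \<Rightarrow> real"
  assumes "f differentiable (at x)" "g differentiable (at x)"
  shows "partial i (\<lambda>y. f y * g y) x = f x * partial i g x + partial i f x * g x"
proof -
  have "((\<lambda>y. f y * g y) has_derivative
      (\<lambda>w. f x * frechet_derivative g (at x) w + frechet_derivative f (at x) w * g x)) (at x)"
    using assms by (intro has_derivative_mult) (simp_all add: frechet_derivative_works)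
  from partial_eqI[OF this] show ?thesis by (simp add: partial_def)
qed

lemma partial_diff:
  fixes f g :: "real^'d::finite \<Rightarrow> real"
  assumes "f differentiable (at x)" "g differentiable (at x)"
  shows "partial i (\<lambda>y. f y - g y) x = partial i f x - partial i g x"
proof -
  have "((\<lambda>y. f y - g y) has_derivative
      (\<lambda>w. frechet_derivative f (at x) w - frechet_derivative g (at x) w)) (at x)"
    using assms by (intro has_derivative_diff) (simp_all add: frechet_derivative_works)
  from partial_eqI[OF this] show ?thesis by (simp add: partial_def)
qed

lemma partial_sum:
  fixes f :: "'i \<Rightarrow> real^'d::finite \<Rightarrow> real"
  assumes "\<And>j. j \<in> J \<Longrightarrow> f j differentiable (at x)"
  shows "partial i (\<lambda>y. \<Sum>j\<in>J. f j y) x = (\<Sum>j\<in>J. partial i (f j) x)"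
proof -
  have "((\<lambda>y. \<Sum>j\<in>J. f j y) has_derivative (\<lambda>w. \<Sum>j\<in>J. frechet_derivative (f j) (at x) w)) (at x)"
    using assms by (intro has_derivative_sum) (simp_all add: frechet_derivative_works)
  from partial_eqI[OF this] show ?thesis by (simp add: partial_def)
qed

lemma differentiable_component:
  fixes v :: "real^'d::finite \<Rightarrow> real^'n"
  assumes "v differentiable (at x)"
  shows "(\<lambda>y. v y $ i) differentiable (at x)"
  using assms unfolding differentiable_def
  by (blast intro: bounded_linear.has_derivative[OF bounded_linear_vec_nth])

lemma div_op_scaleR:
  assumes "s differentiable (at x)" "v differentiable (at x)"
  shows "div_op (\<lambda>y. s y *\<^sub>R v y) x = grad s x \<bullet> v x + s x * div_op v x"
proof -
  have "div_op (\<lambda>y. s y *\<^sub>R v y) x = (\<Sum>i\<in>UNIV. s x * partial i (\<lambda>y. v y $ i) x + partial i s x * v x $ i)"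
    unfolding div_op_def vector_scaleR_component real_scaleR_def
    by (intro sum.cong refl partial_mult assms differentiable_component)
  also have "\<dots> = grad s x \<bullet> v x + s x * div_op v x"
    by (simp add: sum.distrib sum_distrib_left div_op_def grad_def inner_vec_def add.commute)
  finally show ?thesis .
qed

lemma grad_norm_square:
  assumes "v differentiable (at x)"
  shows "grad (\<lambda>y. (norm (v y))\<^sup>2) x \<bullet> m = 2 * (\<Sum>i\<in>UNIV. v x $ i * (grad (\<lambda>y. v y $ i) x \<bullet> m))"
proof -
  have sq: "partial j (\<lambda>y. v y $ i * v y $ i) x = 2 * (v x $ i * partial j (\<lambda>y. v y $ i) x)" for i j
    by (simp add: partial_mult differentiable_component[OF assms])
  have "partial j (\<lambda>y. (norm (v y))\<^sup>2) x = (\<Sum>i\<in>UNIV. 2 * (v x $ i * partial j (\<lambda>y. v y $ i) x))" for j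
    unfolding power2_norm_eq_inner inner_vec_def inner_real_def 
    by (subst partial_sum) (simp_all only: sq differentiable_mult differentiable_component[OF assms])
  then have "grad (\<lambda>y. (norm (v y))\<^sup>2) x \<bullet> m
      = (\<Sum>j\<in>UNIV. \<Sum>i\<in>UNIV. 2 * (v x $ i * partial j (\<lambda>y. v y $ i) x) * m $ j)"
    by (simp add: grad_def inner_vec_def sum_distrib_right)
  also have "\<dots> = (\<Sum>i\<in>UNIV. \<Sum>j\<in>UNIV. 2 * (v x $ i * partial j (\<lambda>y. v y $ i) x) * m $ j)"
    by (rule sum.swap)
  also have "\<dots> = 2 * (\<Sum>i\<in>UNIV. v x $ i * (grad (\<lambda>y. v y $ i) x \<bullet> m))"
    by (simp add: grad_def inner_vec_def sum_distrib_left mult.assoc)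
  finally show ?thesis .
qed

text \<open>Because \<open>r v \<otimes> v\<close> is symmetric, its row-wise divergence is \<open>(r v \<bullet> grad) v + div (r v) v\<close>.  What is
left after subtracting \<open>div (r v) v\<close> gives half of \<open>r v \<bullet> grad |v|\<^sup>2\<close> when it is multiplied by \<open>v\<close>.\<close>

lemma convective_terms_cancel:
  assumes "r differentiable (at x)" "v differentiable (at x)"
  shows "(div_tensor (\<lambda>y. outer (r y *\<^sub>R v y) (v y)) x - div_op (\<lambda>y. r y *\<^sub>R v y) x *\<^sub>R v x
      - (1/2 * r x) *\<^sub>R grad (\<lambda>y. (norm (v y))\<^sup>2) x) \<bullet> v x = 0"
proof -
  let ?m = "\<lambda>y. r y *\<^sub>R v y"
  have m: "?m differentiable (at x)" using assms by (intro differentiable_scaleR)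
  have "outer (?m y) (v y) $ i = (v y $ i) *\<^sub>R ?m y" for y i
    by (simp add: outer_def vec_eq_iff)
  then have "div_tensor (\<lambda>y. outer (?m y) (v y)) x $ i = grad (\<lambda>y. v y $ i) x \<bullet> ?m x + v x $ i * div_op ?m x" for i
    using div_op_scaleR[OF differentiable_component[OF assms(2)] m] by (simp add: div_tensor_def)
  then have "(div_tensor (\<lambda>y. outer (?m y) (v y)) x - div_op ?m x *\<^sub>R v x) \<bullet> v x
      = (\<Sum>i\<in>UNIV. v x $ i * (grad (\<lambda>y. v y $ i) x \<bullet> ?m x))"
    by (simp add: inner_vec_def[of "_ - _"] mult.commute)
  also have "\<dots> = r x * (grad (\<lambda>y. (norm (v y))\<^sup>2) x \<bullet> v x) / 2"
    unfolding grad_norm_square[OF assms(2)] by (simp add: sum_distrib_left mult_ac)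
  finally show ?thesis by (simp add: inner_diff_left)
qed

section \<open>The energy balance of one time step\<close>

context triangulated_domain
begin

text \<open>The scheme after testing, with the integrated fluxes as plain numbers \<open>I1\<close>, \<open>I2\<close>, \<open>I3\<close>, \<open>I40\<close>, \<open>I41\<close>
and the viscous term as \<open>b\<close>.  Integrating by parts twice, in the continuity equation against \<open>s\<close> and
in the gradient equation against \<open>Y\<close>, turns everything into linear relations between nine
integrals, from which the energy increment is obtained by elimination.\<close>

lemma energy_balance:
  fixes r0 r1 s :: "(real^'d) \<Rightarrow> real" and w0 w1 y0 y1 :: "(real^'d) \<Rightarrow> real^'d"
  assumes W: "continuous_on UNIV W" and k: "k > 0"
    and r: "r0 \<in> V_space p \<T>" "r1 \<in> V_space p \<T>" and s: "s \<in> V_space p \<T>"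
    and w: "w0 \<in> V0_space p \<Omega> \<T>" "w1 \<in> V0_space p \<Omega> \<T>"
    and y: "y0 \<in> Vn_space p \<Omega> \<T>" "y1 \<in> Vn_space p \<Omega> \<T>"
    and R_def: "R = (\<lambda>x. (1/2) *\<^sub>R (r0 x + r1 x))"
    and V_def: "V = (\<lambda>x. (1/2) *\<^sub>R (w0 x + w1 x))"
    and Y_def: "Y = (\<lambda>x. (1/2) *\<^sub>R (y0 x + y1 x))"
    and continuity: "0 = (LINT x|lebesgue_on \<Omega>. ((r1 x - r0 x) / k + div_op (\<lambda>y. R y *\<^sub>R V y) x) * s x) + I1"
    and momentum: "0 = (LINT x|lebesgue_on \<Omega>.
              ((R x / k) *\<^sub>R (w1 x - w0 x)
               + div_tensor (\<lambda>y. outer (R y *\<^sub>R V y) (V y)) x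
               - div_op (\<lambda>y. R y *\<^sub>R V y) x *\<^sub>R V x
               + R x *\<^sub>R grad s x
               - (1/2 * R x) *\<^sub>R grad (\<lambda>y. (norm (V y))\<^sup>2) x) \<bullet> V x) + I2 + b"
      (is "_ = (LINT x|_. ?mom x) + _ + _")
    and potential: "0 = (LINT x|lebesgue_on \<Omega>.
              (s x - diff_quot W (r0 x) (r1 x) + \<gamma> * div_op Y x
               - 1/4 * ((norm (w1 x))\<^sup>2 + (norm (w0 x))\<^sup>2)) * (r1 x - r0 x)) + I3"
      (is "_ = (LINT x|_. ?pot x) + _")
    and gradient0: "0 = (LINT x|lebesgue_on \<Omega>. (y0 x - grad r0 x) \<bullet> Y x) + I40"
    and gradient1: "0 = (LINT x|lebesgue_on \<Omega>. (y1 x - grad r1 x) \<bullet> Y x) + I41"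
    and flux12: "I1 + I2 + interface_integral \<Omega> \<T> (jump \<T> (\<lambda>z. (R z * s z) *\<^sub>R V z)) = 0"
    and flux34: "I3 - \<gamma> * (I41 - I40) + \<gamma> * interface_integral \<Omega> \<T> (jump \<T> (\<lambda>z. (r1 z - r0 z) *\<^sub>R Y z)) = 0"
  shows "energy \<Omega> W \<gamma> r1 w1 y1 - energy \<Omega> W \<gamma> r0 w0 y0 = - k * b"
proof -
  have rp: "pw_polynomial r0" "pw_polynomial r1" "pw_polynomial s"
    using r s V_space_pw_polynomial by blast+
  have wp: "pw_polynomial w0" "pw_polynomial w1"
    using w V0_spaceD V_space_pw_polynomial by blast+
  have yp: "pw_polynomial y0" "pw_polynomial y1"
    using y Vn_spaceD V_space_pw_polynomial by blast+
  have RP: "pw_polynomial R" unfolding R_def by (intro pw_polynomial_scaleR pw_polynomial_const pw_polynomial_add rp)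
  have VP: "pw_polynomial V" unfolding V_def by (intro pw_polynomial_scaleR pw_polynomial_const pw_polynomial_add wp)
  have YP: "pw_polynomial Y" unfolding Y_def by (intro pw_polynomial_scaleR pw_polynomial_const pw_polynomial_add yp)
  have V0: "V \<in> V0_space p \<Omega> \<T>"
    using V0_space_linear_combination[OF w, of "1/2" "1/2"] by (simp add: V_def scaleR_add_right)
  have Yn: "Y \<in> Vn_space p \<Omega> \<T>"
    using Vn_space_linear_combination[OF y, of "1/2" "1/2"] by (simp add: Y_def scaleR_add_right)
  define d where "d x = r1 x - r0 x" for x
  have dp: "pw_polynomial d" unfolding d_def by (intro pw_polynomial_diff rp)
  have gradp: "pw_polynomial (\<lambda>x. grad u x \<bullet> z x)" if "pw_polynomial u" "pw_polynomial z" for u z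
  proof -
    have "(\<lambda>x. grad u x \<bullet> z x) = (\<lambda>x. \<Sum>i\<in>UNIV. partial i u x * z x $ i)"
      by (simp add: grad_def inner_vec_def)
    moreover have "pw_polynomial (\<lambda>x. \<Sum>i\<in>UNIV. partial i u x * z x $ i)"
      by (intro pw_polynomial_sum pw_polynomial_mult pw_polynomial_partial pw_polynomial_component that finite)
    ultimately show ?thesis by simp
  qed
  note pw = rp wp yp RP VP YP dp pw_polynomial_mult pw_polynomial_inner pw_polynomial_diff pw_polynomial_add
    pw_polynomial_scaleR gradp pw_polynomial_div_op pw_polynomial_const pw_polynomial_norm_square
  define \<W> where "\<W> x = W (r1 x) - W (r0 x)" for x
  have Wr: "pw_continuous (\<lambda>x. W (r1 x))" "pw_continuous (\<lambda>x. W (r0 x))"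
    by (rule elementwise_map[OF pw_polynomial_continuous[OF rp(2)]], rule continuous_on_compose2[OF W], auto)
      (rule elementwise_map[OF pw_polynomial_continuous[OF rp(1)]], rule continuous_on_compose2[OF W], auto)
  have \<W>c: "pw_continuous \<W>"
    unfolding \<W>_def by (rule elementwise_map2[OF Wr, where h = "(-)"]) (intro continuous_intros)
  let ?I = "\<lambda>f. LINT x|lebesgue_on \<Omega>. f x"
  \<comment> \<open>The volume integrals that occur after testing: the first four in the continuity and momentum
    equations, the next three in the equation for the potential, the last two in the increment of
    the gradient equation.\<close>
  define A1 where "A1 = ?I (\<lambda>x. d x * s x)"
  define A2 where "A2 = ?I (\<lambda>x. R x * ((w1 x - w0 x) \<bullet> V x))"
  define A3 where "A3 = ?I (\<lambda>x. R x * (grad s x \<bullet> V x))"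
  define A4 where "A4 = ?I (\<lambda>x. div_op (\<lambda>y. R y *\<^sub>R V y) x * s x)"
  define A5 where "A5 = ?I \<W>"
  define A6 where "A6 = ?I (\<lambda>x. 1/4 * ((norm (w1 x))\<^sup>2 + (norm (w0 x))\<^sup>2) * d x)"
  define A7 where "A7 = ?I (\<lambda>x. d x * div_op Y x)"
  define A8 where "A8 = ?I (\<lambda>x. (y1 x - y0 x) \<bullet> Y x)"
  define A9 where "A9 = ?I (\<lambda>x. grad d x \<bullet> Y x)"
  have int: "integrable (lebesgue_on \<Omega>) u" if "pw_polynomial u" for u :: "(real^'d) \<Rightarrow> real"
    using integrable_pw_continuous[OF pw_polynomial_continuous[OF that]] .
  have "integrable (lebesgue_on \<Omega>) (\<lambda>x. d x * s x)"
    "integrable (lebesgue_on \<Omega>) (\<lambda>x. R x * ((w1 x - w0 x) \<bullet> V x))"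
    "integrable (lebesgue_on \<Omega>) (\<lambda>x. R x * (grad s x \<bullet> V x))"
    "integrable (lebesgue_on \<Omega>) (\<lambda>x. div_op (\<lambda>y. R y *\<^sub>R V y) x * s x)"
    "integrable (lebesgue_on \<Omega>) (\<lambda>x. 1/4 * ((norm (w1 x))\<^sup>2 + (norm (w0 x))\<^sup>2) * d x)"
    "integrable (lebesgue_on \<Omega>) (\<lambda>x. d x * div_op Y x)"
    "integrable (lebesgue_on \<Omega>) (\<lambda>x. (y1 x - y0 x) \<bullet> Y x)"
    "integrable (lebesgue_on \<Omega>) (\<lambda>x. grad d x \<bullet> Y x)"
    by (intro int pw)+
  note ints = this integrable_pw_continuous[OF \<W>c]
  have e1: "A1 / k + A4 + I1 = 0"
  proof -
    have "?I (\<lambda>x. ((r1 x - r0 x) / k + div_op (\<lambda>y. R y *\<^sub>R V y) x) * s x)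
        = ?I (\<lambda>x. d x * s x / k + div_op (\<lambda>y. R y *\<^sub>R V y) x * s x)"
      by (simp add: d_def distrib_right)
    also have "\<dots> = A1 / k + A4" using ints by (simp add: A1_def A4_def)
    finally show ?thesis using continuity by simp
  qed
  have e2: "A2 / k + A3 + I2 + b = 0"
  proof -
    have "?I ?mom
       = ?I (\<lambda>x. R x * ((w1 x - w0 x) \<bullet> V x) * (1 / k) + R x * (grad s x \<bullet> V x))"
    proof (rule integral_elementwise_cong)
      show "pw_continuous (\<lambda>x. R x * ((w1 x - w0 x) \<bullet> V x) * (1 / k) + R x * (grad s x \<bullet> V x))"
        by (intro pw_polynomial_continuous pw)
      fix K x assume K: "K \<in> \<T>" "x \<in> K"
      show "?mom x
        = R x * ((w1 x - w0 x) \<bullet> V x) * (1 / k) + R x * (grad s x \<bullet> V x)"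
        using convective_terms_cancel[OF pw_polynomial_differentiable[OF RP K] pw_polynomial_differentiable[OF VP K]]
        by (simp add: inner_diff_left inner_add_left diff_divide_distrib right_diff_distrib)
    qed
    also have "\<dots> = A2 / k + A3" using ints by (simp add: A2_def A3_def)
    finally show ?thesis using momentum by simp
  qed
  have e3: "A1 - A5 + \<gamma> * A7 - A6 + I3 = 0"
  proof -
    have alg: "(a - q + g * v - c) * e = e * a - q * e + g * (e * v) - c * e" for a q g v c e :: real
      by (simp add: algebra_simps)
    have dq: "diff_quot W (r0 x) (r1 x) * (r1 x - r0 x) = \<W> x" for x
      by (simp add: diff_quot_def \<W>_def)
    have "?I ?pot
       = ?I (\<lambda>x. d x * s x - \<W> x + \<gamma> * (d x * div_op Y x) - 1/4 * ((norm (w1 x))\<^sup>2 + (norm (w0 x))\<^sup>2) * d x)"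
      unfolding dq[symmetric] d_def by (intro Bochner_Integration.integral_cong refl) (rule alg)
    also have "\<dots> = A1 - A5 + \<gamma> * A7 - A6" using ints by (simp add: A1_def A5_def A7_def A6_def)
    finally show ?thesis using potential by simp
  qed
  have e4: "A8 - A9 + I41 - I40 = 0"
  proof -
    have i: "integrable (lebesgue_on \<Omega>) (\<lambda>x. (y1 x - grad r1 x) \<bullet> Y x)"
      "integrable (lebesgue_on \<Omega>) (\<lambda>x. (y0 x - grad r0 x) \<bullet> Y x)"
      unfolding inner_diff_left by (intro int pw)+
    have "?I (\<lambda>x. (y1 x - grad r1 x) \<bullet> Y x) - ?I (\<lambda>x. (y0 x - grad r0 x) \<bullet> Y x)
       = ?I (\<lambda>x. (y1 x - grad r1 x) \<bullet> Y x - (y0 x - grad r0 x) \<bullet> Y x)"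
      using i by simp
    also have "\<dots> = ?I (\<lambda>x. (y1 x - y0 x) \<bullet> Y x - grad d x \<bullet> Y x)"
    proof (rule integral_elementwise_cong)
      show "pw_continuous (\<lambda>x. (y1 x - y0 x) \<bullet> Y x - grad d x \<bullet> Y x)"
        by (intro pw_polynomial_continuous pw)
      fix K x assume K: "K \<in> \<T>" "x \<in> K"
      have "grad d x = grad r1 x - grad r0 x"
        using pw_polynomial_differentiable[OF rp(1) K] pw_polynomial_differentiable[OF rp(2) K]
        by (simp add: grad_def d_def[abs_def] partial_diff vec_eq_iff)
      then show "(y1 x - grad r1 x) \<bullet> Y x - (y0 x - grad r0 x) \<bullet> Y x = (y1 x - y0 x) \<bullet> Y x - grad d x \<bullet> Y x"
        by (simp add: inner_diff_left)
    qed
    also have "\<dots> = A8 - A9" using ints by (simp add: A8_def A9_def)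
    finally show ?thesis using gradient0 gradient1 by simp
  qed
  have j1: "A3 + A4 = interface_integral \<Omega> \<T> (jump \<T> (\<lambda>z. (R z * s z) *\<^sub>R V z))"
  proof -
    have "A3 + A4 = ?I (\<lambda>x. R x * (grad s x \<bullet> V x) + div_op (\<lambda>y. R y *\<^sub>R V y) x * s x)"
      using ints by (simp add: A3_def A4_def)
    also have "\<dots> = ?I (div_op (\<lambda>x. (R x * s x) *\<^sub>R V x))"
    proof (rule integral_elementwise_cong)
      show "pw_continuous (div_op (\<lambda>x. (R x * s x) *\<^sub>R V x))"
        by (intro pw_polynomial_continuous pw)
      fix K x assume K: "K \<in> \<T>" "x \<in> K"
      have "div_op (\<lambda>y. s y *\<^sub>R (R y *\<^sub>R V y)) x = grad s x \<bullet> (R x *\<^sub>R V x) + s x * div_op (\<lambda>y. R y *\<^sub>R V y) x"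
        by (rule div_op_scaleR[OF pw_polynomial_differentiable[OF _ K] pw_polynomial_differentiable[OF _ K]]) (intro pw)+
      then show "R x * (grad s x \<bullet> V x) + div_op (\<lambda>y. R y *\<^sub>R V y) x * s x = div_op (\<lambda>x. (R x * s x) *\<^sub>R V x) x"
        by (simp add: mult.commute)
    qed
    also have "\<dots> = interface_integral \<Omega> \<T> (jump \<T> (\<lambda>z. (R z * s z) *\<^sub>R V z))"
      by (rule gauss_Vn[OF _ V0_space_imp_Vn_space[OF V0]]) (intro pw)
    finally show ?thesis .
  qed
  have j2: "A9 + A7 = interface_integral \<Omega> \<T> (jump \<T> (\<lambda>z. (r1 z - r0 z) *\<^sub>R Y z))"
  proof -
    have "A9 + A7 = ?I (\<lambda>x. grad d x \<bullet> Y x + d x * div_op Y x)"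
      using ints by (simp add: A9_def A7_def)
    also have "\<dots> = ?I (div_op (\<lambda>x. d x *\<^sub>R Y x))"
    proof (rule integral_elementwise_cong)
      show "pw_continuous (div_op (\<lambda>x. d x *\<^sub>R Y x))"
        by (intro pw_polynomial_continuous pw)
      show "grad d x \<bullet> Y x + d x * div_op Y x = div_op (\<lambda>x. d x *\<^sub>R Y x) x" if K: "K \<in> \<T>" "x \<in> K" for K x
        using div_op_scaleR[OF pw_polynomial_differentiable[OF dp K] pw_polynomial_differentiable[OF YP K]] by simp
    qed
    also have "\<dots> = interface_integral \<Omega> \<T> (jump \<T> (\<lambda>z. d z *\<^sub>R Y z))"
      by (rule gauss_Vn[OF dp Yn])
    finally show ?thesis by (simp only: d_def)
  qed
  have E: "energy \<Omega> W \<gamma> r1 w1 y1 - energy \<Omega> W \<gamma> r0 w0 y0 = A5 + A2 + A6 + \<gamma> * A8"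
  proof -
    let ?e1 = "\<lambda>x. W (r1 x) + 1/2 * r1 x * (norm (w1 x))\<^sup>2 + \<gamma>/2 * (norm (y1 x))\<^sup>2" and ?e0 = "\<lambda>x. W (r0 x) + 1/2 * r0 x * (norm (w0 x))\<^sup>2 + \<gamma>/2 * (norm (y0 x))\<^sup>2"
    have i: "integrable (lebesgue_on \<Omega>) ?e1"
      "integrable (lebesgue_on \<Omega>) ?e0"
      by (intro Bochner_Integration.integrable_add integrable_pw_continuous[OF Wr(1)] integrable_pw_continuous[OF Wr(2)] int pw)+
    have "energy \<Omega> W \<gamma> r1 w1 y1 - energy \<Omega> W \<gamma> r0 w0 y0
      = ?I (\<lambda>x. ?e1 x
          - ?e0 x)"
      unfolding energy_def by (rule Bochner_Integration.integral_diff[OF i, symmetric])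
    also have "\<dots> = ?I (\<lambda>x. \<W> x + R x * ((w1 x - w0 x) \<bullet> V x)
        + 1/4 * ((norm (w1 x))\<^sup>2 + (norm (w0 x))\<^sup>2) * d x + \<gamma> * ((y1 x - y0 x) \<bullet> Y x))"
    proof (rule Bochner_Integration.integral_cong[OF refl])
      fix x
      have sq: "(a - c) \<bullet> ((1/2) *\<^sub>R (c + a)) = ((norm a)\<^sup>2 - (norm c)\<^sup>2) / 2" for a c :: "real^'d"
        by (simp add: power2_norm_eq_inner inner_simps inner_commute)
      have *: "(w1 x - w0 x) \<bullet> V x = ((norm (w1 x))\<^sup>2 - (norm (w0 x))\<^sup>2) / 2"
        "(y1 x - y0 x) \<bullet> Y x = ((norm (y1 x))\<^sup>2 - (norm (y0 x))\<^sup>2) / 2"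
        unfolding V_def Y_def by (rule sq)+
      show "?e1 x
          - ?e0 x
        = \<W> x + R x * ((w1 x - w0 x) \<bullet> V x)
        + 1/4 * ((norm (w1 x))\<^sup>2 + (norm (w0 x))\<^sup>2) * d x + \<gamma> * ((y1 x - y0 x) \<bullet> Y x)"
        unfolding * by (simp add: \<W>_def R_def d_def field_simps)
    qed
    also have "\<dots> = A5 + A2 + A6 + \<gamma> * A8"
      using ints by (simp add: A5_def A2_def A6_def A8_def)
    finally show ?thesis .
  qed
  have 1: "A1 / k + A2 / k = - b" using e1 e2 flux12 j1 by linarith
  have "A1 + A2 = k * (A1 / k + A2 / k)" using k by (simp add: distrib_left)
  then have "A1 + A2 = - k * b" using 1 by simp
  moreover have "A5 + A6 + \<gamma> * A8 = A1"
  proof -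
    have "\<gamma> * (A8 - A9 + I41 - I40) = 0" "\<gamma> * (A9 + A7) = \<gamma> * (I41 - I40) - I3" using e4 flux34 j2 by simp_all
    then have "\<gamma> * A8 = - \<gamma> * A7 - I3" by (simp add: algebra_simps)
    then show ?thesis using e3 by linarith
  qed
  ultimately show ?thesis using E by linarith
qed

end
section \<open>Time derivatives of integrated fluxes\<close>

lemma L2_fun_scaled:
  fixes f :: "'a \<Rightarrow> real"
  assumes "L2_fun M f"
  shows "L2_fun M (\<lambda>x. c * f x)"
  using assms by (auto simp: L2_fun_def power_mult_distrib)

text \<open>The Cauchy-Schwarz inequality against a constant, from the integral of \<open>(A f - m)\<^sup>2\<close>.  The summand
1 in the constant \<open>A\<close> keeps it positive for the null measure.\<close>

lemma (in finite_measure) square_integral_le: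
  fixes f :: "'a \<Rightarrow> real"
  assumes f: "integrable M f" and f2: "integrable M (\<lambda>x. (f x)\<^sup>2)"
  shows "(\<integral>x. f x \<partial>M)\<^sup>2 \<le> (measure M (space M) + 1) * (\<integral>x. (f x)\<^sup>2 \<partial>M)"
proof -
  define m where "m = (\<integral>x. f x \<partial>M)"
  define A where "A = measure M (space M) + 1"
  have A: "A > 0" by (simp add: A_def add_nonneg_pos)
  have "0 \<le> (\<integral>x. (A * f x - m)\<^sup>2 \<partial>M)" by simp
  also have "\<dots> = (\<integral>x. A\<^sup>2 * (f x)\<^sup>2 - (2 * A * m) * f x + m\<^sup>2 \<partial>M)"
    by (simp add: power2_eq_square algebra_simps)
  also have "\<dots> = A\<^sup>2 * (\<integral>x. (f x)\<^sup>2 \<partial>M) - (2 * A * m) * m + (A - 1) * m\<^sup>2"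
    using f f2 by (simp add: m_def A_def)
  also have "\<dots> = A * (A * (\<integral>x. (f x)\<^sup>2 \<partial>M) - m\<^sup>2) - m\<^sup>2"
    by (simp add: power2_eq_square algebra_simps)
  finally have "0 \<le> A * (A * (\<integral>x. (f x)\<^sup>2 \<partial>M) - m\<^sup>2)"
    using zero_le_power2[of m] by linarith
  then have "m\<^sup>2 \<le> A * (\<integral>x. (f x)\<^sup>2 \<partial>M)" using A by (simp add: zero_le_mult_iff)
  then show ?thesis by (simp add: m_def A_def)
qed

text \<open>The second and all higher derivatives of the path vanish, hence zero has to belong to \<open>X\<close>.\<close>

lemma smooth_path_affine:
  fixes u d :: "real^'d::finite \<Rightarrow> 'b::euclidean_space"
  assumes "\<And>\<eta>. (\<lambda>x. u x + (\<eta> - \<theta>) *\<^sub>R d x) \<in> X" "d \<in> X" "(\<lambda>_. 0) \<in> X"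
  shows "smooth_path T \<T> X (\<lambda>\<eta> x. u x + (\<eta> - \<theta>) *\<^sub>R d x)"
proof -
  let ?D = "\<lambda>j. if j = 0 then (\<lambda>\<eta> x. u x + (\<eta> - \<theta>) *\<^sub>R d x) else if j = Suc 0 then (\<lambda>_. d) else (\<lambda>_ _. 0)"
  have "((\<lambda>s. ?D j s x) has_vector_derivative ?D (Suc j) t x) (at t within {0..T})" for j t x
    by (auto intro!: derivative_eq_intros)
  then show ?thesis
    unfolding smooth_path_def using assms by (intro exI[of _ ?D]) auto
qed

lemma smooth_path_constant:
  fixes u :: "real^'d::finite \<Rightarrow> 'b::euclidean_space"
  assumes "u \<in> X" "(\<lambda>_. 0) \<in> X"
  shows "smooth_path T \<T> X (\<lambda>_. u)"
  using smooth_path_affine[of u 0 "\<lambda>_. 0" X T \<T>] assms by simp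

lemma dt_affine:
  fixes u d :: "real^'d::finite \<Rightarrow> 'b::euclidean_space"
  assumes "0 < T" "\<theta> \<in> {0..T}"
  shows "dt T (\<lambda>\<eta> x. u x + (\<eta> - \<theta>) *\<^sub>R d x) \<theta> = d"
proof
  fix x
  have "((\<lambda>s. u x + (s - \<theta>) *\<^sub>R d x) has_vector_derivative d x) (at \<theta> within cbox 0 T)"
    by (auto intro!: derivative_eq_intros)
  then show "dt T (\<lambda>\<eta> x. u x + (\<eta> - \<theta>) *\<^sub>R d x) \<theta> x = d x"
    unfolding dt_def using assms by (intro vector_derivative_within_cbox[of 0 T, simplified]) auto
qed

context triangulated_domain
begin

text \<open>On each facet, convergence of the difference quotients in \<open>L\<^sup>2\<close> implies convergence of their
integrals, because the surface measure is finite.  So the integral of the derivative is the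
derivative of the integrated curve, which is read off from the quadratic polynomial.\<close>

lemma interface_integral_L2_derivative:
  assumes T: "0 < T" "\<theta> \<in> {0..T}"
    and g: "\<And>s. g s \<in> L2_interfaces \<Omega> \<T>"
    and D: "has_L2_derivative \<Omega> \<T> T g D \<theta>"
    and quadratic: "\<And>s. interface_integral \<Omega> \<T> (\<lambda>_. g s) = a + b * (s - \<theta>) + c * (s - \<theta>)\<^sup>2"
  shows "interface_integral \<Omega> \<T> (\<lambda>_. D) = b"
proof -
  define e where "e s x = (g s x - g \<theta> x) / (s - \<theta>) - D x" for s x
  define E where "E s = interface_integral \<Omega> \<T> (\<lambda>_ x. (e s x)\<^sup>2)" for s
  have DL2: "D \<in> L2_interfaces \<Omega> \<T>" and E: "(E \<longlongrightarrow> 0) (at \<theta> within {0..T})"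
    using D by (auto simp: has_L2_derivative_def E_def[abs_def] e_def)
  have eL2: "e s \<in> L2_interfaces \<Omega> \<T>" for s
  proof -
    have "e s = (\<lambda>x. (1 / (s - \<theta>)) * (g s x - g \<theta> x) - D x)" by (simp add: e_def fun_eq_iff)
    moreover have "(\<lambda>x. (1 / (s - \<theta>)) * (g s x - g \<theta> x) - D x) \<in> L2_interfaces \<Omega> \<T>"
      unfolding L2_interfaces_def
    proof (intro CollectI ballI)
      fix F assume F: "F \<in> interfaces \<Omega> \<T>"
      have "L2_fun (facet_measure F) (g \<eta>)" "L2_fun (facet_measure F) D" for \<eta>
        using g DL2 F by (auto simp: L2_interfaces_def)
      then show "L2_fun (facet_measure F) (\<lambda>x. (1 / (s - \<theta>)) * (g s x - g \<theta> x) - D x)"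
        by (intro L2_fun_diff L2_fun_scaled)
    qed
    ultimately show ?thesis by (simp only:)
  qed
  have facet: "((\<lambda>s. \<integral>x. e s x \<partial>facet_measure F) \<longlongrightarrow> 0) (at \<theta> within {0..T})"
    if F: "F \<in> interfaces \<Omega> \<T>" for F
  proof -
    obtain K where K: "K \<in> \<T>" "F facet_of closure K" using F by (rule interface_facet)
    interpret finite_measure "facet_measure F"
      using facet_properties[OF K] by (rule finite_measure_facet_measure)
    define A where "A = measure (facet_measure F) (space (facet_measure F)) + 1"
    have A: "A > 0" by (simp add: A_def add_nonneg_pos)
    have bound: "\<bar>\<integral>x. e s x \<partial>facet_measure F\<bar> \<le> sqrt (A * E s)" for s
    proof (rule real_le_rsqrt)
      have L2: "L2_fun (facet_measure F) (e s)" using eL2 F by (simp add: L2_interfaces_def)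
      have "(\<integral>x. e s x \<partial>facet_measure F)\<^sup>2 \<le> A * (\<integral>x. (e s x)\<^sup>2 \<partial>facet_measure F)"
        unfolding A_def using L2_fun_facet_integrable[OF K L2] L2
        by (intro square_integral_le) (auto simp: L2_fun_def)
      also have "(\<integral>x. (e s x)\<^sup>2 \<partial>facet_measure F) \<le> E s"
        unfolding E_def interface_integral_def
        by (rule member_le_sum[OF F _ finite_interfaces]) simp
      finally show "\<bar>\<integral>x. e s x \<partial>facet_measure F\<bar>\<^sup>2 \<le> A * E s" using A by simp
    qed
    have "((\<lambda>s. sqrt (A * E s)) \<longlongrightarrow> sqrt (A * 0)) (at \<theta> within {0..T})"
      by (intro tendsto_intros E)
    then have lim: "((\<lambda>s. sqrt (A * E s)) \<longlongrightarrow> 0) (at \<theta> within {0..T})" by simp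
    show ?thesis
      by (rule Lim_null_comparison[OF always_eventually lim]) (simp only: real_norm_def bound simp_thms)
  qed
  have "((\<lambda>s. interface_integral \<Omega> \<T> (\<lambda>_. e s)) \<longlongrightarrow> (\<Sum>F\<in>interfaces \<Omega> \<T>. 0)) (at \<theta> within {0..T})"
    unfolding interface_integral_def by (intro tendsto_sum facet)
  moreover have "interface_integral \<Omega> \<T> (\<lambda>_. e s) = b + c * (s - \<theta>) - interface_integral \<Omega> \<T> (\<lambda>_. D)"
    if "s \<noteq> \<theta>" for s
  proof -
    have si: "skeleton_integrable (\<lambda>_. g s)" for s using g by (rule skeleton_integrable_L2)
    have sD: "skeleton_integrable (\<lambda>_. D)" using DL2 by (rule skeleton_integrable_L2)
    have "e s = (\<lambda>x. (1 / (s - \<theta>)) * (g s x + (-1) * g \<theta> x) + (-1) * D x)"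
      by (simp add: e_def fun_eq_iff)
    then have "interface_integral \<Omega> \<T> (\<lambda>_. e s)
      = (1 / (s - \<theta>)) * (interface_integral \<Omega> \<T> (\<lambda>_. g s) + (-1) * interface_integral \<Omega> \<T> (\<lambda>_. g \<theta>))
        + (-1) * interface_integral \<Omega> \<T> (\<lambda>_. D)"
      using si sD by (simp only: interface_integral_add interface_integral_cmult skeleton_integrable_add skeleton_integrable_cmult)
    also have "\<dots> = b + c * (s - \<theta>) - interface_integral \<Omega> \<T> (\<lambda>_. D)"
      unfolding quadratic using that by (simp add: power2_eq_square add_divide_distrib)
    finally show ?thesis .
  qed
  then have "\<forall>\<^sub>F s in at \<theta> within {0..T}. interface_integral \<Omega> \<T> (\<lambda>_. e s) = b + c * (s - \<theta>) - interface_integral \<Omega> \<T> (\<lambda>_. D)"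
    by (auto simp: eventually_at_filter)
  ultimately have "((\<lambda>s. b + c * (s - \<theta>) - interface_integral \<Omega> \<T> (\<lambda>_. D)) \<longlongrightarrow> 0) (at \<theta> within {0..T})"
    by (simp add: tendsto_cong)
  moreover have "((\<lambda>s. b + c * (s - \<theta>) - interface_integral \<Omega> \<T> (\<lambda>_. D)) \<longlongrightarrow> b + c * (\<theta> - \<theta>) - interface_integral \<Omega> \<T> (\<lambda>_. D)) (at \<theta> within {0..T})"
    by (intro tendsto_intros)
  moreover have "at \<theta> within {0..T} \<noteq> bot"
    using T by (simp add: trivial_limit_within islimpt_Icc)
  ultimately show ?thesis using tendsto_unique by fastforce
qed

lemma trace_flux_L2:
  assumes "trace_flux \<Omega> \<T> Y F" "r \<in> broken_H1 \<T>" "w \<in> broken_H10 \<Omega> \<T>" "s \<in> broken_H1 \<T>"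
    "y \<in> broken_H1n \<Omega> \<T>" "z \<in> Y"
  shows "F r w s y z \<in> L2_interfaces \<Omega> \<T>"
  using assms unfolding trace_flux_def by blast

lemma discrete_spaces_broken_H1:
  "r \<in> V_space p \<T> \<Longrightarrow> r \<in> broken_H1 \<T>" "w \<in> V0_space p \<Omega> \<T> \<Longrightarrow> w \<in> broken_H10 \<Omega> \<T>"
  "y \<in> Vn_space p \<Omega> \<T> \<Longrightarrow> y \<in> broken_H1n \<Omega> \<T>"
  using pw_polynomial_broken_H1[OF V_space_pw_polynomial] V0_spaceD Vn_spaceD by blast+

lemma zero_in_V_space: "(\<lambda>_. 0) \<in> V_space p \<T>"
  by (rule V_space_const)

lemma zero_in_V0_space:
  fixes w :: "(real^'d) \<Rightarrow> 'b::euclidean_space"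
  assumes "w \<in> V0_space p \<Omega> \<T>"
  shows "(\<lambda>_. 0 :: 'b) \<in> V0_space p \<Omega> \<T>"
  using V0_space_linear_combination[OF assms assms, of 0 0] by simp

lemma zero_in_Vn_space: "w \<in> Vn_space p \<Omega> \<T> \<Longrightarrow> (\<lambda>_. 0) \<in> Vn_space p \<Omega> \<T>"
  using Vn_space_linear_combination[of w p w 0 0] by simp

end

section \<open>Conservation of mass and dissipation of energy\<close>

theorem theorem5p1:
  fixes \<Omega> :: "(real^'d::finite) set"
    and \<T> :: "(real^'d) set set"
    and \<sigma> T \<gamma> \<mu> :: real
    and p N :: nat
    and F1 :: "('d, real) flux" and F2 :: "('d, real^'d) flux"
    and F3 :: "('d, real) flux" and F4 :: "('d, real^'d) flux"
    and W :: "real \<Rightarrow> real"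
    and B :: "'d vfield \<Rightarrow> 'd vfield \<Rightarrow> real"
    and t k :: "nat \<Rightarrow> real"
    and \<rho>0 \<tau>0 z0 :: "'d sfield" and v0 q0 :: "'d vfield"
    and \<rho> \<tau> :: "nat \<Rightarrow> 'd sfield" and v q :: "nat \<Rightarrow> 'd vfield"
  assumes dim: "CARD('d) \<in> {1, 2, 3}"
    and domain: "open \<Omega>" "connected \<Omega>" "bounded \<Omega>" "\<Omega> \<noteq> {}"
    and mesh: "conforming_triangulation \<sigma> \<Omega> \<T>"
    and time: "0 < T" "t 0 = 0" "t N = T" "\<And>n. n < N \<Longrightarrow> t n < t (Suc n)"
      "\<And>n. n < N \<Longrightarrow> k n = t (Suc n) - t n"
    and W: "double_well W"
    and mu: "0 \<le> \<mu>"
    and B: "bilinear_form \<T> (V0_space p \<Omega> \<T>) B"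
    and fluxes: "trace_flux \<Omega> \<T> (broken_H1 \<T>) F1" "trace_flux \<Omega> \<T> (broken_H10 \<Omega> \<T>) F2"
      "trace_flux \<Omega> \<T> (broken_H1 \<T>) F3" "trace_flux \<Omega> \<T> (broken_H1n \<Omega> \<T>) F4"
    and cond_a: "\<And>r w s y. \<lbrakk>r \<in> V_space p \<T>; w \<in> V0_space p \<Omega> \<T>; s \<in> V_space p \<T>; y \<in> Vn_space p \<Omega> \<T>\<rbrakk> \<Longrightarrow>
      interface_integral \<Omega> \<T> (\<lambda>_. F1 r w s y (\<lambda>_. 1))
        = - interface_integral \<Omega> \<T> (jump \<T> (\<lambda>x. r x *\<^sub>R w x))"
    and cond_b1: "\<And>r w s y \<theta>. \<lbrakk>smooth_path T \<T> (V_space p \<T>) r; smooth_path T \<T> (V0_space p \<Omega> \<T>) w;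
        smooth_path T \<T> (V_space p \<T>) s; smooth_path T \<T> (Vn_space p \<Omega> \<T>) y; \<theta> \<in> {0..T}\<rbrakk> \<Longrightarrow>
      interface_integral \<Omega> \<T> (\<lambda>F x.
        F1 (r \<theta>) (w \<theta>) (s \<theta>) (y \<theta>) (s \<theta>) x
        + F2 (r \<theta>) (w \<theta>) (s \<theta>) (y \<theta>) (w \<theta>) x
        + jump \<T> (\<lambda>z. (r \<theta> z * s \<theta> z) *\<^sub>R w \<theta> z) F x) = 0"
    and cond_b2: "\<And>r w s y \<theta>. \<lbrakk>smooth_path T \<T> (V_space p \<T>) r; smooth_path T \<T> (V0_space p \<Omega> \<T>) w;
        smooth_path T \<T> (V_space p \<T>) s; smooth_path T \<T> (Vn_space p \<Omega> \<T>) y; \<theta> \<in> {0..T}\<rbrakk> \<Longrightarrow>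
      \<exists>D. has_L2_derivative \<Omega> \<T> T (\<lambda>\<eta>. F4 (r \<eta>) (w \<eta>) (s \<eta>) (y \<eta>) (y \<theta>)) D \<theta> \<and>
        interface_integral \<Omega> \<T> (\<lambda>F x.
          F3 (r \<theta>) (w \<theta>) (s \<theta>) (y \<theta>) (dt T r \<theta>) x
          - \<gamma> * D x
          + \<gamma> * jump \<T> (\<lambda>z. dt T r \<theta> z *\<^sub>R y \<theta> z) F x) = 0"
    and data: "\<And>i. weak_partial \<Omega> i \<rho>0 (\<lambda>x. q0 x $ i)" "weak_div \<Omega> q0 z0"
      "AE x in lebesgue_on \<Omega>. \<tau>0 x = deriv W (\<rho>0 x) - \<gamma> * z0 x + 1/2 * (norm (v0 x))\<^sup>2"
    and init: "L2_projection \<Omega> (V_space p \<T>) \<rho>0 (\<rho> 0)"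
      "L2_projection \<Omega> (V0_space p \<Omega> \<T>) v0 (v 0)"
      "L2_projection \<Omega> (V_space p \<T>) \<tau>0 (\<tau> 0)"
      "L2_projection \<Omega> (Vn_space p \<Omega> \<T>) q0 (q 0)"
    and spaces: "\<And>n. n < N \<Longrightarrow> \<rho> (Suc n) \<in> V_space p \<T> \<and> v (Suc n) \<in> V0_space p \<Omega> \<T> \<and>
      \<tau> (Suc n) \<in> V_space p \<T> \<and> q (Suc n) \<in> Vn_space p \<Omega> \<T>"
    and scheme1: "\<And>n \<Psi>. \<lbrakk>n < N; \<Psi> \<in> V_space p \<T>\<rbrakk> \<Longrightarrow>
      0 = (LINT x|lebesgue_on \<Omega>. ((\<rho> (Suc n) x - \<rho> n x) / k n
              + div_op (\<lambda>y. half \<rho> n y *\<^sub>R half v n y) x) * \<Psi> x)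
        + interface_integral \<Omega> \<T> (\<lambda>_. F1 (half \<rho> n) (half v n) (half \<tau> n) (half q n) \<Psi>)"
    and scheme2: "\<And>n X. \<lbrakk>n < N; X \<in> V0_space p \<Omega> \<T>\<rbrakk> \<Longrightarrow>
      0 = (LINT x|lebesgue_on \<Omega>.
              ((half \<rho> n x / k n) *\<^sub>R (v (Suc n) x - v n x)
               + div_tensor (\<lambda>y. outer (half \<rho> n y *\<^sub>R half v n y) (half v n y)) x
               - div_op (\<lambda>y. half \<rho> n y *\<^sub>R half v n y) x *\<^sub>R half v n x
               + half \<rho> n x *\<^sub>R grad (half \<tau> n) x
               - (1/2 * half \<rho> n x) *\<^sub>R grad (\<lambda>y. (norm (half v n y))\<^sup>2) x) \<bullet> X x)
        + interface_integral \<Omega> \<T> (\<lambda>_. F2 (half \<rho> n) (half v n) (half \<tau> n) (half q n) X)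
        + \<mu> * B (half v n) X"
    and scheme3: "\<And>n \<Xi>. \<lbrakk>n < N; \<Xi> \<in> V_space p \<T>\<rbrakk> \<Longrightarrow>
      0 = (LINT x|lebesgue_on \<Omega>.
              (half \<tau> n x - diff_quot W (\<rho> n x) (\<rho> (Suc n) x) + \<gamma> * div_op (half q n) x
               - 1/4 * ((norm (v (Suc n) x))\<^sup>2 + (norm (v n x))\<^sup>2)) * \<Xi> x)
        + interface_integral \<Omega> \<T> (\<lambda>_. F3 (half \<rho> n) (half v n) (half \<tau> n) (half q n) \<Xi>)"
    and scheme4: "\<And>n. n < N \<Longrightarrow>
      discrete_gradient_eq p \<Omega> \<T> F4 (\<rho> (Suc n)) (v (Suc n)) (\<tau> (Suc n)) (q (Suc n))"
  shows "(\<forall>n\<le>N. (LINT x|lebesgue_on \<Omega>. \<rho> n x) = (LINT x|lebesgue_on \<Omega>. \<rho> 0 x)) \<and>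
    (quadratic_in_state p \<Omega> \<T> F4 \<longrightarrow>
      (\<forall>n<N. (n = 0 \<longrightarrow> discrete_gradient_eq p \<Omega> \<T> F4 (\<rho> 0) (v 0) (\<tau> 0) (q 0)) \<longrightarrow>
        energy \<Omega> W \<gamma> (\<rho> (Suc n)) (v (Suc n)) (q (Suc n)) - energy \<Omega> W \<gamma> (\<rho> n) (v n) (q n)
          = - \<mu> * k n * B (half v n) (half v n)))"
proof -
  interpret triangulated_domain \<sigma> \<Omega> \<T>
    using mesh domain(1) by unfold_locales
  have in_spaces: "\<rho> n \<in> V_space p \<T>" "v n \<in> V0_space p \<Omega> \<T>" "\<tau> n \<in> V_space p \<T>" "q n \<in> Vn_space p \<Omega> \<T>"
    if "n \<le> N" for n
    using that init spaces[of "n - 1"] by (cases n; simp add: L2_projection_def)+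
  have half_eq: "half u n = (\<lambda>x. (1/2) *\<^sub>R u n x + (1/2) *\<^sub>R u (Suc n) x)"
    for u :: "nat \<Rightarrow> real^'d \<Rightarrow> 'b::real_vector" and n
    by (simp add: half_def[abs_def] scaleR_add_right)
  have halves: "half \<rho> n \<in> V_space p \<T>" "half v n \<in> V0_space p \<Omega> \<T>" "half \<tau> n \<in> V_space p \<T>" "half q n \<in> Vn_space p \<Omega> \<T>"
    if "n < N" for n
  proof -
    note now = in_spaces[OF less_imp_le[OF that]] and nxt = in_spaces[OF Suc_leI[OF that]]
    show "half \<rho> n \<in> V_space p \<T>" unfolding half_eq by (rule V_space_linear_combination[OF now(1) nxt(1)])
    show "half v n \<in> V0_space p \<Omega> \<T>" unfolding half_eq by (rule V0_space_linear_combination[OF now(2) nxt(2)])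
    show "half \<tau> n \<in> V_space p \<T>" unfolding half_eq by (rule V_space_linear_combination[OF now(3) nxt(3)])
    show "half q n \<in> Vn_space p \<Omega> \<T>" unfolding half_eq by (rule Vn_space_linear_combination[OF now(4) nxt(4)])
  qed
  have k_pos: "k n > 0" if "n < N" for n using time(4,5)[OF that] by simp
  have mass_step: "(LINT x|lebesgue_on \<Omega>. \<rho> (Suc n) x) = (LINT x|lebesgue_on \<Omega>. \<rho> n x)" if n: "n < N" for n
  proof -
    note rp = V_space_pw_polynomial[OF in_spaces(1)[OF less_imp_le[OF n]]] V_space_pw_polynomial[OF in_spaces(1)[OF Suc_leI[OF n]]]
    let ?m = "\<lambda>y. half \<rho> n y *\<^sub>R half v n y"
    have mp: "pw_polynomial ?m"
      by (rule pw_polynomial_scaleR[OF V_space_pw_polynomial[OF halves(1)[OF n]]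
            V_space_pw_polynomial[OF conjunct1[OF V0_spaceD[OF halves(2)[OF n]]]]])
    have i: "integrable (lebesgue_on \<Omega>) (\<rho> n)" "integrable (lebesgue_on \<Omega>) (\<rho> (Suc n))" "integrable (lebesgue_on \<Omega>) (div_op ?m)"
      by (rule integrable_pw_continuous[OF pw_polynomial_continuous[OF rp(1)]]
          integrable_pw_continuous[OF pw_polynomial_continuous[OF rp(2)]]
          integrable_pw_continuous[OF pw_polynomial_continuous[OF pw_polynomial_div_op[OF mp]]])+
    have "0 = (LINT x|lebesgue_on \<Omega>. (\<rho> (Suc n) x - \<rho> n x) / k n + div_op ?m x)
        + interface_integral \<Omega> \<T> (\<lambda>_. F1 (half \<rho> n) (half v n) (half \<tau> n) (half q n) (\<lambda>_. 1))"
      using scheme1[OF n V_space_const[of 1]] by simp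
    also have "\<dots> = ((LINT x|lebesgue_on \<Omega>. \<rho> (Suc n) x) - (LINT x|lebesgue_on \<Omega>. \<rho> n x)) / k n"
      using i cond_a[OF halves[OF n]] gauss_Vn[OF V_space_pw_polynomial[OF halves(1)[OF n]] V0_space_imp_Vn_space[OF halves(2)[OF n]]] by simp
    finally show ?thesis using k_pos[OF n] by simp
  qed
  have mass: "(LINT x|lebesgue_on \<Omega>. \<rho> n x) = (LINT x|lebesgue_on \<Omega>. \<rho> 0 x)" if "n \<le> N" for n
    using that by (induction n) (simp_all add: mass_step)
  have Wc: "continuous_on UNIV W"
    using W C1_deriv_continuous[OF smooth_imp_C1_deriv] by (auto simp: double_well_def)
  have "energy \<Omega> W \<gamma> (\<rho> (Suc n)) (v (Suc n)) (q (Suc n)) - energy \<Omega> W \<gamma> (\<rho> n) (v n) (q n)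
      = - \<mu> * k n * B (half v n) (half v n)"
    if quad: "quadratic_in_state p \<Omega> \<T> F4" and n: "n < N"
      and start: "n = 0 \<longrightarrow> discrete_gradient_eq p \<Omega> \<T> F4 (\<rho> 0) (v 0) (\<tau> 0) (q 0)" for n
  proof -
    let ?R = "half \<rho> n" and ?V = "half v n" and ?S = "half \<tau> n" and ?Y = "half q n"
    note now = in_spaces[OF less_imp_le[OF n]] and nxt = in_spaces[OF Suc_leI[OF n]] and mid = halves[OF n]
    let ?int = "interface_integral \<Omega> \<T>"
    define I1 where "I1 = ?int (\<lambda>_. F1 ?R ?V ?S ?Y ?S)"
    define I2 where "I2 = ?int (\<lambda>_. F2 ?R ?V ?S ?Y ?V)"
    define dr where "dr = (\<lambda>x. \<rho> (Suc n) x - \<rho> n x)"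
    define dv where "dv = (\<lambda>x. v (Suc n) x - v n x)"
    define ds where "ds = (\<lambda>x. \<tau> (Suc n) x - \<tau> n x)"
    define dq where "dq = (\<lambda>x. q (Suc n) x - q n x)"
    define I3 where "I3 = ?int (\<lambda>_. F3 ?R ?V ?S ?Y dr)"
    define I40 where "I40 = ?int (\<lambda>_. F4 (\<rho> n) (v n) (\<tau> n) (q n) ?Y)"
    define I41 where "I41 = ?int (\<lambda>_. F4 (\<rho> (Suc n)) (v (Suc n)) (\<tau> (Suc n)) (q (Suc n)) ?Y)"
    have diffs: "dr \<in> V_space p \<T>" "dv \<in> V0_space p \<Omega> \<T>" "ds \<in> V_space p \<T>" "dq \<in> Vn_space p \<Omega> \<T>"
      using V_space_linear_combination[OF nxt(1) now(1), of 1 "-1"] V0_space_linear_combination[OF nxt(2) now(2), of 1 "-1"]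
        V_space_linear_combination[OF nxt(3) now(3), of 1 "-1"] Vn_space_linear_combination[OF nxt(4) now(4), of 1 "-1"]
      by (simp_all add: dr_def dv_def ds_def dq_def)
    note midH = discrete_spaces_broken_H1(1)[OF mid(1)] discrete_spaces_broken_H1(2)[OF mid(2)]
      discrete_spaces_broken_H1(1)[OF mid(3)] discrete_spaces_broken_H1(3)[OF mid(4)]
    note midp = V_space_pw_polynomial[OF mid(1)] V_space_pw_polynomial[OF conjunct1[OF V0_spaceD[OF mid(2)]]]
      V_space_pw_polynomial[OF mid(3)] V_space_pw_polynomial[OF conjunct1[OF Vn_spaceD[OF mid(4)]]]
    \<comment> \<open>Constant paths turn the first condition on the fluxes into one on the midpoint state.\<close>
    have flux12: "I1 + I2 + ?int (jump \<T> (\<lambda>z. (?R z * ?S z) *\<^sub>R ?V z)) = 0"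
    proof -
      have "?int (\<lambda>F x. F1 ?R ?V ?S ?Y ?S x + F2 ?R ?V ?S ?Y ?V x + jump \<T> (\<lambda>z. (?R z * ?S z) *\<^sub>R ?V z) F x) = 0"
        using time(1)
        by (intro cond_b1[of "\<lambda>_. ?R" "\<lambda>_. ?V" "\<lambda>_. ?S" "\<lambda>_. ?Y" 0] smooth_path_constant mid
            zero_in_V_space zero_in_V0_space[OF mid(2)] zero_in_Vn_space[OF mid(4)]) simp
      moreover have "skeleton_integrable (\<lambda>_. F1 ?R ?V ?S ?Y ?S)" "skeleton_integrable (\<lambda>_. F2 ?R ?V ?S ?Y ?V)"
        by (intro skeleton_integrable_L2 trace_flux_L2[OF fluxes(1)] trace_flux_L2[OF fluxes(2)] midH)+
      moreover have "skeleton_integrable (jump \<T> (\<lambda>z. (?R z * ?S z) *\<^sub>R ?V z))"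
        by (intro skeleton_integrable_jump pw_polynomial_scaleR pw_polynomial_mult midp)
      ultimately show ?thesis
        by (simp only: interface_integral_add skeleton_integrable_add I1_def I2_def)
    qed
    \<comment> \<open>For the second condition take the straight line through the old and the new state that
      passes through their midpoint at time \<open>\<theta>\<close> and has the full increments as its velocity; the
      two states are reached at \<open>\<theta> - 1/2\<close> and \<open>\<theta> + 1/2\<close>.  As the line consists of discrete states
      for all real parameters, these times may lie outside \<open>{0..T}\<close>.\<close>
    define \<theta> where "\<theta> = T / 2"
    have \<theta>: "\<theta> \<in> {0..T}" using time(1) by (simp add: \<theta>_def)
    let ?r = "\<lambda>\<eta> x. ?R x + (\<eta> - \<theta>) *\<^sub>R dr x" and ?w = "\<lambda>\<eta> x. ?V x + (\<eta> - \<theta>) *\<^sub>R dv x"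
    let ?s = "\<lambda>\<eta> x. ?S x + (\<eta> - \<theta>) *\<^sub>R ds x" and ?y = "\<lambda>\<eta> x. ?Y x + (\<eta> - \<theta>) *\<^sub>R dq x"
    have line: "?r \<eta> \<in> V_space p \<T>" "?w \<eta> \<in> V0_space p \<Omega> \<T>" "?s \<eta> \<in> V_space p \<T>" "?y \<eta> \<in> Vn_space p \<Omega> \<T>" for \<eta>
      using V_space_linear_combination[OF mid(1) diffs(1), of 1 "\<eta> - \<theta>"] V0_space_linear_combination[OF mid(2) diffs(2), of 1 "\<eta> - \<theta>"]
        V_space_linear_combination[OF mid(3) diffs(3), of 1 "\<eta> - \<theta>"] Vn_space_linear_combination[OF mid(4) diffs(4), of 1 "\<eta> - \<theta>"]
      by simp_all
    obtain D where D: "has_L2_derivative \<Omega> \<T> T (\<lambda>\<eta>. F4 (?r \<eta>) (?w \<eta>) (?s \<eta>) (?y \<eta>) (?y \<theta>)) D \<theta>"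
      and D_int: "?int (\<lambda>F x. F3 (?r \<theta>) (?w \<theta>) (?s \<theta>) (?y \<theta>) (dt T ?r \<theta>) x - \<gamma> * D x
          + \<gamma> * jump \<T> (\<lambda>z. dt T ?r \<theta> z *\<^sub>R ?y \<theta> z) F x) = 0"
      using cond_b2[OF smooth_path_affine[OF line(1) diffs(1) zero_in_V_space]
          smooth_path_affine[OF line(2) diffs(2) zero_in_V0_space[OF mid(2)]]
          smooth_path_affine[OF line(3) diffs(3) zero_in_V_space]
          smooth_path_affine[OF line(4) diffs(4) zero_in_Vn_space[OF mid(4)]] \<theta>]
      by (elim exE conjE) (rule that)
    have mid_point: "?r \<theta> = ?R" "?w \<theta> = ?V" "?s \<theta> = ?S" "?y \<theta> = ?Y" by simp_all
    have dt_r: "dt T ?r \<theta> = dr" by (rule dt_affine[OF time(1) \<theta>])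
    let ?g = "\<lambda>\<eta>. F4 (?r \<eta>) (?w \<eta>) (?s \<eta>) (?y \<eta>) ?Y"
    obtain a b c where "\<forall>s. ?int (\<lambda>_. F4 (\<lambda>x. ?R x + s * dr x) (\<lambda>x. ?V x + s *\<^sub>R dv x)
        (\<lambda>x. ?S x + s * ds x) (\<lambda>x. ?Y x + s *\<^sub>R dq x) ?Y) = a + b * s + c * s\<^sup>2"
      using quad[unfolded quadratic_in_state_def, rule_format, OF mid diffs mid(4)] by (elim exE) (rule that)
    then have quadratic: "?int (\<lambda>_. ?g \<eta>) = a + b * (\<eta> - \<theta>) + c * (\<eta> - \<theta>)\<^sup>2" for \<eta>
      by (simp only: real_scaleR_def)
    have gL2: "?g \<eta> \<in> L2_interfaces \<Omega> \<T>" for \<eta>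
      by (intro trace_flux_L2[OF fluxes(4)] discrete_spaces_broken_H1(1)[OF line(1)] discrete_spaces_broken_H1(2)[OF line(2)]
          discrete_spaces_broken_H1(1)[OF line(3)] discrete_spaces_broken_H1(3)[OF line(4)] midH)
    have D_b: "?int (\<lambda>_. D) = b"
      by (rule interface_integral_L2_derivative[OF time(1) \<theta> gL2 D[unfolded mid_point] quadratic])
    have ends: "\<rho> (Suc n) = ?r (\<theta> + 1/2)" "v (Suc n) = ?w (\<theta> + 1/2)" "\<tau> (Suc n) = ?s (\<theta> + 1/2)" "q (Suc n) = ?y (\<theta> + 1/2)"
      "\<rho> n = ?r (\<theta> - 1/2)" "v n = ?w (\<theta> - 1/2)" "\<tau> n = ?s (\<theta> - 1/2)" "q n = ?y (\<theta> - 1/2)"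
      by (simp_all add: half_def dr_def dv_def ds_def dq_def scaleR_add_right scaleR_diff_right scaleR_half_double fun_eq_iff field_simps)
    have "I41 = ?int (\<lambda>_. ?g (\<theta> + 1/2))" "I40 = ?int (\<lambda>_. ?g (\<theta> - 1/2))"
      unfolding I41_def I40_def by (simp_all only: ends[symmetric])
    \<comment> \<open>The increment of a quadratic polynomial over an interval of length one is its derivative
      at the midpoint.\<close>
    then have I4: "I41 - I40 = b" unfolding quadratic by (simp add: power2_eq_square)
    have flux34: "I3 - \<gamma> * (I41 - I40) + \<gamma> * ?int (jump \<T> (\<lambda>z. (\<rho> (Suc n) z - \<rho> n z) *\<^sub>R ?Y z)) = 0"
    proof -
      have si: "skeleton_integrable (\<lambda>_. F3 ?R ?V ?S ?Y dr)" "skeleton_integrable (\<lambda>_. D)"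
        "skeleton_integrable (jump \<T> (\<lambda>z. dr z *\<^sub>R ?Y z))"
        using D by (auto simp: has_L2_derivative_def intro!: skeleton_integrable_L2 trace_flux_L2[OF fluxes(3)] midH
            discrete_spaces_broken_H1(1)[OF diffs(1)] skeleton_integrable_jump pw_polynomial_scaleR midp V_space_pw_polynomial[OF diffs(1)])
      have "?int (\<lambda>F x. F3 ?R ?V ?S ?Y dr x + (- \<gamma>) * D x + \<gamma> * jump \<T> (\<lambda>z. dr z *\<^sub>R ?Y z) F x) = 0"
        using D_int unfolding dt_r mid_point by simp
      then have "I3 + (- \<gamma>) * ?int (\<lambda>_. D) + \<gamma> * ?int (jump \<T> (\<lambda>z. dr z *\<^sub>R ?Y z)) = 0"
        using si by (simp only: interface_integral_add interface_integral_cmult skeleton_integrable_add skeleton_integrable_cmult I3_def)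
      then show ?thesis by (simp add: D_b I4 dr_def)
    qed
    have grad0: "discrete_gradient_eq p \<Omega> \<T> F4 (\<rho> n) (v n) (\<tau> n) (q n)"
      using start scheme4[of "n - 1"] n by (cases n) auto
    have gradients: "0 = (LINT x|lebesgue_on \<Omega>. (q n x - grad (\<rho> n) x) \<bullet> ?Y x) + I40"
      "0 = (LINT x|lebesgue_on \<Omega>. (q (Suc n) x - grad (\<rho> (Suc n)) x) \<bullet> ?Y x) + I41"
      using grad0 scheme4[OF n] mid(4) unfolding I40_def I41_def discrete_gradient_eq_def by blast+
    have half_mean: "half u n = (\<lambda>x. (1/2) *\<^sub>R (u n x + u (Suc n) x))"
      for u :: "nat \<Rightarrow> real^'d \<Rightarrow> 'b::real_vector"
      by (simp add: half_def[abs_def])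
    have "energy \<Omega> W \<gamma> (\<rho> (Suc n)) (v (Suc n)) (q (Suc n)) - energy \<Omega> W \<gamma> (\<rho> n) (v n) (q n)
        = - k n * (\<mu> * B ?V ?V)"
      by (rule energy_balance[OF Wc k_pos[OF n] now(1) nxt(1) mid(3) now(2) nxt(2) now(4) nxt(4)
            half_mean half_mean half_mean scheme1[OF n mid(3), folded I1_def]
            scheme2[OF n mid(2), folded I2_def] scheme3[OF n diffs(1), folded I3_def, unfolded dr_def]
            gradients flux12 flux34])
    then show ?thesis by (simp add: mult_ac)
  qed
  with mass show ?thesis by blast
qed

end
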